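(* Let $\omega$ be a radial weight, $1<p<\infty$ and $k\in\mathbb{N}$. Then the following statements are equivalent: (i) $P_\omega:L^p_\omega\to D^p_{\omega,k}$ is bounded; (ii) there exists $C=C(\omega)>0$ such that for each $L\in(A^{p'}_\omega)^\star$ there is a unique $g\in D^p_{\omega,k}$ such that $L(f)=\langle f,g\rangle_{A^2_\omega}$ for all $f\in A^{p'}_\omega$ and $\|g\|_{D^p_{\omega,k}}\le C\|L\|$ (that is, $(A^{p'}_\omega)^\star$ is continuously embedded into $D^p_{\omega,k}$); (iii) the identity operator $I_d:A^p_\omega\to D^p_{\omega,k}$ is bounded; (iv) $\omega\in\widehat{\mathcal{D}}$.
   Context: $\mathbb{D}$ is the open unit disc of $\mathbb{C}$, $\mathcal{H}(\mathbb{D})$ the space of analytic functions in $\mathbb{D}$, and $dA(z)=\frac{dx\,dy}{\pi}$. A radial weight is a nonnegative function $\omega\in L^1([0,1))$ extended to $\mathbb{D}$ by $\omega(z)=\omega(|z|)$; it is assumed throughout that $\widehat{\omega}(z)=\int_{|z|}^1\omega(s)\,ds>0$ for all $z\in\mathbb{D}$. $\omega\in\widehat{\mathcal{D}}$ if there is $C\ge1$ with $\widehat{\omega}(r)\le C\widehat{\omega}\left(\frac{1+r}{2}\right)$ for all $0\le r<1$. $L^p_\omega$ is the space of measurable $f$ on $\mathbb{D}$ with $\|f\|_{L^p_\omega}^p=\int_{\mathbb{D}}|f(z)|^p\omega(z)\,dA(z)<\infty$, and $A^p_\omega=L^p_\omega\cap\mathcal{H}(\mathbb{D})$. $p'$ is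 the conjugate exponent, $\frac1p+\frac1{p'}=1$. Write $\omega_{[\beta]}(z)=\omega(z)(1-|z|)^\beta$. The Dirichlet-type space $D^p_{\omega,k}$ consists of $f\in\mathcal{H}(\mathbb{D})$ with $\|f\|_{D^p_{\omega,k}}=\|f^{(k)}\|_{A^p_{\omega_{[kp]}}}+\sum_{j=0}^k|f^{(j)}(0)|<\infty$. Write $\omega_x=\int_0^1r^x\omega(r)\,dr$ for $x\ge0$. The Bergman projection is $P_\omega(f)(z)=\int_{\mathbb{D}}f(\zeta)\overline{B^\omega_z(\zeta)}\,\omega(\zeta)\,dA(\zeta)$, where $B^\omega_z(\zeta)=\sum_{n=0}^\infty\frac{(\overline{z}\zeta)^n}{2\omega_{2n+1}}$ is the reproducing kernel of $A^2_\omega$. $X^\star$ is the dual of $X$. The $A^2_\omega$-pairing is $\langle f,g\rangle_{A^2_\omega}=\lim_{r\to1^-}\int_{\mathbb{D}}f_r(z)\overline{g(z)}\,\omega(z)\,dA(z)$, where $f_r(z)=f(rz)$. *)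

theory Defs
  imports "HOL-Analysis.Analysis"
begin

abbreviation disc :: "complex set" where
  "disc \<equiv> ball 0 1"

definition area_measure :: "complex measure" where
  "area_measure = scale_measure (ennreal (1 / pi)) (lebesgue_on disc)"

text \<open>
  A radial weight is given by its profile \<open>w\<close> on \<open>{0..<1}\<close>; the weight on the
  disc is \<open>\<lambda>z. w (norm z)\<close>. Values of \<open>w\<close> outside \<open>{0..<1}\<close>, and values of functions
  on the disc outside \<open>disc\<close>, play no role.
\<close>

definition weight_tail :: "(real \<Rightarrow> real) \<Rightarrow> real \<Rightarrow> real" where
  "weight_tail w r = (LINT s|lebesgue_on {r..<1}. w s)"

definition radial_weight :: "(real \<Rightarrow> real) \<Rightarrow> bool" where
  "radial_weight w \<longleftrightarrow>
     (\<forall>r\<in>{0..<1}. 0 \<le> w r) \<and> integrable (lebesgue_on {0..<1}) w \<and>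
     (\<forall>r\<in>{0..<1}. 0 < weight_tail w r)"

definition upper_doubling :: "(real \<Rightarrow> real) \<Rightarrow> bool" where
  "upper_doubling w \<longleftrightarrow>
     (\<exists>C\<ge>1. \<forall>r\<in>{0..<1}. weight_tail w r \<le> C * weight_tail w ((1 + r) / 2))"

definition weight_moment :: "(real \<Rightarrow> real) \<Rightarrow> real \<Rightarrow> real" where
  "weight_moment w x = (LINT r|lebesgue_on {0..<1}. r powr x * w r)"

definition weight_times_dist :: "(real \<Rightarrow> real) \<Rightarrow> real \<Rightarrow> real \<Rightarrow> real" where
  "weight_times_dist w \<beta> r = w r * (1 - r) powr \<beta>"

definition Lp_space :: "real \<Rightarrow> (real \<Rightarrow> real) \<Rightarrow> (complex \<Rightarrow> complex) set" where
  "Lp_space p w =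
     {f \<in> borel_measurable (lebesgue_on disc).
        integrable area_measure (\<lambda>z. norm (f z) powr p * w (norm z))}"

definition Lp_norm :: "real \<Rightarrow> (real \<Rightarrow> real) \<Rightarrow> (complex \<Rightarrow> complex) \<Rightarrow> real" where
  "Lp_norm p w f = (LINT z|area_measure. norm (f z) powr p * w (norm z)) powr (1 / p)"

definition bergman_space :: "real \<Rightarrow> (real \<Rightarrow> real) \<Rightarrow> (complex \<Rightarrow> complex) set" where
  "bergman_space p w = Lp_space p w \<inter> {f. f holomorphic_on disc}"

definition dirichlet_space ::
    "real \<Rightarrow> (real \<Rightarrow> real) \<Rightarrow> nat \<Rightarrow> (complex \<Rightarrow> complex) set" where
  "dirichlet_space p w k =
     {f. f holomorphic_on disc \<and>
         (deriv ^^ k) f \<in> bergman_space p (weight_times_dist w (real k * p))}"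

definition dirichlet_norm ::
    "real \<Rightarrow> (real \<Rightarrow> real) \<Rightarrow> nat \<Rightarrow> (complex \<Rightarrow> complex) \<Rightarrow> real" where
  "dirichlet_norm p w k f =
     Lp_norm p (weight_times_dist w (real k * p)) ((deriv ^^ k) f) +
     (\<Sum>j=0..k. norm ((deriv ^^ j) f 0))"

definition bergman_kernel :: "(real \<Rightarrow> real) \<Rightarrow> complex \<Rightarrow> complex \<Rightarrow> complex" where
  "bergman_kernel w z \<zeta> =
     (\<Sum>n. (cnj z * \<zeta>) ^ n / complex_of_real (2 * weight_moment w (2 * real n + 1)))"

definition bergman_projection ::
    "(real \<Rightarrow> real) \<Rightarrow> (complex \<Rightarrow> complex) \<Rightarrow> complex \<Rightarrow> complex" where
  "bergman_projection w f z =
     (LINT \<zeta>|area_measure. f \<zeta> * cnj (bergman_kernel w z \<zeta>) * complex_of_real (w (norm \<zeta>)))"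

text \<open>
  The pairing is a relation rather than a function: it asserts that the integrals and
  their limit exist. A function in \<open>dirichlet_space p w k\<close> need not be integrable
  against \<open>w\<close>, and the default value of a divergent integral must not count as a pairing.
\<close>

definition has_A2_pairing ::
    "(real \<Rightarrow> real) \<Rightarrow> (complex \<Rightarrow> complex) \<Rightarrow> (complex \<Rightarrow> complex) \<Rightarrow> complex \<Rightarrow> bool" where
  "has_A2_pairing w f g c \<longleftrightarrow>
     (\<forall>r\<in>{0<..<1}. integrable area_measure
        (\<lambda>z. f (complex_of_real r * z) * cnj (g z) * complex_of_real (w (norm z)))) \<and>
     ((\<lambda>r. LINT z|area_measure.
        f (complex_of_real r * z) * cnj (g z) * complex_of_real (w (norm z))) \<longlongrightarrow> c) (at_left 1)"

text \<open>
  The elements of the space are functions on all of \<open>complex\<close>; linearity and boundedness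
  together force a functional to depend only on the restriction to \<open>disc\<close>.
\<close>

definition bergman_dual ::
    "real \<Rightarrow> (real \<Rightarrow> real) \<Rightarrow> ((complex \<Rightarrow> complex) \<Rightarrow> complex) set" where
  "bergman_dual q w =
     {L. (\<forall>f\<in>bergman_space q w. \<forall>g\<in>bergman_space q w. L (\<lambda>z. f z + g z) = L f + L g) \<and>
         (\<forall>a. \<forall>f\<in>bergman_space q w. L (\<lambda>z. a * f z) = a * L f) \<and>
         (\<exists>M. \<forall>f\<in>bergman_space q w. norm (L f) \<le> M * Lp_norm q w f)}"

definition bergman_dual_norm ::
    "real \<Rightarrow> (real \<Rightarrow> real) \<Rightarrow> ((complex \<Rightarrow> complex) \<Rightarrow> complex) \<Rightarrow> real" where
  "bergman_dual_norm q w L =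
     (SUP f\<in>{f \<in> bergman_space q w. Lp_norm q w f \<le> 1}. norm (L f))"

text \<open>
  Linearity is not part of this notion: it is meant for maps that are evidently linear, such as
  \<open>bergman_projection w\<close> and the identity.
\<close>

definition bounded_between ::
    "'a set \<Rightarrow> ('a \<Rightarrow> real) \<Rightarrow> 'b set \<Rightarrow> ('b \<Rightarrow> real) \<Rightarrow> ('a \<Rightarrow> 'b) \<Rightarrow> bool" where
  "bounded_between X normX Y normY T \<longleftrightarrow>
     (\<exists>C. \<forall>x\<in>X. T x \<in> Y \<and> normY (T x) \<le> C * normX x)"

end

theory Submission
  imports Defs "HOL-Complex_Analysis.Complex_Analysis"
begin

text \<open>
  The class of upper doubling weights enters only through one observation: superlevel sets of a
  nondecreasing function \<open>\<phi>\<close> are intervals ending at 1, so doubling gives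
  \<open>\<integral> \<phi>((1 + r) / 2) w \<le> C \<integral> \<phi> w\<close>. Applied to the integral means of \<open>f\<close>, together with Cauchy's
  estimate \<open>(1 - r)^k M_p(r, f^(k)) \<le> c M_p((1 + r) / 2, f)\<close>, this is (iii). Applied to powers
  of \<open>r\<close>, with \<open>sqrt r \<le> (1 + r) / 2\<close>, it makes the moments doubling. Conversely, testing (iii) on
  \<open>z^n\<close> shows that at least half of the moment of order \<open>n p + 1\<close> comes from \<open>1 - r \<le> K / n\<close>, which
  gives doubling of moments and then of tails.

  For (ii), a functional \<open>L\<close> can only be represented by the power series with coefficients
  \<open>cnj (L (z^n)) / (2 w_(2n+1))\<close>. The frequencies are cut into blocks on which the moments
  \<open>w_(2n+1)\<close> agree up to a factor 2. The M. Riesz theorem makes the multiplier \<open>1 / w_(2n+1)\<close> harmless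
  on each block, and a discrete Hardy inequality reassembles the blocks, so that the series is even
  in the Bergman space with exponent \<open>p\<close>. In particular it is integrable against the weight, which
  membership in the Dirichlet-type space alone would not give. Statement (i) follows from (ii) applied
  to the functionals \<open>h \<mapsto> \<integral> h cnj f w\<close>, and (iii) from (i) since the projection fixes analytic
  functions.

  Normalized arc length is obtained as the image of normalized area under \<open>z \<mapsto> z / |z|\<close>; rotation
  invariance of area then yields orthogonality of the powers and polar coordinates without
  introducing angles.
\<close>

section \<open>Normalized arc length\<close>

text \<open>The implications form the cycle (ii) => (i) => (iii) => (iv) => (ii), and the last is
  the hard one. The kernel has no closed form, so nothing is estimated through its size; all
  information passes through coefficients. Pairing \<open>g\<close> with \<open>z^n\<close>
  multiplies a coefficient by \<open>2 w_(2n+1)\<close>, whereas the norm of \<open>z^n\<close> with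
  exponent \<open>q\<close> involves \<open>w_(nq+1)\<close>; doubling lets one dyadic scale of
  moments serve every exponent. The block estimate is an upper bound only: the q-th power of the
  norm of a sum of blocks \<open>G_n\<close> is at most a constant times the sum of
  \<open>2^-n ||G_n||_q^q\<close>, with norms over the circle. In place of a matching lower bound,
  \<open>L\<close> is tested on a function \<open>F\<close> assembled from the dual functions
  \<open>|G_n|^(p-1) sgn G_n\<close>. Then \<open>L F\<close> is exactly the sum \<open>X\<close> of
  \<open>2^-n ||G_n||_p^p\<close>, the upper bound for exponent \<open>q\<close> gives
  \<open>||F|| \<le> c X^(1/q)\<close>, hence \<open>X^(1/p) \<le> c ||L||\<close>, and the upper
  bound for exponent \<open>p\<close> turns this into the norm of \<open>g\<close>.\<close>

lemma ball_borel_measurable [measurable]: "ball (a::'a::euclidean_space) r \<in> sets borel"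
  by simp

text \<open>Integrate \<open>indicator A x * indicator ?B (x - T y)\<close> over x and y in both
  orders, \<open>?B\<close> being the unit ball. Translation invariance and
  \<open>norm (T y) = norm y\<close> give |A| |B| in one order and |B| times the measure of the
  preimage of A in the other; the finite positive factor |B| cancels. No determinant is
  involved.\<close>

lemma lborel_distr_isometry:
  fixes T :: "'a::euclidean_space \<Rightarrow> 'a"
  assumes lin: "linear T" and iso: "\<And>x. norm (T x) = norm x" and surj: "surj T"
  shows "distr lborel borel T = lborel"
proof (rule measure_eqI)
  show "sets (distr lborel borel T) = sets lborel" by simp
  fix A :: "'a set" assume "A \<in> sets (distr lborel borel T)"
  then have A[measurable]: "A \<in> sets borel" by simp
  have [measurable]: "T \<in> borel_measurable borel"
    using lin by (intro borel_measurable_continuous_onI linear_continuous_on linear_conv_bounded_linear[THEN iffD1])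
  let ?B = "ball 0 1 :: 'a set"
  let ?m = "emeasure lborel ?B"
  have shift: "(\<integral>\<^sup>+y. f (y + a) \<partial>lborel) = (\<integral>\<^sup>+y. f y \<partial>lborel)"
    if [measurable]: "f \<in> borel_measurable borel" for f :: "'a \<Rightarrow> ennreal" and a
  proof -
    have "(\<integral>\<^sup>+y. f y \<partial>lborel) = (\<integral>\<^sup>+y. f y \<partial>(distr lborel borel ((+) a)))"
      by (simp add: lborel_distr_plus)
    also have "\<dots> = (\<integral>\<^sup>+y. f (a + y) \<partial>lborel)"
      by (subst nn_integral_distr) auto
    finally show ?thesis by (simp add: add.commute)
  qed
  have 1: "(\<integral>\<^sup>+x. \<integral>\<^sup>+y. indicator A x * indicator ?B (x - T y) \<partial>lborel \<partial>lborel) = emeasure lborel A * ?m"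
  proof -
    have "(\<integral>\<^sup>+y. indicator A x * indicator ?B (x - T y) \<partial>lborel) = indicator A x * ?m" for x
    proof -
      obtain x' where x': "x = T x'" using surj by auto
      have "indicator ?B (x - T y) = (indicator ?B (y + (-x')) :: ennreal)" for y
      proof -
        have "x - T y = T (x' - y)" using x' lin by (simp add: linear_diff)
        then have "norm (x - T y) = norm (y + (-x'))"
          using iso[of "x' - y"] by (simp add: norm_minus_commute)
        then show ?thesis by (simp add: indicator_def)
      qed
      then have "(\<integral>\<^sup>+y. indicator A x * indicator ?B (x - T y) \<partial>lborel)
          = (\<integral>\<^sup>+y. indicator A x * indicator ?B (y + (-x')) \<partial>lborel)" by presburger
      also have "\<dots> = indicator A x * (\<integral>\<^sup>+y. indicator ?B (y + (-x')) \<partial>lborel)"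
        by (rule nn_integral_cmult) measurable
      also have "(\<integral>\<^sup>+y. indicator ?B (y + (-x')) \<partial>lborel) = ?m"
        using shift[of "indicator ?B" "-x'"] by simp
      finally show ?thesis .
    qed
    then show ?thesis by (simp add: nn_integral_multc)
  qed
  have 2: "(\<integral>\<^sup>+y. \<integral>\<^sup>+x. indicator A x * indicator ?B (x - T y) \<partial>lborel \<partial>lborel)
      = ?m * (\<integral>\<^sup>+y. indicator A (T y) \<partial>lborel)"
  proof -
    have "(\<integral>\<^sup>+x. indicator A x * indicator ?B (x - T y) \<partial>lborel)
        = (\<integral>\<^sup>+x. indicator A (x + T y) * indicator ?B x \<partial>lborel)" for y
      using shift[of "\<lambda>x. indicator A x * indicator ?B (x - T y)" "T y"] by simp
    then have "(\<integral>\<^sup>+y. \<integral>\<^sup>+x. indicator A x * indicator ?B (x - T y) \<partial>lborel \<partial>lborel)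
       = (\<integral>\<^sup>+y. \<integral>\<^sup>+x. indicator A (x + T y) * indicator ?B x \<partial>lborel \<partial>lborel)" by simp
    also have "\<dots> = (\<integral>\<^sup>+x. \<integral>\<^sup>+y. indicator A (x + T y) * indicator ?B x \<partial>lborel \<partial>lborel)"
      by (rule lborel_pair.Fubini') measurable
    also have "\<dots> = (\<integral>\<^sup>+x. indicator ?B x * (\<integral>\<^sup>+y. indicator A (T y) \<partial>lborel) \<partial>lborel)"
    proof (intro nn_integral_cong)
      fix x
      obtain x' where x': "x = T x'" using surj by auto
      have "(\<integral>\<^sup>+y. indicator A (x + T y) * indicator ?B x \<partial>lborel)
          = indicator ?B x * (\<integral>\<^sup>+y. indicator A (x + T y) \<partial>lborel)"
        by (subst nn_integral_cmult[symmetric]) (auto simp: mult.commute)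
      also have "(\<integral>\<^sup>+y. indicator A (x + T y) \<partial>lborel) = (\<integral>\<^sup>+y. (indicator A (T (y + x')) :: ennreal) \<partial>lborel)"
        using lin by (simp add: x' linear_add add.commute)
      also have "\<dots> = (\<integral>\<^sup>+y. indicator A (T y) \<partial>lborel)"
        by (rule shift) measurable
      finally show "(\<integral>\<^sup>+y. indicator A (x + T y) * indicator ?B x \<partial>lborel)
          = indicator ?B x * (\<integral>\<^sup>+y. indicator A (T y) \<partial>lborel)" .
    qed
    also have "\<dots> = ?m * (\<integral>\<^sup>+y. indicator A (T y) \<partial>lborel)"
      by (simp add: nn_integral_multc)
    finally show ?thesis .
  qed
  have "emeasure lborel A * ?m = ?m * (\<integral>\<^sup>+y. indicator A (T y) \<partial>lborel)"
    unfolding 1[symmetric] 2[symmetric] by (rule lborel_pair.Fubini'[symmetric]) measurable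
  moreover have "?m \<noteq> 0" "?m \<noteq> \<infinity>"
    using emeasure_lborel_ball_finite[of "0::'a" 1] content_ball_pos[of 1 "0::'a"]
    by (auto simp: measure_def less_top)
  ultimately have "emeasure lborel A = (\<integral>\<^sup>+y. indicator A (T y) \<partial>lborel)"
    by (metis ennreal_mult_cancel_left infinity_ennreal_def mult.commute)
  also have "\<dots> = emeasure (distr lborel borel T) A"
    using A nn_integral_distr[of T lborel borel "indicator A"] by simp
  finally show "emeasure (distr lborel borel T) A = emeasure lborel A" by simp
qed

section \<open>Normalized area on the disc\<close>

lemma space_area [simp]: "space area_measure = disc"
  by (simp add: area_measure_def space_restrict_space space_scale_measure)

lemma sets_area: "sets area_measure = sets (lebesgue_on disc)"
  by (simp add: area_measure_def)

lemma measurable_area_iff: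
  "f \<in> measurable area_measure N \<longleftrightarrow> f \<in> measurable (lebesgue_on disc) N"
  by (simp add: measurable_def sets_area space_restrict_space)

lemma measurable_area_lborel:
  assumes "f \<in> measurable (restrict_space borel disc) N" 
  shows "f \<in> measurable area_measure N"
  unfolding measurable_area_iff
proof (rule measurableI)
  fix x assume "x \<in> space (lebesgue_on disc)" then show "f x \<in> space N"
    using assms by (auto simp: measurable_def space_restrict_space)
next
  fix A assume "A \<in> sets N"
  then have "f -` A \<inter> disc \<in> sets (restrict_space borel disc)"
    using assms by (auto simp: measurable_def space_restrict_space)
  then show "f -` A \<inter> space (lebesgue_on disc) \<in> sets (lebesgue_on disc)"
    by (auto simp: sets_restrict_space space_restrict_space)
qed

lemma measurable_area_borel [measurable (raw)]:
  "f \<in> measurable borel N \<Longrightarrow> f \<in> measurable area_measure N"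
  by (intro measurable_area_lborel measurable_restrict_space1)

lemma borel_measurable_area_continuous:
  "continuous_on disc f \<Longrightarrow> f \<in> borel_measurable area_measure"
  by (intro measurable_area_lborel borel_measurable_continuous_on_restrict)

lemma nn_integral_area:
  assumes "F \<in> borel_measurable area_measure"
  shows "(\<integral>\<^sup>+z. F z \<partial>area_measure) = ennreal (1 / pi) * (\<integral>\<^sup>+z. F z * indicator disc z \<partial>lborel)"
proof -
  have "F \<in> borel_measurable (lebesgue_on disc)"
    using assms by (simp add: measurable_area_iff)
  then have "(\<integral>\<^sup>+z. F z \<partial>area_measure) = ennreal (1 / pi) * (\<integral>\<^sup>+z. F z \<partial>lebesgue_on disc)"
    unfolding area_measure_def by (rule nn_integral_scale_measure)
  also have "(\<integral>\<^sup>+z. F z \<partial>lebesgue_on disc) = (\<integral>\<^sup>+z. F z * indicator disc z \<partial>lebesgue)"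
    by (rule nn_integral_restrict_space) simp
  finally show ?thesis unfolding nn_integral_completion .
qed

lemma emeasure_area_ball: 
  assumes "0 \<le> r" "r \<le> 1" shows "emeasure area_measure (ball 0 r) = ennreal (r\<^sup>2)"
proof -
  have "emeasure area_measure (ball 0 r) = (\<integral>\<^sup>+z. indicator (ball 0 r) z \<partial>area_measure)"
    using assms by (subst nn_integral_indicator) (auto simp: sets_area sets_restrict_space intro!: image_eqI[of _ _ "ball 0 r"])
  also have "\<dots> = ennreal (1/pi) * (\<integral>\<^sup>+z. indicator (ball (0::complex) r) z \<partial>lborel)"
  proof (subst nn_integral_area)
    have "indicator (ball 0 r) z * indicator disc z = (indicator (ball (0::complex) r) z :: ennreal)" for z
      using assms by (auto simp: indicator_def)
    then show "ennreal (1/pi) * (\<integral>\<^sup>+z. indicator (ball 0 r) z * indicator disc z \<partial>lborel)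
        = ennreal (1/pi) * (\<integral>\<^sup>+z. indicator (ball (0::complex) r) z \<partial>lborel)" by simp
  qed measurable
  also have "\<dots> = ennreal (1/pi) * ennreal (pi * r^2)"
    using content_ball[of r "0::complex"] assms emeasure_lborel_ball_finite[of "0::complex" r]
    by (simp add: emeasure_eq_ennreal_measure eval_unit_ball_vol)
  also have "\<dots> = ennreal (r^2)"
    by (subst ennreal_mult[symmetric]) auto
  finally show ?thesis .
qed

lemma emeasure_area_disc: "emeasure area_measure disc = 1"
  using emeasure_area_ball[of 1] by simp

interpretation area: finite_measure area_measure
  by (rule finite_measureI) (simp add: emeasure_area_disc)

lemma nn_integral_area_rotate:
  assumes "norm c = 1" and [measurable]: "F \<in> borel_measurable borel"
  shows "(\<integral>\<^sup>+z. F (c * z) \<partial>area_measure) = (\<integral>\<^sup>+z. F z \<partial>area_measure)"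
proof -
  have "distr lborel borel ((*) c) = lborel"
  proof (rule lborel_distr_isometry)
    show "surj ((*) c)"
      using assms(1) by (intro surjI[where f="\<lambda>x. x / c"]) auto
    show "linear ((*) c)" by (simp add: linear_times)
  qed (use assms in \<open>auto simp: norm_mult\<close>)
  then have "(\<integral>\<^sup>+z. F z * indicator disc z \<partial>lborel)
      = (\<integral>\<^sup>+z. F z * indicator disc z \<partial>distr lborel borel ((*) c))" by simp
  also have "\<dots> = (\<integral>\<^sup>+z. F (c * z) * indicator disc (c * z) \<partial>lborel)"
    by (rule nn_integral_distr) measurable
  also have "\<dots> = (\<integral>\<^sup>+z. F (c * z) * indicator disc z \<partial>lborel)"
    using assms by (intro nn_integral_cong) (auto simp: indicator_def norm_mult)
  finally show ?thesis by (simp add: nn_integral_area)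
qed

section \<open>The circle and its rotation invariant measure\<close>

definition circle :: "complex set" where "circle = sphere 0 1"

text \<open>The value 1 at the origin keeps every direction on the circle, so that the image measure
  lives exactly on \<open>circle\<close> and \<open>norm_times_direction\<close> has no
  exception.\<close>

definition direction :: "complex \<Rightarrow> complex" where
  "direction z = (if z = 0 then 1 else sgn z)"

definition arc_measure :: "complex measure" where
  "arc_measure = distr area_measure (restrict_space borel circle) direction"

lemma circle_closed [simp]: "circle \<in> sets borel" "closed circle" "compact circle"
  by (auto simp: circle_def)

lemma direction_in_circle [simp]: "direction z \<in> circle"
  by (simp add: direction_def circle_def norm_sgn)

lemma norm_times_direction: "of_real (norm z) * direction z = z"
  by (simp add: direction_def sgn_div_norm scaleR_conv_of_real)

lemma borel_measurable_direction [measurable]: "direction \<in> borel_measurable borel"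
  unfolding direction_def sgn_div_norm by measurable

lemma measurable_direction: "direction \<in> measurable area_measure (restrict_space borel circle)"
  by (intro measurable_restrict_space2 measurable_area_borel) auto

lemma space_arc [simp]: "space arc_measure = circle"
  by (simp add: arc_measure_def space_restrict_space)

lemma sets_arc [measurable_cong]: "sets arc_measure = sets (restrict_space borel circle)"
  by (simp add: arc_measure_def)

lemma emeasure_arc_circle: "emeasure arc_measure circle = 1"
proof -
  have "direction -` circle = UNIV" by auto
  then show ?thesis
    unfolding arc_measure_def using measurable_direction
    by (subst emeasure_distr) (auto simp: emeasure_area_disc sets_restrict_space)
qed

interpretation arc: finite_measure arc_measure
  by (rule finite_measureI) (simp add: emeasure_arc_circle)

lemma measure_arc_circle [simp]: "measure arc_measure circle = 1"
  by (simp add: measure_def emeasure_arc_circle)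

lemma circle_norm: "u \<in> circle \<longleftrightarrow> norm u = 1" by (simp add: circle_def)

lemma nn_integral_arc:
  "F \<in> borel_measurable (restrict_space borel circle) \<Longrightarrow>
   (\<integral>\<^sup>+u. F u \<partial>arc_measure) = (\<integral>\<^sup>+z. F (direction z) \<partial>area_measure)"
  unfolding arc_measure_def by (intro nn_integral_distr measurable_direction) simp

lemma direction_rotate: "norm c = 1 \<Longrightarrow> z \<noteq> 0 \<Longrightarrow> direction (c * z) = c * direction z"
  by (cases "c = 0") (auto simp: direction_def sgn_mult, simp add: sgn_div_norm)

lemma AE_area_nonzero: "AE z in area_measure. z \<noteq> 0"
proof (rule AE_I)
  show "emeasure area_measure {0} = 0"
    by (subst nn_integral_indicator[symmetric])
       (auto simp: nn_integral_area sets_area sets_restrict_space indicator_inter_arith[symmetric] Int_absorb2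
          intro!: image_eqI[of _ _ "{0}"])
qed (auto simp: sets_area sets_restrict_space intro!: image_eqI[of _ _ "{0}"])

text \<open>\<open>direction\<close> commutes with rotations off the origin, and the origin is null;
  rotation invariance of area therefore passes to the image measure.\<close>

lemma distr_arc_rotate:
  assumes "norm c = 1"
  shows "distr arc_measure arc_measure ((*) c) = arc_measure"
proof (rule measure_eqI)
  have rot: "(*) c \<in> measurable (restrict_space borel circle) (restrict_space borel circle)"
    using assms by (intro measurable_restrict_space3) (auto simp: circle_def norm_mult)
  then have m: "(*) c \<in> measurable arc_measure arc_measure"
    by (simp cong: measurable_cong_sets add: sets_arc)
  fix A assume "A \<in> sets (distr arc_measure arc_measure ((*) c))"
  then have A: "A \<in> sets arc_measure" by simp
  then have A': "A \<in> sets borel" "A \<subseteq> circle"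
    by (auto simp: sets_arc sets_restrict_space)
  have "emeasure (distr arc_measure arc_measure ((*) c)) A = (\<integral>\<^sup>+u. indicator A (c * u) \<partial>arc_measure)"
    using A m by (subst nn_integral_distr[symmetric, OF m]) (auto simp: )
  also have "\<dots> = (\<integral>\<^sup>+z. indicator A (c * direction z) \<partial>area_measure)"
    using A' by (intro nn_integral_arc measurable_restrict_space1) auto
  also have "\<dots> = (\<integral>\<^sup>+z. indicator A (direction (c * z)) \<partial>area_measure)"
    using AE_area_nonzero by (intro nn_integral_cong_AE) (auto simp: direction_rotate assms)
  also have "\<dots> = (\<integral>\<^sup>+z. indicator A (direction z) \<partial>area_measure)"
    using A' by (intro nn_integral_area_rotate[OF assms, of "\<lambda>z. indicator A (direction z)"]) auto
  also have "\<dots> = emeasure arc_measure A"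
    using A A' by (subst nn_integral_arc[symmetric]) (auto simp: measurable_restrict_space1)
  finally show "emeasure (distr arc_measure arc_measure ((*) c)) A = emeasure arc_measure A" .
qed simp

lemma measurable_arc_rotate:
  "norm c = 1 \<Longrightarrow> (*) c \<in> measurable arc_measure arc_measure"
  using measurable_restrict_space3[of "(*) c" borel borel circle circle]
  by (simp cong: measurable_cong_sets add: sets_arc circle_def norm_mult)

lemma integral_arc_rotate:
  fixes F :: "complex \<Rightarrow> 'b::{banach, second_countable_topology}"
  assumes "norm c = 1" "F \<in> borel_measurable arc_measure"
  shows "(\<integral>u. F (c * u) \<partial>arc_measure) = (\<integral>u. F u \<partial>arc_measure)"
  using integral_distr[OF measurable_arc_rotate[OF assms(1)], of F] assms
  by (simp add: distr_arc_rotate)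

lemma continuous_on_circle_measurable:
  fixes f :: "complex \<Rightarrow> 'b::topological_space"
  shows "continuous_on circle f \<Longrightarrow> f \<in> borel_measurable arc_measure"
  using borel_measurable_continuous_on_restrict[of circle f]
  by (simp cong: measurable_cong_sets add: sets_arc)

lemma continuous_on_circle_integrable:
  fixes f :: "complex \<Rightarrow> 'b::{banach, second_countable_topology}"
  assumes "continuous_on circle f"
  shows "integrable arc_measure f"
proof -
  have "bounded (f ` circle)"
    using assms by (intro compact_imp_bounded compact_continuous_image) auto
  then obtain B where "\<And>u. u \<in> circle \<Longrightarrow> norm (f u) \<le> B"
    by (auto simp: bounded_iff)
  then show ?thesis
    using continuous_on_circle_measurable[OF assms]
    by (intro arc.integrable_const_bound[where B=B]) auto
qed

text \<open>Rotation invariance gives \<open>c ^ n * I = I\<close> for the integral \<open>I\<close> of \<open>u ^ n\<close> and all unimodular \<open>c\<close>.\<close>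
lemma integral_arc_power:
  "(\<integral>u. u ^ n \<partial>arc_measure) = (if n = 0 then 1 else 0)"
proof (cases "n = 0")
  case False
  define I where "I = (\<integral>u. u ^ n \<partial>arc_measure)"
  have c: "c ^ n * I = I" if "norm c = 1" for c
  proof -
    have "(\<integral>u. (c * u) ^ n \<partial>arc_measure) = I" unfolding I_def
      by (intro integral_arc_rotate[OF that, of "\<lambda>u. u ^ n"] continuous_on_circle_measurable continuous_intros)
    then show ?thesis by (simp add: power_mult_distrib I_def)
  qed
  have "cis (pi / real n) ^ n = - 1"
    using False by (simp add: Complex.DeMoivre)
  then have "- I = I" using c[of "cis (pi / real n)"] by simp
  then show ?thesis using False I_def by (simp add: eq_neg_iff_add_eq_0)
qed (auto)

section \<open>Integral inequalities and Taylor coefficients\<close>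

lemma conjugate_exponent:
  fixes p q :: real
  assumes "1 < p" "1 / p + 1 / q = 1"
  shows "1 < q" "(p - 1) * q = p" "q = p / (p - 1)" "(q - 1) * (p - 1) = 1" "1 / q = 1 - 1 / p"
proof -
  have "1 / q = (p - 1) / p" using assms by (simp add: field_simps)
  then show q: "q = p / (p - 1)" using assms by (metis inverse_divide inverse_eq_divide inverse_inverse_eq)
  show "1 < q" "(p - 1) * q = p" "(q - 1) * (p - 1) = 1"
    using assms by (auto simp: q field_simps)
  show "1 / q = 1 - 1 / p" using assms by simp
qed

lemma Hoelder_inequality:
  fixes f g :: "'a \<Rightarrow> real"
  assumes pq: "1 < p" "1 / p + 1 / q = 1"
    and [measurable]: "f \<in> borel_measurable M" "g \<in> borel_measurable M"
    and nn: "\<And>x. x \<in> space M \<Longrightarrow> 0 \<le> f x" "\<And>x. x \<in> space M \<Longrightarrow> 0 \<le> g x"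
    and int: "integrable M (\<lambda>x. f x powr p)" "integrable M (\<lambda>x. g x powr q)"
  shows "integrable M (\<lambda>x. f x * g x)"
    and "(\<integral>x. f x * g x \<partial>M) \<le> (\<integral>x. f x powr p \<partial>M) powr (1 / p) * (\<integral>x. g x powr q \<partial>M) powr (1 / q)"
proof -
  note q = conjugate_exponent[OF pq]
  have young: "a * b \<le> a powr p / p + b powr q / q" if "0 \<le> a" "0 \<le> b" for a b
    using Youngs_inequality[of p q a b] pq q(1) that by simp
  show int': "integrable M (\<lambda>x. f x * g x)"
  proof (rule Bochner_Integration.integrable_bound)
    show "integrable M (\<lambda>x. f x powr p / p + g x powr q / q)" using int by simp
    show "AE x in M. norm (f x * g x) \<le> norm (f x powr p / p + g x powr q / q)"
      using young nn pq q(1) by (intro AE_I2) (auto simp: abs_mult)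
  qed measurable
  define A where "A = (\<integral>x. f x powr p \<partial>M)"
  define B where "B = (\<integral>x. g x powr q \<partial>M)"
  have nnAB: "0 \<le> A" "0 \<le> B" unfolding A_def B_def by (auto intro: integral_nonneg_AE)
  show "(\<integral>x. f x * g x \<partial>M) \<le> A powr (1 / p) * B powr (1 / q)"
  \<comment> \<open>Young's inequality will be applied to f and g divided by their norms, so a
    vanishing norm is treated apart.\<close>
  proof (cases "A = 0 \<or> B = 0")
    case True
    have "AE x in M. f x * g x = 0"
    proof (cases "A = 0")
      case True
      then have "AE x in M. f x powr p = 0"
        unfolding A_def using int by (subst (asm) integral_nonneg_eq_0_iff_AE) auto
      then show ?thesis by eventually_elim auto
    next
      case False
      with True have "AE x in M. g x powr q = 0"
        unfolding B_def using int by (subst (asm) integral_nonneg_eq_0_iff_AE) auto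
      then show ?thesis by eventually_elim auto
    qed
    then have "(\<integral>x. f x * g x \<partial>M) = 0" by (intro integral_eq_zero_AE)
    then show ?thesis by simp
  next
    case False
    then have pos: "0 < A" "0 < B" using nnAB by auto
    define a b where "a = A powr (1/p)" and "b = B powr (1/q)"
    have ab: "0 < a" "0 < b" "a powr p = A" "b powr q = B"
      using pos pq q(1) by (auto simp: a_def b_def powr_powr)
    have "(\<integral>x. f x * g x \<partial>M) / (a * b) = (\<integral>x. (f x / a) * (g x / b) \<partial>M)"
      by simp
    also have "\<dots> \<le> (\<integral>x. (f x powr p / (p * A)) + g x powr q / (q * B) \<partial>M)"
    proof (rule integral_mono)
      show "integrable M (\<lambda>x. (f x / a) * (g x / b))" using int' by simp
      show "integrable M (\<lambda>x. (f x powr p / (p * A)) + g x powr q / (q * B))" using int by simp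
      fix x assume x: "x \<in> space M"
      have "(f x / a) * (g x / b) \<le> (f x / a) powr p / p + (g x / b) powr q / q"
        using young[of "f x / a" "g x / b"] nn[OF x] ab by simp
      also have "\<dots> = (f x powr p / (p * A)) + g x powr q / (q * B)"
        using nn[OF x] ab by (simp add: powr_divide mult.commute)
      finally show "(f x / a) * (g x / b) \<le> (f x powr p / (p * A)) + g x powr q / (q * B)" .
    qed
    also have "\<dots> = A / (p * A) + B / (q * B)"
      using int by (simp add: A_def B_def)
    also have "\<dots> = 1" using pos pq q(1) by simp
    finally show ?thesis using ab by (simp add: field_simps a_def[symmetric] b_def[symmetric])
  qed
qed

lemma powr_add_le:
  fixes a b :: real assumes "0 \<le> a" "0 \<le> b" "0 \<le> p"
  shows "(a + b) powr p \<le> 2 powr p * (a powr p + b powr p)"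
proof -
  have "(a + b) powr p \<le> (2 * max a b) powr p" using assms by (intro powr_mono2) auto
  also have "\<dots> = 2 powr p * max a b powr p" using assms by (simp add: powr_mult)
  also have "max a b powr p \<le> a powr p + b powr p" by (auto simp: max_def)
  finally show ?thesis by simp
qed

lemma integrable_powr_add:
  fixes f g :: "'a \<Rightarrow> real"
  assumes "1 < p"
    and [measurable]: "f \<in> borel_measurable M" "g \<in> borel_measurable M"
    and nn: "\<And>x. x \<in> space M \<Longrightarrow> 0 \<le> f x" "\<And>x. x \<in> space M \<Longrightarrow> 0 \<le> g x"
    and int: "integrable M (\<lambda>x. f x powr p)" "integrable M (\<lambda>x. g x powr p)"
  shows "integrable M (\<lambda>x. (f x + g x) powr p)"
proof (rule Bochner_Integration.integrable_bound)
  show "integrable M (\<lambda>x. 2 powr p * (f x powr p + g x powr p))" using int by simp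
  show "AE x in M. norm ((f x + g x) powr p) \<le> norm (2 powr p * (f x powr p + g x powr p))"
    using nn powr_add_le[of _ _ p] assms(1) by (intro AE_I2) (auto simp: )
qed measurable

lemma Minkowski_inequality:
  fixes f g :: "'a \<Rightarrow> real"
  assumes p: "1 < p"
    and [measurable]: "f \<in> borel_measurable M" "g \<in> borel_measurable M"
    and nn: "\<And>x. x \<in> space M \<Longrightarrow> 0 \<le> f x" "\<And>x. x \<in> space M \<Longrightarrow> 0 \<le> g x"
    and int: "integrable M (\<lambda>x. f x powr p)" "integrable M (\<lambda>x. g x powr p)"
  shows "(\<integral>x. (f x + g x) powr p \<partial>M) powr (1 / p)
    \<le> (\<integral>x. f x powr p \<partial>M) powr (1 / p) + (\<integral>x. g x powr p \<partial>M) powr (1 / p)"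
proof -
  define q where "q = p / (p - 1)"
  have pq: "1 / p + 1 / q = 1" using p by (simp add: q_def field_simps)
  note q = conjugate_exponent[OF p pq]
  let ?S = "\<integral>x. (f x + g x) powr p \<partial>M"
  note intS = integrable_powr_add[OF p assms(2,3) nn int]
  have powq: "((f x + g x) powr (p - 1)) powr q = (f x + g x) powr p" for x
    using q(2) by (simp add: powr_powr)
  have "f \<in> borel_measurable M" "g \<in> borel_measurable M" by simp_all
  have H: "integrable M (\<lambda>x. h x * (f x + g x) powr (p - 1))"
    "(\<integral>x. h x * (f x + g x) powr (p - 1) \<partial>M) \<le> (\<integral>x. h x powr p \<partial>M) powr (1 / p) * ?S powr (1 / q)"
    if [measurable]: "h \<in> borel_measurable M" and "\<And>x. x \<in> space M \<Longrightarrow> 0 \<le> h x" "integrable M (\<lambda>x. h x powr p)" for h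
    using Hoelder_inequality[OF p pq, of h M "\<lambda>x. (f x + g x) powr (p - 1)"] that intS by (simp_all add: powq)
  have nnS: "0 \<le> ?S" by (auto intro: integral_nonneg_AE)
  have "?S = (\<integral>x. f x * (f x + g x) powr (p - 1) + g x * (f x + g x) powr (p - 1) \<partial>M)"
  proof (rule Bochner_Integration.integral_cong[OF refl])
    fix x assume "x \<in> space M"
    then have "0 \<le> f x + g x" using nn by auto
    then have "(f x + g x) powr p = (f x + g x) * (f x + g x) powr (p - 1)"
      using p by (cases "f x + g x = 0") (auto simp: powr_mult_base)
    then show "(f x + g x) powr p = f x * (f x + g x) powr (p - 1) + g x * (f x + g x) powr (p - 1)"
      by (simp add: distrib_right)
  qed
  also have "\<dots> \<le> ((\<integral>x. f x powr p \<partial>M) powr (1 / p) + (\<integral>x. g x powr p \<partial>M) powr (1 / p)) * ?S powr (1 / q)"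
    using H[of f] H[of g] nn int by (simp add: distrib_right)
  finally have *: "?S \<le> ((\<integral>x. f x powr p \<partial>M) powr (1 / p) + (\<integral>x. g x powr p \<partial>M) powr (1 / p)) * ?S powr (1 / q)" .
  show ?thesis
  proof (cases "?S = 0")
    case False
    then have S: "0 < ?S" using nnS by linarith
    then have "?S = ?S powr (1/p) * ?S powr (1/q)"
      using pq by (simp flip: powr_add)
    with * have "?S powr (1/p) * ?S powr (1/q) \<le> ((\<integral>x. f x powr p \<partial>M) powr (1 / p) + (\<integral>x. g x powr p \<partial>M) powr (1 / p)) * ?S powr (1 / q)"
      by simp
    moreover have "0 < ?S powr (1/q)" using S by simp
    ultimately show ?thesis by (rule mult_right_le_imp_le)
  qed (auto intro!: add_nonneg_nonneg)
qed

text \<open>Continuity is given on the torus only, so the extension by zero is the function that is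
  Borel on the plane; composing it with the coordinate maps then gives measurability for the product
  of the restricted sigma-algebras.\<close>

lemma continuous_on_circle2_measurable:
  fixes G :: "complex \<times> complex \<Rightarrow> 'b::real_normed_vector"
  assumes "continuous_on (circle \<times> circle) G"
  shows "G \<in> borel_measurable (arc_measure \<Otimes>\<^sub>M arc_measure)"
proof -
  have "(\<lambda>x. indicator (circle \<times> circle) x *\<^sub>R G x) \<in> borel_measurable borel"
    using assms by (intro borel_measurable_continuous_on_indicator) (auto intro!: borel_closed closed_Times)
  moreover have "(\<lambda>x. (fst x, snd x)) \<in> borel_measurable (arc_measure \<Otimes>\<^sub>M arc_measure)"
  proof (rule borel_measurable_Pair)
    have id: "(\<lambda>x. x) \<in> borel_measurable arc_measure"
      by (intro continuous_on_circle_measurable continuous_intros)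
    show "fst \<in> borel_measurable (arc_measure \<Otimes>\<^sub>M arc_measure)"
      by (rule measurable_compose[OF measurable_fst id])
    show "snd \<in> borel_measurable (arc_measure \<Otimes>\<^sub>M arc_measure)"
      by (rule measurable_compose[OF measurable_snd id])
  qed
  ultimately have "(\<lambda>x. indicator (circle \<times> circle) (fst x, snd x) *\<^sub>R G (fst x, snd x)) \<in> borel_measurable (arc_measure \<Otimes>\<^sub>M arc_measure)"
    by (rule measurable_compose[rotated])
  then show ?thesis
    by (rule measurable_cong[THEN iffD1, rotated]) (auto simp: space_pair_measure)
qed

section \<open>Fubini, orthogonality and termwise integration on the circle\<close>

interpretation arc2: pair_sigma_finite arc_measure arc_measure ..

lemma Fubini_circle:
  fixes G :: "complex \<Rightarrow> complex \<Rightarrow> 'b::{banach, second_countable_topology}"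
  assumes "continuous_on (circle \<times> circle) (case_prod G)"
  shows "(\<integral>u. (\<integral>v. G u v \<partial>arc_measure) \<partial>arc_measure) = (\<integral>v. (\<integral>u. G u v \<partial>arc_measure) \<partial>arc_measure)"
    and "integrable arc_measure (\<lambda>u. \<integral>v. G u v \<partial>arc_measure)"
proof -
  have "bounded (case_prod G ` (circle \<times> circle))"
    using assms by (intro compact_imp_bounded compact_continuous_image compact_Times) auto
  then obtain B where B: "\<And>x. x \<in> circle \<times> circle \<Longrightarrow> norm (case_prod G x) \<le> B"
    by (meson bounded_iff imageI)
  interpret P: finite_measure "arc_measure \<Otimes>\<^sub>M arc_measure"
    by (intro finite_measure_pair_measure arc.finite_measure_axioms)
  have int: "integrable (arc_measure \<Otimes>\<^sub>M arc_measure) (case_prod G)"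
    using continuous_on_circle2_measurable[OF assms] B
    by (intro P.integrable_const_bound[where B=B]) (auto simp: space_pair_measure intro!: AE_I2)
  show "(\<integral>u. (\<integral>v. G u v \<partial>arc_measure) \<partial>arc_measure) = (\<integral>v. (\<integral>u. G u v \<partial>arc_measure) \<partial>arc_measure)"
    using arc2.Fubini_integral[OF int] by simp
  show "integrable arc_measure (\<lambda>u. \<integral>v. G u v \<partial>arc_measure)"
    using arc2.integrable_fst[OF int] .
qed

lemma arc_orthogonal:
  "(\<integral>u. u ^ m * cnj u ^ n \<partial>arc_measure) = (if m = n then 1 else 0)"
proof (cases "n \<le> m")
  case True
  have "(\<integral>u. u ^ m * cnj u ^ n \<partial>arc_measure) = (\<integral>u. u ^ (m - n) \<partial>arc_measure)"
  proof (rule Bochner_Integration.integral_cong[OF refl])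
    fix u assume "u \<in> space arc_measure"
    then have "u * cnj u = 1" by (simp add: circle_norm complex_norm_square[symmetric])
    then have "(u * cnj u) ^ n = 1" by simp
    moreover have "u ^ m = u ^ (m - n) * u ^ n" using True by (simp flip: power_add)
    ultimately show "u ^ m * cnj u ^ n = u ^ (m - n)" by (simp add: power_mult_distrib)
  qed
  then show ?thesis using True by (simp add: integral_arc_power)
next
  case False
  have "(\<integral>u. u ^ m * cnj u ^ n \<partial>arc_measure) = (\<integral>u. cnj (u ^ (n - m)) \<partial>arc_measure)"
  proof (rule Bochner_Integration.integral_cong[OF refl])
    fix u assume "u \<in> space arc_measure"
    then have "u * cnj u = 1" by (simp add: circle_norm complex_norm_square[symmetric])
    then have "(u * cnj u) ^ m = 1" by simp
    moreover have "cnj u ^ n = cnj u ^ (n - m) * cnj u ^ m" using False by (simp flip: power_add)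
    ultimately show "u ^ m * cnj u ^ n = cnj (u ^ (n - m))" by (simp add: power_mult_distrib mult_ac)
  qed
  also have "\<dots> = cnj (\<integral>u. u ^ (n - m) \<partial>arc_measure)"
    by (rule Bochner_Integration.integral_cnj)
  finally show ?thesis using False by (simp add: integral_arc_power)
qed

text \<open>One interchange of sum and integral serves Taylor series, the Cauchy kernel and the
  Poisson kernel: \<open>a\<close> carries the absolute convergence, while \<open>b n\<close> is a
  power of \<open>u\<close> or \<open>cnj u\<close> and bounded by 1.\<close>

lemma sums_integral_circle:
  fixes a :: "nat \<Rightarrow> complex" and b :: "nat \<Rightarrow> complex \<Rightarrow> complex"
  assumes "summable (\<lambda>n. norm (a n))" "continuous_on circle \<psi>" "\<And>n. continuous_on circle (b n)"
    and b: "\<And>n u. u \<in> circle \<Longrightarrow> norm (b n u) \<le> 1"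
    and F: "\<And>u. u \<in> circle \<Longrightarrow> (\<lambda>n. a n * b n u) sums F u"
  shows "(\<lambda>n. a n * (\<integral>u. \<psi> u * b n u \<partial>arc_measure)) sums (\<integral>u. \<psi> u * F u \<partial>arc_measure)"
proof -
  have "bounded (\<psi> ` circle)"
    using assms by (intro compact_imp_bounded compact_continuous_image) auto
  then obtain B where B: "\<And>u. u \<in> circle \<Longrightarrow> norm (\<psi> u) \<le> B" by (meson bounded_iff imageI)
  have B0: "0 \<le> B" using order_trans[OF norm_ge_zero B[of 1]] by (simp add: circle_norm)
  let ?f = "\<lambda>n u. a n * (\<psi> u * b n u)"
  have int: "integrable arc_measure (?f n)" for n
    using assms by (intro continuous_on_circle_integrable continuous_intros)
  have bd: "norm (?f n u) \<le> norm (a n) * B" if "u \<in> circle" for n u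
    using B[OF that] b[OF that, of n] B0
    by (auto simp: norm_mult intro!: mult_left_mono mult_mono[of "norm (\<psi> u)" B "norm (b n u)" 1, simplified])
  have sm: "summable (\<lambda>n. norm (a n) * B)" using assms by (intro summable_mult2)
  have "(\<lambda>n. integral\<^sup>L arc_measure (?f n)) sums (\<integral>u. (\<Sum>n. ?f n u) \<partial>arc_measure)"
  proof (rule sums_integral[OF int])
    show "AE u in arc_measure. summable (\<lambda>n. norm (?f n u))"
      using bd by (intro AE_I2 summable_comparison_test'[OF sm, of 0]) auto
    show "summable (\<lambda>n. \<integral>u. norm (?f n u) \<partial>arc_measure)"
    proof (rule summable_comparison_test'[OF sm, of 0])
      fix n
      have "(\<integral>u. norm (?f n u) \<partial>arc_measure) \<le> (\<integral>u. norm (a n) * B \<partial>arc_measure)"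
        using bd int by (intro integral_mono integrable_norm) auto
      then show "norm (\<integral>u. norm (?f n u) \<partial>arc_measure) \<le> norm (a n) * B" by simp
    qed
  qed
  moreover have "(\<integral>u. (\<Sum>n. ?f n u) \<partial>arc_measure) = (\<integral>u. \<psi> u * F u \<partial>arc_measure)"
  proof (rule Bochner_Integration.integral_cong[OF refl])
    fix u assume "u \<in> space arc_measure"
    then have "(\<lambda>n. \<psi> u * (a n * b n u)) sums (\<psi> u * F u)" using F by (intro sums_mult) auto
    then show "(\<Sum>n. ?f n u) = \<psi> u * F u" by (simp add: sums_iff mult_ac)
  qed
  ultimately show ?thesis by simp
qed

section \<open>Taylor coefficients as Fourier coefficients\<close>

definition taylor_coeff :: "(complex \<Rightarrow> complex) \<Rightarrow> nat \<Rightarrow> complex" where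
  "taylor_coeff f n = (deriv ^^ n) f 0 / fact n"

lemma taylor_sums:
  "f holomorphic_on ball 0 R \<Longrightarrow> norm z < R \<Longrightarrow> (\<lambda>n. taylor_coeff f n * z ^ n) sums f z"
  using holomorphic_power_series[of f 0 R z] by (simp add: taylor_coeff_def)

lemma taylor_summable:
  assumes "f holomorphic_on ball 0 R" "0 \<le> r" "r < R"
  shows "summable (\<lambda>n. norm (taylor_coeff f n * of_real r ^ n))"
proof (rule powser_insidea)
  \<comment> \<open>Plain convergence at a radius strictly between r and R makes the convergence at
    r absolute.\<close>
  show "summable (\<lambda>n. taylor_coeff f n * of_real ((r + R) / 2) ^ n)"
    using assms by (intro sums_summable[OF taylor_sums[OF assms(1)]]) (auto simp del: of_real_add of_real_divide)
  show "norm (of_real r :: complex) < norm (of_real ((r + R) / 2) :: complex)"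
    using assms by (simp del: of_real_add of_real_divide)
qed

lemma holomorphic_circle_continuous:
  fixes f :: "complex \<Rightarrow> complex"
  assumes "f holomorphic_on ball 0 R" "norm c < R"
  shows "continuous_on circle (\<lambda>u. f (c * u))"
  using assms by (intro continuous_on_compose2[OF holomorphic_on_imp_continuous_on[OF assms(1)]] continuous_intros)
     (auto simp: circle_norm norm_mult)

lemma sums_integral_holomorphic:
  assumes "f holomorphic_on ball 0 R" "0 \<le> r" "r < R" "continuous_on circle \<psi>"
  shows "(\<lambda>n. taylor_coeff f n * of_real r ^ n * (\<integral>u. \<psi> u * u ^ n \<partial>arc_measure))
     sums (\<integral>u. \<psi> u * f (of_real r * u) \<partial>arc_measure)"
proof (rule sums_integral_circle)
  show "summable (\<lambda>n. norm (taylor_coeff f n * of_real r ^ n))"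
    using assms by (intro taylor_summable)
  fix u assume "u \<in> circle"
  then show "(\<lambda>n. taylor_coeff f n * of_real r ^ n * u ^ n) sums f (of_real r * u)"
    using taylor_sums[OF assms(1), of "of_real r * u"] assms
    by (simp add: norm_mult circle_norm power_mult_distrib mult.assoc)
next
  show "norm (u ^ n) \<le> 1" if "u \<in> circle" for n u using that by (simp add: circle_norm norm_power)
next
  show "continuous_on circle (\<lambda>u. u ^ n)" for n by (intro continuous_intros)
qed fact

lemma coeff_integral:
  assumes "f holomorphic_on ball 0 R" "0 \<le> r" "r < R"
  shows "(\<integral>u. cnj u ^ n * f (of_real r * u) \<partial>arc_measure) = taylor_coeff f n * of_real r ^ n"
proof -
  have "(\<lambda>m. taylor_coeff f m * of_real r ^ m * (\<integral>u. cnj u ^ n * u ^ m \<partial>arc_measure))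
     sums (\<integral>u. cnj u ^ n * f (of_real r * u) \<partial>arc_measure)"
    by (rule sums_integral_holomorphic[OF assms]) (intro continuous_intros)
  moreover have "(\<integral>u. cnj u ^ n * u ^ m \<partial>arc_measure) = (if m = n then 1 else 0)" for m
    using arc_orthogonal[of m n] by (simp add: mult.commute)
  then have "(\<lambda>m. taylor_coeff f m * of_real r ^ m * (\<integral>u. cnj u ^ n * u ^ m \<partial>arc_measure))
     = (\<lambda>m. if m = n then taylor_coeff f m * of_real r ^ m else 0)"
    by auto
  ultimately have "(\<lambda>m. if m = n then taylor_coeff f m * of_real r ^ m else 0)
     sums (\<integral>u. cnj u ^ n * f (of_real r * u) \<partial>arc_measure)" by simp
  from sums_unique2[OF this sums_single] show ?thesis .
qed

text \<open>Boundary values of analytic functions carry no negative frequencies. The case n = 0 is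
  the mean value property, which later evaluates the mean of \<open>F powr p\<close> in the Riesz
  theorem.\<close>

lemma coeff_integral_neg:
  assumes "f holomorphic_on ball 0 R" "0 \<le> r" "r < R"
  shows "(\<integral>u. u ^ n * f (of_real r * u) \<partial>arc_measure) = (if n = 0 then f 0 else 0)"
proof -
  have "(\<lambda>m. taylor_coeff f m * of_real r ^ m * (\<integral>u. u ^ n * u ^ m \<partial>arc_measure))
     sums (\<integral>u. u ^ n * f (of_real r * u) \<partial>arc_measure)"
    by (rule sums_integral_holomorphic[OF assms]) (intro continuous_intros)
  moreover have "(\<integral>u. u ^ n * u ^ m \<partial>arc_measure) = (if m = 0 \<and> n = 0 then 1 else 0)" for m
    by (simp flip: power_add add: integral_arc_power)
  then have "(\<lambda>m. taylor_coeff f m * of_real r ^ m * (\<integral>u. u ^ n * u ^ m \<partial>arc_measure))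
     = (\<lambda>m. if m = 0 then (if n = 0 then f 0 else 0) else 0)"
    by (auto simp: taylor_coeff_def)
  ultimately have "(\<lambda>m. if m = 0 then (if n = 0 then f 0 else 0) else 0)
     sums (\<integral>u. u ^ n * f (of_real r * u) \<partial>arc_measure)" by simp
  from sums_unique2[OF this sums_single] show ?thesis .
qed

section \<open>Poisson integrals and integral means\<close>

lemma continuous_on_powr_norm:
  fixes f :: "'a::topological_space \<Rightarrow> 'b::real_normed_vector"
  assumes "continuous_on S f" "0 < p"
  shows "continuous_on S (\<lambda>x. norm (f x) powr p)"
  using assms by (intro continuous_on_powr' continuous_intros) auto

text \<open>Hoelder against the constant 1; the circle has total mass 1.\<close>

lemma Jensen_circle:
  fixes f :: "complex \<Rightarrow> real"
  assumes "1 < p" "continuous_on circle f" "\<And>u. u \<in> circle \<Longrightarrow> 0 \<le> f u"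
  shows "(\<integral>u. f u \<partial>arc_measure) powr p \<le> (\<integral>u. f u powr p \<partial>arc_measure)"
proof -
  define q where "q = p / (p - 1)"
  have pq: "1 / p + 1 / q = 1" using assms by (simp add: q_def field_simps)
  have "(\<integral>u. f u * 1 \<partial>arc_measure) \<le> (\<integral>u. f u powr p \<partial>arc_measure) powr (1 / p) * (\<integral>u. 1 powr q \<partial>arc_measure) powr (1 / q)"
    using assms by (intro Hoelder_inequality[OF assms(1) pq] continuous_on_circle_measurable
        continuous_on_circle_integrable continuous_on_powr' continuous_intros) auto
  then have "(\<integral>u. f u \<partial>arc_measure) \<le> (\<integral>u. f u powr p \<partial>arc_measure) powr (1 / p)" by simp
  then have "(\<integral>u. f u \<partial>arc_measure) powr p \<le> ((\<integral>u. f u powr p \<partial>arc_measure) powr (1 / p)) powr p"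
    using assms by (intro powr_mono2) (auto intro!: integral_nonneg_AE)
  also have "\<dots> = (\<integral>u. f u powr p \<partial>arc_measure)"
    using assms by (simp add: powr_powr integral_nonneg_AE)
  finally show ?thesis .
qed

text \<open>The Poisson kernel with pole at 1. The two-variable kernel at \<open>z\<close> in the
  disc and \<open>u\<close> on the circle is \<open>poisson (z * cnj u)\<close>.\<close>

definition poisson :: "complex \<Rightarrow> real" where
  "poisson z = (1 - (norm z)\<^sup>2) / (norm (1 - z))\<^sup>2"

lemma poisson_nonneg: "norm z < 1 \<Longrightarrow> 0 \<le> poisson z"
  unfolding poisson_def by (intro divide_nonneg_nonneg) (auto simp: abs_square_le_1)

text \<open>The point is strict positivity: the Poisson integral of a nonnegative function with
  positive mean is positive everywhere, which makes \<open>F powr p\<close> analytic in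
  \<open>Riesz_nonneg\<close>.\<close>

lemma poisson_lower: "norm z < 1 \<Longrightarrow> (1 - (norm z)\<^sup>2) / 4 \<le> poisson z"
proof -
  assume z: "norm z < 1"
  have "norm (1 - z) \<le> 2" using norm_triangle_ineq4[of 1 z] z by simp
  then have "(norm (1 - z))\<^sup>2 \<le> 2\<^sup>2" by (intro power_mono) auto
  moreover have "0 < (norm (1 - z))\<^sup>2" using z by auto
  moreover have "0 \<le> 1 - (norm z)\<^sup>2" using z by (simp add: abs_square_le_1)
  ultimately show ?thesis unfolding poisson_def by (intro divide_left_mono) auto
qed

text \<open>Splits the kernel into the Cauchy kernel and an antianalytic part without constant term;
  each has a geometric series.\<close>

lemma poisson_eq:
  assumes "norm z < 1"
  shows "complex_of_real (poisson z) = 1 / (1 - z) + cnj z / (1 - cnj z)"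
proof -
  have "z \<noteq> 1" using assms by auto
  moreover have "cnj z \<noteq> 1" using assms complex_mod_cnj[of z] by force
  ultimately have z: "1 - z \<noteq> 0" "1 - cnj z \<noteq> 0" by auto
  have "1 / (1 - z) + cnj z / (1 - cnj z) = (1 - z * cnj z) / ((1 - z) * (1 - cnj z))"
    using z by (simp add: field_simps)
  also have "\<dots> = complex_of_real (poisson z)"
    unfolding poisson_def of_real_divide of_real_diff complex_norm_square by simp
  finally show ?thesis by simp
qed

lemma poisson_cnj: "poisson (cnj z) = poisson z"
proof -
  have "norm (1 - cnj z) = norm (cnj (1 - z))" by simp
  then show ?thesis unfolding poisson_def by (metis complex_mod_cnj)
qed

lemma continuous_on_poisson:
  assumes "continuous_on S f" "\<And>x. x \<in> S \<Longrightarrow> norm (f x) < 1"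
  shows "continuous_on S (\<lambda>x. poisson (f x))"
  proof -
  have "f x \<noteq> 1" if "x \<in> S" for x using assms(2)[OF that] by auto
  then show ?thesis unfolding poisson_def using assms by (intro continuous_intros) auto
qed

text \<open>The Riesz (Cauchy-Szego) projection: the Fourier coefficients of nonnegative index
  become Taylor coefficients, see \<open>cauchy_transform_sums\<close>.\<close>

definition cauchy_transform :: "(complex \<Rightarrow> complex) \<Rightarrow> complex \<Rightarrow> complex" where
  "cauchy_transform \<phi> z = (\<integral>u. \<phi> u * (1 / (1 - z * cnj u)) \<partial>arc_measure)"

definition fourier :: "(complex \<Rightarrow> complex) \<Rightarrow> nat \<Rightarrow> complex" where
  "fourier \<phi> n = (\<integral>u. \<phi> u * cnj u ^ n \<partial>arc_measure)"

lemma cauchy_transform_sums: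
  assumes "continuous_on circle \<phi>" "norm z < 1"
  shows "(\<lambda>n. fourier \<phi> n * z ^ n) sums cauchy_transform \<phi> z"
proof -
  have "(\<lambda>n. z ^ n * (\<integral>u. \<phi> u * cnj u ^ n \<partial>arc_measure)) sums (\<integral>u. \<phi> u * (1 / (1 - z * cnj u)) \<partial>arc_measure)"
  proof (rule sums_integral_circle)
    show "summable (\<lambda>n. norm (z ^ n))" using assms by (simp add: norm_power summable_geometric)
    show "continuous_on circle (\<lambda>u. cnj u ^ n)" for n by (intro continuous_intros)
    fix u assume u: "u \<in> circle"
    show "norm (cnj u ^ n) \<le> 1" for n using u by (simp add: circle_norm norm_power)
    show "(\<lambda>n. z ^ n * cnj u ^ n) sums (1 / (1 - z * cnj u))"
      using geometric_sums[of "z * cnj u"] u assms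
      by (simp add: circle_norm norm_mult power_mult_distrib)
  qed fact
  then show ?thesis by (simp add: fourier_def cauchy_transform_def mult.commute)
qed

text \<open>The difference between Poisson integral and Cauchy transform is the antianalytic part,
  expanded in the coefficients of negative frequency. It vanishes as soon as those do.\<close>

lemma poisson_integral:
  assumes "continuous_on circle \<phi>" "norm z < 1"
  shows "(\<lambda>n. cnj z ^ Suc n * (\<integral>u. \<phi> u * u ^ Suc n \<partial>arc_measure)) sums
    ((\<integral>u. \<phi> u * of_real (poisson (z * cnj u)) \<partial>arc_measure) - cauchy_transform \<phi> z)"
proof -
  have ne: "1 - z * cnj u \<noteq> 0" "1 - cnj z * u \<noteq> 0" if "u \<in> circle" for u
  proof -
    have "norm (z * cnj u) < 1" "norm (cnj z * u) < 1"
      using that assms by (auto simp: norm_mult circle_norm)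
    then have "z * cnj u \<noteq> 1" "cnj z * u \<noteq> 1" by force+
    then show "1 - z * cnj u \<noteq> 0" "1 - cnj z * u \<noteq> 0" by auto
  qed
  have "(\<lambda>n. cnj z ^ Suc n * (\<integral>u. \<phi> u * u ^ Suc n \<partial>arc_measure)) sums
      (\<integral>u. \<phi> u * (cnj z * u / (1 - cnj z * u)) \<partial>arc_measure)"
  proof (rule sums_integral_circle)
    have "summable (\<lambda>n. norm z * norm z ^ n)" using assms by (intro summable_mult summable_geometric) auto
    then show "summable (\<lambda>n. norm (cnj z ^ Suc n))" by (simp add: norm_power norm_mult)
    show "continuous_on circle (\<lambda>u. u ^ Suc n)" for n by (intro continuous_intros)
    fix u assume u: "u \<in> circle"
    show "norm (u ^ Suc n) \<le> 1" for n using u by (simp add: circle_norm norm_power norm_mult)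
    have "(\<lambda>n. (cnj z * u) * (cnj z * u) ^ n) sums ((cnj z * u) * (1 / (1 - cnj z * u)))"
      using u assms by (intro sums_mult geometric_sums) (simp add: circle_norm norm_mult)
    then show "(\<lambda>n. cnj z ^ Suc n * u ^ Suc n) sums (cnj z * u / (1 - cnj z * u))"
      by (simp add: power_mult_distrib mult_ac)
  qed fact
  moreover have "(\<integral>u. \<phi> u * of_real (poisson (z * cnj u)) \<partial>arc_measure)
     = (\<integral>u. \<phi> u * (1 / (1 - z * cnj u)) + \<phi> u * (cnj z * u / (1 - cnj z * u)) \<partial>arc_measure)"
  proof (rule Bochner_Integration.integral_cong[OF refl])
    fix u assume "u \<in> space arc_measure"
    then have "norm (z * cnj u) < 1" using assms by (simp add: norm_mult circle_norm)
    from poisson_eq[OF this]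
    show "\<phi> u * of_real (poisson (z * cnj u)) = \<phi> u * (1 / (1 - z * cnj u)) + \<phi> u * (cnj z * u / (1 - cnj z * u))"
      by (simp add: distrib_left)
  qed
  moreover have "\<dots> = cauchy_transform \<phi> z + (\<integral>u. \<phi> u * (cnj z * u / (1 - cnj z * u)) \<partial>arc_measure)"
    unfolding cauchy_transform_def using ne assms
    by (intro Bochner_Integration.integral_add continuous_on_circle_integrable continuous_intros) auto
  ultimately show ?thesis by simp
qed

text \<open>The dilation by \<open>\<rho>\<close> makes the boundary values continuous. They have no
  negative frequencies, so the Poisson integral is their Cauchy transform, which is the Taylor
  series of f.\<close>

lemma poisson_holomorphic:
  assumes "f holomorphic_on ball 0 R" "0 \<le> \<rho>" "\<rho> < R" "norm z < 1"
  shows "(\<integral>u. f (of_real \<rho> * u) * of_real (poisson (z * cnj u)) \<partial>arc_measure) = f (of_real \<rho> * z)"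
proof -
  let ?\<phi> = "\<lambda>u. f (of_real \<rho> * u)"
  have cont: "continuous_on circle ?\<phi>"
    using assms by (intro holomorphic_circle_continuous) auto
  have "norm (of_real \<rho> * z) < R"
    using assms mult_left_mono[of "norm z" 1 \<rho>] by (simp add: norm_mult)
  from taylor_sums[OF assms(1) this] have "(\<lambda>n. fourier ?\<phi> n * z ^ n) sums f (of_real \<rho> * z)"
    using coeff_integral[OF assms(1-3)]
    by (simp add: fourier_def mult.commute[of _ "cnj _ ^ _"] power_mult_distrib mult.assoc)
  then have "cauchy_transform ?\<phi> z = f (of_real \<rho> * z)"
    using cauchy_transform_sums[OF cont assms(4)] sums_unique2 by blast
  moreover have "(\<integral>u. ?\<phi> u * u ^ Suc n \<partial>arc_measure) = 0" for n
    using coeff_integral_neg[OF assms(1-3), of "Suc n"] by (simp add: mult.commute)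
  ultimately have "(\<lambda>n. 0) sums ((\<integral>u. ?\<phi> u * of_real (poisson (z * cnj u)) \<partial>arc_measure) - f (of_real \<rho> * z))"
    using poisson_integral[OF cont assms(4)] by simp
  then show ?thesis using sums_unique2[OF sums_zero] by force
qed

lemma poisson_total:
  assumes "norm z < 1" shows "(\<integral>u. poisson (z * cnj u) \<partial>arc_measure) = 1"
proof -
  have "complex_of_real (\<integral>u. poisson (z * cnj u) \<partial>arc_measure) = (\<integral>u. of_real (poisson (z * cnj u)) \<partial>arc_measure)"
    by simp
  also have "\<dots> = 1"
    using poisson_holomorphic[of "\<lambda>_. 1" 1 0 z] assms by simp
  finally show ?thesis using of_real_eq_1_iff by blast
qed

text \<open>For fixed v the kernel is a probability density in u, so Jensen's inequality bounds the
  p-th power pointwise; by symmetry it is also a density in v, and Fubini finishes.\<close>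

lemma poisson_contraction:
  fixes \<phi> :: "complex \<Rightarrow> complex"
  assumes p: "1 < p" and cont: "continuous_on circle \<phi>" and r: "0 \<le> r" "r < 1"
  shows "(\<integral>v. norm (\<integral>u. \<phi> u * of_real (poisson (of_real r * v * cnj u)) \<partial>arc_measure) powr p \<partial>arc_measure)
     \<le> (\<integral>u. norm (\<phi> u) powr p \<partial>arc_measure)"
proof -
  define q where "q = p / (p - 1)"
  have pq: "1 / p + 1 / q = 1" using p by (simp add: q_def field_simps)
  note q = conjugate_exponent[OF p pq]
  let ?P = "\<lambda>v u. poisson (of_real r * v * cnj u)"
  have small: "norm (of_real r * v * cnj u) < 1" if "v \<in> circle" "u \<in> circle" for u v
    using that r by (simp add: norm_mult circle_norm)
  have P0: "0 \<le> ?P v u" if "v \<in> circle" "u \<in> circle" for u v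
    using small[OF that] by (rule poisson_nonneg)
  have P1: "(\<integral>u. ?P v u \<partial>arc_measure) = 1" if "v \<in> circle" for v
    using that r by (intro poisson_total) (simp add: norm_mult circle_norm)
  have P2: "(\<integral>v. ?P v u \<partial>arc_measure) = 1" if "u \<in> circle" for u
  \<comment> \<open>The kernel is real, hence unchanged by conjugation, and conjugating
    \<open>v * cnj u\<close> exchanges the roles of u and v.\<close>
  proof -
    have "(\<integral>v. ?P v u \<partial>arc_measure) = (\<integral>v. poisson (of_real r * u * cnj v) \<partial>arc_measure)"
    proof (rule Bochner_Integration.integral_cong[OF refl])
      fix v show "?P v u = poisson (of_real r * u * cnj v)"
        using poisson_cnj[of "of_real r * v * cnj u"] by (simp only: complex_cnj_mult complex_cnj_cnj complex_cnj_complex_of_real mult_ac)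
    qed
    also have "\<dots> = 1" using that r by (intro poisson_total) (auto simp: norm_mult circle_norm)
    finally show ?thesis .
  qed
  have contP: "continuous_on circle (?P v)" if "v \<in> circle" for v
    using small that by (intro continuous_on_poisson continuous_intros) auto
  have step: "norm (\<integral>u. \<phi> u * of_real (?P v u) \<partial>arc_measure) powr p \<le> (\<integral>u. norm (\<phi> u) powr p * ?P v u \<partial>arc_measure)"
    if v: "v \<in> circle" for v
  proof -
    \<comment> \<open>Jensen for the density \<open>?P v\<close> comes from Hoelder with the kernel
      split as \<open>P^(1/p) P^(1/q)\<close>; the second factor has norm 1.\<close>
    let ?f = "\<lambda>u. norm (\<phi> u) * ?P v u powr (1 / p)" and ?g = "\<lambda>u. ?P v u powr (1 / q)"
    have fp: "?f u powr p = norm (\<phi> u) powr p * ?P v u" if "u \<in> circle" for u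
      using P0[OF v that] p by (simp add: powr_mult powr_powr)
    have gq: "?g u powr q = ?P v u" if "u \<in> circle" for u
      using P0[OF v that] q(1) by (simp add: powr_powr)
    have fg: "?f u * ?g u = norm (\<phi> u) * ?P v u" if "u \<in> circle" for u
      using P0[OF v that] pq by (simp add: mult.assoc flip: powr_add)
    have c: "continuous_on circle ?f" "continuous_on circle ?g"
      using P0[OF v] p q(1) by (intro continuous_on_mult continuous_on_norm continuous_on_powr' cont contP[OF v] continuous_on_const; simp)+
    have "(\<integral>u. ?f u * ?g u \<partial>arc_measure) \<le> (\<integral>u. ?f u powr p \<partial>arc_measure) powr (1/p) * (\<integral>u. ?g u powr q \<partial>arc_measure) powr (1/q)"
    proof (rule Hoelder_inequality(2)[OF p pq])
      show "integrable arc_measure (\<lambda>u. ?f u powr p)" "integrable arc_measure (\<lambda>u. ?g u powr q)"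
        using p q(1) P0[OF v]
        by (intro continuous_on_circle_integrable continuous_on_powr' c continuous_on_const; simp)+
    qed (use c in \<open>auto intro: continuous_on_circle_measurable\<close>)
    moreover have "(\<integral>u. ?f u * ?g u \<partial>arc_measure) = (\<integral>u. norm (\<phi> u) * ?P v u \<partial>arc_measure)"
      "(\<integral>u. ?f u powr p \<partial>arc_measure) = (\<integral>u. norm (\<phi> u) powr p * ?P v u \<partial>arc_measure)"
      "(\<integral>u. ?g u powr q \<partial>arc_measure) = (\<integral>u. ?P v u \<partial>arc_measure)"
      using fp gq fg by (intro Bochner_Integration.integral_cong[OF refl]; simp)+
    ultimately have *: "(\<integral>u. norm (\<phi> u) * ?P v u \<partial>arc_measure) \<le> (\<integral>u. norm (\<phi> u) powr p * ?P v u \<partial>arc_measure) powr (1/p)"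
      using P1[OF v] by simp
    have "norm (\<integral>u. \<phi> u * of_real (?P v u) \<partial>arc_measure) \<le> (\<integral>u. norm (\<phi> u * of_real (?P v u)) \<partial>arc_measure)"
      by (rule integral_norm_bound)
    also have "\<dots> = (\<integral>u. norm (\<phi> u) * ?P v u \<partial>arc_measure)"
      using P0[OF v] by (intro Bochner_Integration.integral_cong) (auto simp: norm_mult)
    also note *
    finally have "norm (\<integral>u. \<phi> u * of_real (?P v u) \<partial>arc_measure) powr p \<le> ((\<integral>u. norm (\<phi> u) powr p * ?P v u \<partial>arc_measure) powr (1/p)) powr p"
      using p by (intro powr_mono2) auto
    also have "\<dots> = (\<integral>u. norm (\<phi> u) powr p * ?P v u \<partial>arc_measure)"
      using p P0[OF v] by (simp add: powr_powr, subst abs_of_nonneg) (auto intro!: integral_nonneg_AE)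
    finally show ?thesis .
  qed
  let ?G = "\<lambda>v u. norm (\<phi> u) powr p * ?P v u"
  have contG: "continuous_on (circle \<times> circle) (case_prod ?G)"
    unfolding case_prod_unfold
  proof (intro continuous_on_mult continuous_on_powr_norm continuous_on_poisson)
    show "continuous_on (circle \<times> circle) (\<lambda>x. \<phi> (snd x))"
      by (rule continuous_on_compose2[OF cont]) (auto intro!: continuous_intros)
    show "norm (of_real r * fst x * cnj (snd x)) < 1" if "x \<in> circle \<times> circle" for x
      using that small[of "fst x" "snd x"] by auto
  qed (use p in \<open>auto intro!: continuous_intros\<close>)
  have "(\<integral>v. norm (\<integral>u. \<phi> u * of_real (?P v u) \<partial>arc_measure) powr p \<partial>arc_measure) \<le> (\<integral>v. (\<integral>u. ?G v u \<partial>arc_measure) \<partial>arc_measure)"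
    using step Fubini_circle(2)[OF contG]
    by (intro integral_mono') (auto intro!: integral_nonneg_AE mult_nonneg_nonneg P0 AE_I2)
  also have "\<dots> = (\<integral>u. (\<integral>v. ?G v u \<partial>arc_measure) \<partial>arc_measure)"
    by (rule Fubini_circle(1)[OF contG])
  also have "\<dots> = (\<integral>u. norm (\<phi> u) powr p \<partial>arc_measure)"
    using P2 by (intro Bochner_Integration.integral_cong) auto
  finally show ?thesis .
qed

text \<open>The p-th power of the integral mean \<open>M_p(r, f)\<close>. Without the root it can be
  integrated in r directly.\<close>

definition mean_pow :: "real \<Rightarrow> (complex \<Rightarrow> complex) \<Rightarrow> real \<Rightarrow> real" where
  "mean_pow p f r = (\<integral>u. norm (f (of_real r * u)) powr p \<partial>arc_measure)"

lemma mean_pow_nonneg: "0 \<le> mean_pow p f r"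
  unfolding mean_pow_def by (intro integral_nonneg_AE) auto

text \<open>Instead of subharmonicity: on the circle of radius r, f is the Poisson integral, at
  distance r / \<open>\<rho>\<close> from the origin, of its values on the circle of radius
  \<open>\<rho>\<close>, and Poisson integrals contract the mean.\<close>

lemma mean_pow_mono:
  assumes "1 < p" "f holomorphic_on ball 0 R" "0 \<le> r" "r \<le> \<rho>" "\<rho> < R"
  shows "mean_pow p f r \<le> mean_pow p f \<rho>"
proof (cases "r = \<rho>")
  case False
  define x where "x = r / \<rho>"
  have \<rho>: "0 < \<rho>" and x: "0 \<le> x" "x < 1" "r = \<rho> * x" using assms False by (auto simp: x_def)
  have "mean_pow p f r = (\<integral>v. norm (\<integral>u. f (of_real \<rho> * u) * of_real (poisson (of_real x * v * cnj u)) \<partial>arc_measure) powr p \<partial>arc_measure)"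
    unfolding mean_pow_def
  proof (rule Bochner_Integration.integral_cong[OF refl])
    fix v assume "v \<in> space arc_measure"
    then show "norm (f (of_real r * v)) powr p = norm (\<integral>u. f (of_real \<rho> * u) * of_real (poisson (of_real x * v * cnj u)) \<partial>arc_measure) powr p"
      using x \<rho> assms by (subst poisson_holomorphic[OF assms(2)]) (auto simp: circle_norm norm_mult mult.assoc)
  qed
  also have "\<dots> \<le> mean_pow p f \<rho>"
    unfolding mean_pow_def using assms x \<rho>
    by (intro poisson_contraction holomorphic_circle_continuous[OF assms(2)]) auto
  finally show ?thesis .
qed simp

lemma mean_pow_rotate:
  assumes "f holomorphic_on ball 0 R" "norm c < R" "0 < p"
  shows "(\<integral>u. norm (f (c * u)) powr p \<partial>arc_measure) = mean_pow p f (norm c)"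
proof -
  have "c * u = of_real (norm c) * (direction c * u)" for u
    by (simp add: norm_times_direction flip: mult.assoc)
  then have "(\<integral>u. norm (f (c * u)) powr p \<partial>arc_measure) = (\<integral>u. norm (f (of_real (norm c) * (direction c * u))) powr p \<partial>arc_measure)"
    by presburger
  also have "\<dots> = (\<integral>u. norm (f (of_real (norm c) * u)) powr p \<partial>arc_measure)"
    using direction_in_circle[of c] assms
    by (intro integral_arc_rotate[of "direction c" "\<lambda>u. norm (f (of_real (norm c) * u)) powr p"]
       continuous_on_circle_measurable continuous_on_powr_norm holomorphic_circle_continuous[OF assms(1)])
       (auto simp: circle_norm)
  finally show ?thesis by (simp add: mean_pow_def)
qed

text \<open>Cauchy's formula read as the k-th Fourier coefficient of f on a small circle around
  a.\<close>

lemma Cauchy_circle: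
  assumes f: "f holomorphic_on ball a R" and d: "0 < d" "d < R"
  shows "(deriv ^^ k) f a = fact k / of_real d ^ k * (\<integral>u. cnj u ^ k * f (a + of_real d * u) \<partial>arc_measure)"
proof -
  have "(\<lambda>z. f (a + z)) holomorphic_on ball 0 R"
    by (rule holomorphic_on_compose_gen[OF _ f, unfolded o_def]) (auto intro!: holomorphic_intros simp: dist_norm)
  from coeff_integral[OF this, of d k] d
  have "(\<integral>u. cnj u ^ k * f (a + of_real d * u) \<partial>arc_measure) = (deriv ^^ k) (\<lambda>z. f (a + z)) 0 / fact k * of_real d ^ k"
    by (simp add: taylor_coeff_def)
  moreover have "(deriv ^^ k) (\<lambda>z. f (a + z)) 0 = (deriv ^^ k) f a"
    using higher_deriv_shift_0[of k f a] by (simp add: o_def)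
  ultimately show ?thesis using d by simp
qed

text \<open>Cauchy's formula on the circle of radius d around \<open>r v\<close>, then Jensen, then
  Fubini. With that circle parametrized as \<open>v (r + d u)\<close>, the v-integral for fixed u is
  an integral mean at radius \<open>|r + d u| \<le> r + d\<close>, and monotonicity applies.\<close>

lemma mean_pow_deriv:
  assumes p: "1 < p" and f: "f holomorphic_on disc" and r: "0 \<le> r" and d: "0 < d" "r + d < 1"
  shows "mean_pow p ((deriv ^^ k) f) r \<le> (fact k / d ^ k) powr p * mean_pow p f (r + d)"
proof -
  define c where "c = fact k / d ^ k"
  have c: "0 < c" using d by (simp add: c_def)
  let ?G = "\<lambda>v u. norm (f (v * (of_real r + of_real d * u))) powr p"
  have inside: "norm (v * (of_real r + of_real d * u)) < 1" if "v \<in> circle" "u \<in> circle" for u v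
  proof -
    have "norm (of_real r + of_real d * u) \<le> r + d"
      using that r d norm_triangle_ineq[of "of_real r" "of_real d * u"] by (simp add: norm_mult circle_norm)
    then show ?thesis using that d by (simp add: norm_mult circle_norm)
  qed
  have contf: "continuous_on disc f" using f by (rule holomorphic_on_imp_continuous_on)
  have step: "norm ((deriv ^^ k) f (of_real r * v)) powr p \<le> c powr p * (\<integral>u. ?G v u \<partial>arc_measure)" if v: "v \<in> circle" for v
  proof -
    have sub: "ball (of_real r * v) (1 - r) \<subseteq> disc"
    proof
      fix z assume "z \<in> ball (of_real r * v) (1 - r)"
      then have "norm (z - of_real r * v) < 1 - r" by (simp add: dist_norm norm_minus_commute)
      moreover have "norm z \<le> norm (z - of_real r * v) + norm (of_real r * v)"
        using norm_triangle_ineq[of "z - of_real r * v" "of_real r * v"] by simp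
      ultimately show "z \<in> disc" using v r by (simp add: norm_mult circle_norm)
    qed
    have contv: "continuous_on circle (\<lambda>u. f (of_real r * v + of_real d * u))"
    proof (intro continuous_on_compose2[OF contf] continuous_intros)
      show "(\<lambda>u. of_real r * v + of_real d * u) ` circle \<subseteq> disc"
        using v r d by (auto simp: circle_norm norm_mult intro!: le_less_trans[OF norm_triangle_ineq])
    qed
    have contv': "continuous_on circle (\<lambda>u. f (v * (of_real r + of_real d * u)))"
      using inside[OF v] by (intro continuous_on_compose2[OF contf] continuous_intros) auto
    have "norm ((deriv ^^ k) f (of_real r * v)) = c * norm (\<integral>u. cnj u ^ k * f (of_real r * v + of_real d * u) \<partial>arc_measure)"
      using Cauchy_circle[OF holomorphic_on_subset[OF f sub], of d k] d
      by (simp add: norm_mult norm_divide norm_power c_def)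
    also have "\<dots> \<le> c * (\<integral>u. norm (cnj u ^ k * f (of_real r * v + of_real d * u)) \<partial>arc_measure)"
      using c by (intro mult_left_mono integral_norm_bound) auto
    also have "(\<integral>u. norm (cnj u ^ k * f (of_real r * v + of_real d * u)) \<partial>arc_measure) = (\<integral>u. norm (f (of_real r * v + of_real d * u)) \<partial>arc_measure)"
      by (intro Bochner_Integration.integral_cong) (auto simp: norm_mult norm_power circle_norm)
    \<comment> \<open>Rotating u by v makes v a common factor of the argument of f.\<close>
    also have "\<dots> = (\<integral>u. norm (f (of_real r * v + of_real d * (v * u))) \<partial>arc_measure)"
      using v contv by (intro integral_arc_rotate[of v "\<lambda>u. norm (f (of_real r * v + of_real d * u))", symmetric]
        continuous_on_circle_measurable continuous_intros) (auto simp: circle_norm)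
    also have "\<dots> = (\<integral>u. norm (f (v * (of_real r + of_real d * u))) \<partial>arc_measure)"
      by (simp add: algebra_simps)
    finally have "norm ((deriv ^^ k) f (of_real r * v)) powr p \<le> (c * (\<integral>u. norm (f (v * (of_real r + of_real d * u))) \<partial>arc_measure)) powr p"
      using p by (intro powr_mono2) auto
    also have "\<dots> = c powr p * (\<integral>u. norm (f (v * (of_real r + of_real d * u))) \<partial>arc_measure) powr p"
      by (rule powr_mult)
    also have "\<dots> \<le> c powr p * (\<integral>u. ?G v u \<partial>arc_measure)"
      using p contv' by (intro mult_left_mono Jensen_circle continuous_intros) auto
    finally show ?thesis .
  qed
  have contG: "continuous_on (circle \<times> circle) (case_prod ?G)"
    unfolding case_prod_unfold using inside p
    by (intro continuous_on_powr_norm continuous_on_compose2[OF contf] continuous_intros) auto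
  have "mean_pow p ((deriv ^^ k) f) r \<le> (\<integral>v. c powr p * (\<integral>u. ?G v u \<partial>arc_measure) \<partial>arc_measure)"
    unfolding mean_pow_def using step Fubini_circle(2)[OF contG]
    by (intro integral_mono' integrable_mult_right) (auto intro!: integral_nonneg_AE mult_nonneg_nonneg)
  also have "\<dots> = c powr p * (\<integral>u. (\<integral>v. ?G v u \<partial>arc_measure) \<partial>arc_measure)"
    using Fubini_circle(1)[OF contG] by simp
  also have "\<dots> \<le> c powr p * (\<integral>u. mean_pow p f (r + d) \<partial>arc_measure)"
  proof (intro mult_left_mono integral_mono')
    fix u assume "u \<in> space arc_measure"
    then have u: "u \<in> circle" by simp
    have nle: "norm (of_real r + of_real d * u) \<le> r + d"
      using u r d norm_triangle_ineq[of "of_real r" "of_real d * u"] by (simp add: norm_mult circle_norm)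
    \<comment> \<open>For fixed u the point \<open>r + d u\<close> is merely rotated by v, so the
      v-integral depends on its modulus alone.\<close>
    have "(\<integral>v. ?G v u \<partial>arc_measure) = mean_pow p f (norm (of_real r + of_real d * u))"
      using mean_pow_rotate[OF f, of "of_real r + of_real d * u" p] nle d p by (simp add: mult.commute)
    also have "\<dots> \<le> mean_pow p f (r + d)"
      using nle d r by (intro mean_pow_mono[OF p f]) auto
    finally show "(\<integral>v. ?G v u \<partial>arc_measure) \<le> mean_pow p f (r + d)" .
  qed (auto simp: mean_pow_nonneg)
  finally show ?thesis by (simp add: c_def)
qed

section \<open>The Riesz projection\<close>

text \<open>The trigonometric inequality behind M. Riesz' theorem. With t = arg z it reads
  \<open>1 \<le> A cos^p t - B cos (p t)\<close> on (-pi/2, pi/2): near the endpoints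
  \<open>cos (p t)\<close> is negative because 1 < p and \<open>p * pi / 2 \<le> pi\<close>,
  elsewhere \<open>cos t\<close> is bounded below.\<close>

lemma powr_Re_inequality:
  assumes p: "1 < p" "p \<le> 2"
  shows "\<exists>A>0. \<exists>B>0. \<forall>z. 0 < Re z \<longrightarrow> norm z powr p \<le> A * Re z powr p - B * Re (z powr of_real p)"
proof -
  \<comment> \<open>Chosen so that \<open>p * t0\<close> lies midway between \<open>pi / 2\<close>
    and \<open>p * pi / 2\<close>.\<close>
  define t0 where "t0 = pi / 2 * ((1 + p) / (2 * p))"
  have t0: "0 < t0" "t0 < pi / 2" "p * t0 = pi / 2 * ((1 + p) / 2)"
    using p by (auto simp: t0_def field_simps intro!: add_pos_pos)
  have pt0: "pi / 2 < p * t0" "p * t0 < pi"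
    using p unfolding t0(3) by auto
  define c where "c = - cos (p * t0)"
  have c: "0 < c"
  proof -
    have "cos (p * t0) < cos (pi / 2)" using pt0 by (intro cos_monotone_0_pi) auto
    then show ?thesis by (simp add: c_def)
  qed
  \<comment> \<open>B makes the second term alone at least 1 beyond t0; A then pays for both 1 and B
    on the range up to t0.\<close>
  define B where "B = 1 / c"
  define A where "A = (1 + B) / cos t0 powr p"
  have B: "0 < B" using c by (simp add: B_def)
  have ct0: "0 < cos t0" using t0 by (intro cos_gt_zero_pi) auto
  have A: "0 < A" using B ct0 by (simp add: A_def add_pos_pos)
  have key: "1 \<le> A * cos t powr p - B * cos (p * t)" if "\<bar>t\<bar> < pi / 2" for t
  proof (cases "\<bar>t\<bar> \<le> t0")
    case True
    have "cos t0 \<le> cos \<bar>t\<bar>" using True t0 by (intro cos_monotone_0_pi_le) auto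
    then have "cos t0 powr p \<le> cos t powr p" using ct0 p by (intro powr_mono2) auto
    then have "A * cos t0 powr p \<le> A * cos t powr p" using A by simp
    moreover have "A * cos t0 powr p = 1 + B" using ct0 by (simp add: A_def)
    moreover have "B * cos (p * t) \<le> B" using B cos_le_one[of "p * t"] by simp
    ultimately show ?thesis by linarith
  next
    case False
    have "cos (p * \<bar>t\<bar>) \<le> cos (p * t0)"
    proof (rule cos_monotone_0_pi_le)
      show "0 \<le> p * t0" using p t0 by simp
      show "p * t0 \<le> p * \<bar>t\<bar>" using p False by simp
      have "p * \<bar>t\<bar> \<le> 2 * (pi / 2)" using p that by (intro mult_mono) auto
      then show "p * \<bar>t\<bar> \<le> pi" by simp
    qed
    moreover have "cos (p * \<bar>t\<bar>) = cos (p * t)" by (cases "0 \<le> t") auto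
    ultimately have "c \<le> - cos (p * t)" by (simp add: c_def)
    then have "B * c \<le> B * (- cos (p * t))" using B by (intro mult_left_mono) auto
    then have "1 \<le> - B * cos (p * t)" using c by (simp add: B_def)
    moreover have "0 \<le> A * cos t powr p" using A by simp
    ultimately show ?thesis by linarith
  qed
  have "norm z powr p \<le> A * Re z powr p - B * Re (z powr of_real p)" if z: "0 < Re z" for z
  proof -
    define t where "t = Im (Ln z)"
    have z0: "z \<noteq> 0" using z by auto
    have t: "\<bar>t\<bar> < pi / 2" unfolding t_def using z Re_Ln_pos_lt[OF z0] by simp
    have polar: "z = of_real (norm z) * cis t"
      using exp_Ln[OF z0] Re_Ln[OF z0] z0 by (metis Euler t_def complex_norm_eq_1_exp exp_eq_polar norm_exp_eq_Re)
    have Rez: "Re z = norm z * cos t" by (subst polar) simp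
    have ct: "0 < cos t" using t by (intro cos_gt_zero_pi) auto
    have "z powr of_real p = exp (of_real p * Ln z)" using z0 by (simp add: powr_def)
    then have "Re (z powr of_real p) = exp (p * ln (norm z)) * cos (p * t)"
      using Re_Ln[OF z0] by (simp add: Re_exp t_def)
    also have "exp (p * ln (norm z)) = norm z powr p" using z0 by (simp add: powr_def)
    finally have "A * Re z powr p - B * Re (z powr of_real p) = norm z powr p * (A * cos t powr p - B * cos (p * t))"
      unfolding Rez using ct by (simp add: powr_mult algebra_simps)
    moreover have "norm z powr p * 1 \<le> norm z powr p * (A * cos t powr p - B * cos (p * t))"
      using key[OF t] by (intro mult_left_mono) auto
    ultimately show ?thesis by simp
  qed
  with A B show ?thesis by blast
qed

lemma cauchy_transform_holomorphic:
  assumes "continuous_on circle \<phi>"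
  shows "cauchy_transform \<phi> holomorphic_on disc"
proof (rule power_series_holomorphic)
  fix w :: complex assume "w \<in> disc"
  then show "(\<lambda>n. fourier \<phi> n * (w - 0) ^ n) sums cauchy_transform \<phi> w"
    using cauchy_transform_sums[OF assms, of w] by simp
qed

lemma cauchy_kernel_ne: "norm z < 1 \<Longrightarrow> u \<in> circle \<Longrightarrow> 1 - z * cnj u \<noteq> 0"
proof -
  assume "norm z < 1" "u \<in> circle"
  then have "norm (z * cnj u) < 1" by (simp add: norm_mult circle_norm)
  then have "z * cnj u \<noteq> 1" by force
  then show ?thesis by simp
qed

lemma cauchy_integrable:
  "continuous_on circle \<phi> \<Longrightarrow> norm z < 1 \<Longrightarrow> integrable arc_measure (\<lambda>u. \<phi> u * (1 / (1 - z * cnj u)))"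
  by (intro continuous_on_circle_integrable continuous_intros ballI cauchy_kernel_ne)

text \<open>Twice the Cauchy transform minus the mean is the Herglotz integral, the analytic
  function whose real part is the Poisson integral of \<open>\<phi>\<close>.\<close>

lemma herglotz_Re:
  fixes \<phi> :: "complex \<Rightarrow> real"
  assumes "continuous_on circle \<phi>" "norm z < 1"
  shows "Re (2 * cauchy_transform (\<lambda>u. of_real (\<phi> u)) z - fourier (\<lambda>u. of_real (\<phi> u)) 0)
     = (\<integral>u. \<phi> u * poisson (z * cnj u) \<partial>arc_measure)"
proof -
  let ?h = "\<lambda>u. 2 * (of_real (\<phi> u) * (1 / (1 - z * cnj u))) - complex_of_real (\<phi> u)"
  have int: "integrable arc_measure (\<lambda>u. of_real (\<phi> u) * (1 / (1 - z * cnj u)))"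
    "integrable arc_measure (\<lambda>u. complex_of_real (\<phi> u))"
    using assms by (intro cauchy_integrable continuous_on_circle_integrable continuous_intros; simp)+
  have "2 * cauchy_transform (\<lambda>u. of_real (\<phi> u)) z - fourier (\<lambda>u. of_real (\<phi> u)) 0 = (\<integral>u. ?h u \<partial>arc_measure)"
    unfolding cauchy_transform_def fourier_def power_0 mult_1_right
    by (simp only: Bochner_Integration.integral_diff int integrable_mult_right integral_mult_right_zero)
  moreover have "Re (\<integral>u. ?h u \<partial>arc_measure) = (\<integral>u. Re (?h u) \<partial>arc_measure)"
    by (intro integral_Re[symmetric] Bochner_Integration.integrable_diff integrable_mult_right int)
  moreover have "(\<integral>u. Re (?h u) \<partial>arc_measure) = (\<integral>u. \<phi> u * poisson (z * cnj u) \<partial>arc_measure)"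
  proof (rule Bochner_Integration.integral_cong[OF refl])
    fix u assume "u \<in> space arc_measure"
    then have u: "norm (z * cnj u) < 1" "1 - z * cnj u \<noteq> 0"
      using assms cauchy_kernel_ne[of z u] by (auto simp: norm_mult circle_norm)
    let ?w = "z * cnj u"
    have "complex_of_real (poisson ?w) = 1 / (1 - ?w) + cnj (?w / (1 - ?w))"
      using poisson_eq[OF u(1)] by simp
    then have "poisson ?w = Re (1 / (1 - ?w)) + Re (?w / (1 - ?w))"
      by (metis Re_complex_of_real complex_cnj(1) complex_surj plus_complex.sel(1) cnj.sel(1))
    moreover have "?w / (1 - ?w) = 1 / (1 - ?w) - 1" using u(2) by (simp add: field_simps)
    ultimately have "poisson ?w = 2 * Re (1 / (1 - ?w)) - 1" by simp
    then have "\<phi> u * poisson ?w = \<phi> u * (2 * Re (1 / (1 - ?w)) - 1)" by simp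
    moreover have "Re (of_real (\<phi> u) * (1 / (1 - ?w))) = \<phi> u * Re (1 / (1 - ?w))"
      by (simp only: times_complex.sel Re_complex_of_real Im_complex_of_real mult_zero_left diff_zero)
    moreover have "Re (?h u) = 2 * Re (of_real (\<phi> u) * (1 / (1 - ?w))) - \<phi> u"
      by (simp only: minus_complex.sel times_complex.sel Re_complex_of_real complex_Re_numeral complex_Im_numeral mult_zero_left diff_zero)
    ultimately show "Re (?h u) = \<phi> u * poisson ?w" by (simp only: algebra_simps)
  qed
  ultimately show ?thesis by simp
qed

text \<open>For nonnegative \<open>\<phi>\<close> the Herglotz integral F has positive real part, so
  \<open>F powr p\<close> is analytic. In the integrated form of \<open>powr_Re_inequality\<close>
  the term with B is B times the value of \<open>F powr p\<close> at 0, which is positive and may be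
  dropped; what remains is the mean of the Poisson integral Re F.\<close>

lemma Riesz_nonneg:
  assumes p: "1 < p" "p \<le> 2"
  shows "\<exists>C>0. \<forall>\<phi> r. continuous_on circle \<phi> \<longrightarrow> (\<forall>u\<in>circle. 0 \<le> \<phi> u) \<longrightarrow> 0 \<le> r \<longrightarrow> r < 1 \<longrightarrow>
     mean_pow p (cauchy_transform (\<lambda>u. of_real (\<phi> u))) r \<le> C * (\<integral>u. \<phi> u powr p \<partial>arc_measure)"
proof -
  obtain A B where AB: "0 < A" "0 < B" and key: "\<And>z. 0 < Re z \<Longrightarrow> norm z powr p \<le> A * Re z powr p - B * Re (z powr of_real p)"
    using powr_Re_inequality[OF p] by blast
  \<comment> \<open>The summand A bounds the Herglotz integral, the summand 1 the mean I via
    Jensen.\<close>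
  define C where "C = 2 powr p * (A + 1)"
  have "mean_pow p (cauchy_transform (\<lambda>u. of_real (\<phi> u))) r \<le> C * (\<integral>u. \<phi> u powr p \<partial>arc_measure)"
    if cont: "continuous_on circle \<phi>" and nn: "\<And>u. u \<in> circle \<Longrightarrow> 0 \<le> \<phi> u" and r: "0 \<le> r" "r < 1" for \<phi> :: "complex \<Rightarrow> real" and r
  proof -
    let ?c\<phi> = "\<lambda>u. complex_of_real (\<phi> u)"
    have contc: "continuous_on circle ?c\<phi>" using cont by (intro continuous_intros)
    define I where "I = (\<integral>u. \<phi> u \<partial>arc_measure)"
    have I0: "fourier ?c\<phi> 0 = of_real I" by (simp add: fourier_def I_def)
    have I: "0 \<le> I" unfolding I_def using nn by (auto intro!: integral_nonneg_AE)
    have Ip: "I powr p \<le> (\<integral>u. \<phi> u powr p \<partial>arc_measure)"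
      unfolding I_def using p cont nn by (intro Jensen_circle) auto
    define F where "F z = 2 * cauchy_transform ?c\<phi> z - of_real I" for z
    have holF: "F holomorphic_on disc" unfolding F_def
      using cauchy_transform_holomorphic[OF contc] by (intro holomorphic_intros)
    have ReF: "Re (F z) = (\<integral>u. \<phi> u * poisson (z * cnj u) \<partial>arc_measure)" if "norm z < 1" for z
      using herglotz_Re[OF cont that] by (simp add: F_def I0)
    have F0: "F 0 = of_real I"
      using cauchy_transform_sums[OF contc, of 0] I0 unfolding F_def cauchy_transform_def fourier_def by simp
    have small: "norm (of_real r * v) < 1" if "v \<in> circle" for v :: complex
      using that r by (simp add: circle_norm norm_mult)
    have contF: "continuous_on circle (\<lambda>v. F (of_real r * v))"
      using r by (intro holomorphic_circle_continuous[OF holF]) auto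
    have contract: "(\<integral>v. \<bar>Re (F (of_real r * v))\<bar> powr p \<partial>arc_measure) \<le> (\<integral>u. \<phi> u powr p \<partial>arc_measure)"
    proof -
      have "(\<integral>v. \<bar>Re (F (of_real r * v))\<bar> powr p \<partial>arc_measure) =
         (\<integral>v. norm (\<integral>u. ?c\<phi> u * of_real (poisson (of_real r * v * cnj u)) \<partial>arc_measure) powr p \<partial>arc_measure)"
      proof (rule Bochner_Integration.integral_cong[OF refl])
        fix v assume "v \<in> space arc_measure"
        then have "Re (F (of_real r * v)) = (\<integral>u. \<phi> u * poisson (of_real r * v * cnj u) \<partial>arc_measure)"
          using ReF small by simp
        then show "\<bar>Re (F (of_real r * v))\<bar> powr p = norm (\<integral>u. ?c\<phi> u * of_real (poisson (of_real r * v * cnj u)) \<partial>arc_measure) powr p"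
          by (simp flip: of_real_mult)
      qed
      also have "\<dots> \<le> (\<integral>u. norm (?c\<phi> u) powr p \<partial>arc_measure)"
        by (rule poisson_contraction[OF p(1) contc r])
      also have "\<dots> = (\<integral>u. \<phi> u powr p \<partial>arc_measure)"
        using nn by (intro Bochner_Integration.integral_cong) auto
      finally show ?thesis .
    qed
    have meanF: "(\<integral>v. norm (F (of_real r * v)) powr p \<partial>arc_measure) \<le> A * (\<integral>u. \<phi> u powr p \<partial>arc_measure)"
    \<comment> \<open>A zero mean makes F vanish identically; it is set apart because strict
      positivity of Re F then fails.\<close>
    proof (cases "I = 0")
      case True
      have "AE u in arc_measure. \<phi> u = 0"
        using True nn unfolding I_def by (subst (asm) integral_nonneg_eq_0_iff_AE) (auto intro: continuous_on_circle_integrable[OF cont])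
      then have "cauchy_transform ?c\<phi> z = 0" for z
        unfolding cauchy_transform_def by (intro integral_eq_zero_AE) auto
      then have "F z = 0" for z by (simp add: F_def True)
      then show ?thesis using AB p nn by (auto intro!: mult_nonneg_nonneg integral_nonneg_AE)
    next
      case False
      then have Ipos: "0 < I" using I by simp
      have pos: "0 < Re (F z)" if z: "norm z < 1" for z
      proof -
        have "(\<integral>u. \<phi> u * ((1 - (norm z)\<^sup>2) / 4) \<partial>arc_measure) \<le> (\<integral>u. \<phi> u * poisson (z * cnj u) \<partial>arc_measure)"
        proof (rule integral_mono)
          show "integrable arc_measure (\<lambda>u. \<phi> u * poisson (z * cnj u))"
            using z cont by (intro continuous_on_circle_integrable continuous_intros continuous_on_poisson)
              (auto simp: norm_mult circle_norm)
          show "integrable arc_measure (\<lambda>u. \<phi> u * ((1 - (norm z)\<^sup>2) / 4))"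
            using cont by (intro continuous_on_circle_integrable continuous_intros) auto
          fix u assume "u \<in> space arc_measure"
          then show "\<phi> u * ((1 - (norm z)\<^sup>2) / 4) \<le> \<phi> u * poisson (z * cnj u)"
            using poisson_lower[of "z * cnj u"] z nn[of u] by (intro mult_left_mono) (auto simp: norm_mult circle_norm)
        qed
        moreover have "(\<integral>u. \<phi> u * ((1 - (norm z)\<^sup>2) / 4) \<partial>arc_measure) = I * ((1 - (norm z)\<^sup>2) / 4)"
          unfolding I_def by (rule integral_mult_left_zero)
        moreover have "0 < I * ((1 - (norm z)\<^sup>2) / 4)"
          using Ipos z abs_square_less_1[of "norm z"] by simp
        ultimately show ?thesis using ReF[OF z] by linarith
      qed
      have hol: "(\<lambda>z. F z powr of_real p) holomorphic_on disc"
        using pos by (intro holomorphic_on_powr_right holomorphic_on_compose_gen[of F _ "\<lambda>z. z powr of_real p" "{z. 0 < Re z}", unfolded o_def] holF holomorphic_intros)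
          (auto simp: complex_nonpos_Reals_iff)
      \<comment> \<open>Mean value property together with F(0) = I > 0.\<close>
      have mean: "(\<integral>v. F (of_real r * v) powr of_real p \<partial>arc_measure) = of_real (I powr p)"
        using coeff_integral_neg[OF hol, of r 0] r Ipos by (simp add: F0 powr_of_real)
      have contFp: "continuous_on circle (\<lambda>v. F (of_real r * v) powr of_real p)"
        using r by (intro holomorphic_circle_continuous[OF hol]) auto
      note intFp = continuous_on_circle_integrable[OF contFp]
      have intRe: "integrable arc_measure (\<lambda>v. Re (F (of_real r * v)) powr p)"
        using contF p pos small by (intro continuous_on_circle_integrable continuous_on_powr' continuous_intros) (auto simp: less_imp_le)
      have "(\<integral>v. norm (F (of_real r * v)) powr p \<partial>arc_measure)
         \<le> (\<integral>v. A * Re (F (of_real r * v)) powr p - B * Re (F (of_real r * v) powr of_real p) \<partial>arc_measure)"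
        using intFp intRe p contF small pos
        by (intro integral_mono continuous_on_circle_integrable[OF continuous_on_powr_norm] key) auto
      also have "\<dots> = A * (\<integral>v. Re (F (of_real r * v)) powr p \<partial>arc_measure) - B * Re (\<integral>v. F (of_real r * v) powr of_real p \<partial>arc_measure)"
        using intFp intRe by simp
      also have "\<dots> \<le> A * (\<integral>v. Re (F (of_real r * v)) powr p \<partial>arc_measure)"
        unfolding mean using AB by simp
      also have "(\<integral>v. Re (F (of_real r * v)) powr p \<partial>arc_measure) = (\<integral>v. \<bar>Re (F (of_real r * v))\<bar> powr p \<partial>arc_measure)"
        using pos small by (intro Bochner_Integration.integral_cong) (auto simp: abs_of_pos)
      also have "A * (\<integral>v. \<bar>Re (F (of_real r * v))\<bar> powr p \<partial>arc_measure) \<le> A * (\<integral>u. \<phi> u powr p \<partial>arc_measure)"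
        using contract AB by (intro mult_left_mono) auto
      finally show ?thesis .
    qed
    have "mean_pow p (cauchy_transform ?c\<phi>) r \<le> (\<integral>v. 2 powr p * (norm (F (of_real r * v)) powr p + I powr p) \<partial>arc_measure)"
      unfolding mean_pow_def
    proof (rule integral_mono)
      have contT: "continuous_on circle (\<lambda>v. cauchy_transform ?c\<phi> (of_real r * v))"
        using r by (intro holomorphic_circle_continuous[OF cauchy_transform_holomorphic[OF contc]]) auto
      show "integrable arc_measure (\<lambda>v. norm (cauchy_transform ?c\<phi> (of_real r * v)) powr p)"
        using contT p by (intro continuous_on_circle_integrable continuous_on_powr_norm) auto
      show "integrable arc_measure (\<lambda>v. 2 powr p * (norm (F (of_real r * v)) powr p + I powr p))"
        using contF p by (intro continuous_on_circle_integrable continuous_intros continuous_on_powr_norm) auto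
      fix v assume "v \<in> space arc_measure"
      let ?T = "cauchy_transform ?c\<phi> (of_real r * v)"
      \<comment> \<open>The Cauchy transform is (F + I) / 2; the factor 1/2 is given away.\<close>
      have "norm ?T \<le> 2 * norm ?T" by simp
      also have "\<dots> = norm (F (of_real r * v) + of_real I)" by (simp add: F_def norm_mult)
      also have "\<dots> \<le> norm (F (of_real r * v)) + I" using I norm_triangle_ineq[of "F (of_real r * v)" "of_real I"] by simp
      finally have "norm ?T powr p \<le> (norm (F (of_real r * v)) + I) powr p" using p by (intro powr_mono2) auto
      also have "\<dots> \<le> 2 powr p * (norm (F (of_real r * v)) powr p + I powr p)"
        using I p by (intro powr_add_le) auto
      finally show "norm ?T powr p \<le> 2 powr p * (norm (F (of_real r * v)) powr p + I powr p)" .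
    qed
    also have "\<dots> = 2 powr p * ((\<integral>v. norm (F (of_real r * v)) powr p \<partial>arc_measure) + I powr p)"
      using continuous_on_circle_integrable[OF continuous_on_powr_norm[OF contF]] p by simp
    also have "\<dots> \<le> 2 powr p * (A * (\<integral>u. \<phi> u powr p \<partial>arc_measure) + (\<integral>u. \<phi> u powr p \<partial>arc_measure))"
      using meanF Ip by (intro mult_left_mono add_mono) auto
    also have "\<dots> = C * (\<integral>u. \<phi> u powr p \<partial>arc_measure)" by (simp add: C_def algebra_simps)
    finally show ?thesis .
  qed
  moreover have "0 < C" using AB by (simp add: C_def)
  ultimately show ?thesis by blast
qed

text \<open>Positive and negative parts of the real and imaginary part are again continuous, so
  linearity reduces to four nonnegative functions. The two factors \<open>2 powr p\<close> in the
  constant come from two nested uses of \<open>powr_add_le\<close>.\<close>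

lemma Riesz_cauchy:
  assumes p: "1 < p" "p \<le> 2"
  shows "\<exists>C>0. \<forall>\<phi> r. continuous_on circle \<phi> \<longrightarrow> 0 \<le> r \<longrightarrow> r < 1 \<longrightarrow>
     mean_pow p (cauchy_transform \<phi>) r \<le> C * (\<integral>u. norm (\<phi> u) powr p \<partial>arc_measure)"
proof -
  obtain C where C: "0 < C" and R: "\<And>\<phi> r. continuous_on circle \<phi> \<Longrightarrow> (\<And>u. u \<in> circle \<Longrightarrow> 0 \<le> \<phi> u) \<Longrightarrow> 0 \<le> r \<Longrightarrow> r < 1 \<Longrightarrow>
     mean_pow p (cauchy_transform (\<lambda>u. of_real (\<phi> u))) r \<le> C * (\<integral>u. \<phi> u powr p \<partial>arc_measure)"
    using Riesz_nonneg[OF p] by blast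
  define D where "D = 2 powr p * (2 powr p * (4 * C))"
  have "mean_pow p (cauchy_transform \<phi>) r \<le> D * (\<integral>u. norm (\<phi> u) powr p \<partial>arc_measure)"
    if cont: "continuous_on circle \<phi>" and r: "0 \<le> r" "r < 1" for \<phi> r
  proof -
    let ?I = "\<integral>u. norm (\<phi> u) powr p \<partial>arc_measure"
    define g where "g i u = (if i = (0::nat) then max (Re (\<phi> u)) 0 else if i = 1 then max (- Re (\<phi> u)) 0
       else if i = 2 then max (Im (\<phi> u)) 0 else max (- Im (\<phi> u)) 0)" for i u
    have contg: "continuous_on circle (g i)" for i
      unfolding g_def using cont by (cases "i = 0"; cases "i = 1"; cases "i = 2") (auto intro!: continuous_intros)
    have g0: "0 \<le> g i u" for i u by (auto simp: g_def)
    have gle: "g i u \<le> norm (\<phi> u)" for i u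
      using abs_Re_le_cmod[of "\<phi> u"] abs_Im_le_cmod[of "\<phi> u"] by (auto simp: g_def)
    let ?T = "\<lambda>i. cauchy_transform (\<lambda>u. of_real (g i u))"
    have split: "\<phi> u = of_real (g 0 u) - of_real (g 1 u) + \<i> * (of_real (g 2 u) - of_real (g 3 u))" for u
      by (auto simp: g_def complex_eq_iff max_def)
    have bound: "mean_pow p (?T i) r \<le> C * ?I" for i
    proof -
      have "mean_pow p (?T i) r \<le> C * (\<integral>u. g i u powr p \<partial>arc_measure)"
        by (intro R contg g0 r)
      also have "\<dots> \<le> C * ?I"
        using C cont contg g0 gle p
        by (intro mult_left_mono integral_mono continuous_on_circle_integrable continuous_on_powr_norm powr_mono2 continuous_on_powr' continuous_intros) auto
      finally show ?thesis .
    qed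
    have T: "cauchy_transform \<phi> z = ?T 0 z - ?T 1 z + \<i> * (?T 2 z - ?T 3 z)" if "norm z < 1" for z
    proof -
      have int: "integrable arc_measure (\<lambda>u. of_real (g i u) * (1 / (1 - z * cnj u)))" for i
        by (intro cauchy_integrable that continuous_intros contg)
      have "cauchy_transform \<phi> z = (\<integral>u. (of_real (g 0 u) * (1 / (1 - z * cnj u)) - of_real (g 1 u) * (1 / (1 - z * cnj u)))
          + \<i> * (of_real (g 2 u) * (1 / (1 - z * cnj u)) - of_real (g 3 u) * (1 / (1 - z * cnj u))) \<partial>arc_measure)"
        unfolding cauchy_transform_def by (subst split) (simp add: algebra_simps diff_divide_distrib add_divide_distrib)
      also have "\<dots> = ?T 0 z - ?T 1 z + \<i> * (?T 2 z - ?T 3 z)"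
        unfolding cauchy_transform_def by (simp only: Bochner_Integration.integral_add Bochner_Integration.integral_diff int
            Bochner_Integration.integrable_diff integrable_mult_right integral_mult_right_zero)
      finally show ?thesis .
    qed
    have contT: "continuous_on circle (\<lambda>v. ?T i (of_real r * v))" for i
      using r contg by (intro holomorphic_circle_continuous[OF cauchy_transform_holomorphic] continuous_intros) auto
    have contT': "continuous_on circle (\<lambda>v. cauchy_transform \<phi> (of_real r * v))"
      using r cont by (intro holomorphic_circle_continuous[OF cauchy_transform_holomorphic] continuous_intros) auto
    have intT: "integrable arc_measure (\<lambda>v. norm (?T i (of_real r * v)) powr p)" for i
      using contT p by (intro continuous_on_circle_integrable continuous_on_powr_norm) auto
    have "mean_pow p (cauchy_transform \<phi>) r \<le> (\<integral>v. 2 powr p * (2 powr p * (norm (?T 0 (of_real r * v)) powr p + norm (?T 1 (of_real r * v)) powr p)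
          + 2 powr p * (norm (?T 2 (of_real r * v)) powr p + norm (?T 3 (of_real r * v)) powr p)) \<partial>arc_measure)"
      unfolding mean_pow_def
    proof (rule integral_mono)
      show "integrable arc_measure (\<lambda>v. norm (cauchy_transform \<phi> (of_real r * v)) powr p)"
        using contT' p by (intro continuous_on_circle_integrable continuous_on_powr_norm) auto
      show "integrable arc_measure (\<lambda>v. 2 powr p * (2 powr p * (norm (?T 0 (of_real r * v)) powr p + norm (?T 1 (of_real r * v)) powr p)
          + 2 powr p * (norm (?T 2 (of_real r * v)) powr p + norm (?T 3 (of_real r * v)) powr p)))"
        by (intro integrable_mult_right Bochner_Integration.integrable_add intT)
      fix v assume "v \<in> space arc_measure"
      then have z: "norm (of_real r * v) < 1" using r by (simp add: circle_norm norm_mult)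
      let ?t = "\<lambda>i. norm (?T i (of_real r * v))"
      have "norm (cauchy_transform \<phi> (of_real r * v)) \<le> norm (?T 0 (of_real r * v) - ?T 1 (of_real r * v)) + norm (\<i> * (?T 2 (of_real r * v) - ?T 3 (of_real r * v)))"
        unfolding T[OF z] by (rule norm_triangle_ineq)
      also have "\<dots> \<le> (?t 0 + ?t 1) + (?t 2 + ?t 3)"
        unfolding norm_mult using norm_triangle_ineq4[of "?T 0 (of_real r * v)" "?T 1 (of_real r * v)"]
          norm_triangle_ineq4[of "?T 2 (of_real r * v)" "?T 3 (of_real r * v)"] by simp
      finally have "norm (cauchy_transform \<phi> (of_real r * v)) powr p \<le> ((?t 0 + ?t 1) + (?t 2 + ?t 3)) powr p"
        using p by (intro powr_mono2) auto
      also have "\<dots> \<le> 2 powr p * ((?t 0 + ?t 1) powr p + (?t 2 + ?t 3) powr p)"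
        using p by (intro powr_add_le) auto
      also have "\<dots> \<le> 2 powr p * (2 powr p * (?t 0 powr p + ?t 1 powr p) + 2 powr p * (?t 2 powr p + ?t 3 powr p))"
        using p by (intro mult_left_mono add_mono powr_add_le) auto
      finally show "norm (cauchy_transform \<phi> (of_real r * v)) powr p \<le> 2 powr p * (2 powr p * (?t 0 powr p + ?t 1 powr p) + 2 powr p * (?t 2 powr p + ?t 3 powr p))" .
    qed
    also have "\<dots> = 2 powr p * (2 powr p * (mean_pow p (?T 0) r + mean_pow p (?T 1) r) + 2 powr p * (mean_pow p (?T 2) r + mean_pow p (?T 3) r))"
      unfolding mean_pow_def
      by (simp only: Bochner_Integration.integral_add intT integrable_mult_right Bochner_Integration.integrable_add integral_mult_right_zero)
    also have "\<dots> \<le> 2 powr p * (2 powr p * (C * ?I + C * ?I) + 2 powr p * (C * ?I + C * ?I))"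
      by (intro mult_left_mono add_mono bound) auto
    also have "\<dots> = D * ?I" by (simp add: D_def algebra_simps)
    finally show ?thesis .
  qed
  moreover have "0 < D" using C by (simp add: D_def)
  ultimately show ?thesis by blast
qed

section \<open>Partial sums and monotone multipliers\<close>

definition partial_fourier :: "nat \<Rightarrow> nat \<Rightarrow> (complex \<Rightarrow> complex) \<Rightarrow> complex \<Rightarrow> complex" where
  "partial_fourier a b \<phi> z = (\<Sum>k=a..<b. fourier \<phi> k * z ^ k)"

lemma continuous_on_partial_fourier [continuous_intros]:
  "continuous_on S g \<Longrightarrow> continuous_on S (\<lambda>x. partial_fourier a b \<phi> (g x))"
  unfolding partial_fourier_def by (intro continuous_intros)

lemma fourier_shift: "fourier (\<lambda>u. cnj u ^ m * \<phi> u) k = fourier \<phi> (k + m)"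
  unfolding fourier_def by (simp add: power_add mult_ac)

text \<open>A tail of the Cauchy series is the Cauchy transform after shifting frequencies down by
  m, multiplied back by \<open>z ^ m\<close>. Since the shift is unimodular on the circle, partial
  sums inherit the bound with a constant independent of m.\<close>

lemma partial_fourier_cauchy:
  assumes "continuous_on circle \<phi>" "norm z < 1"
  shows "partial_fourier 0 m \<phi> z = cauchy_transform \<phi> z - z ^ m * cauchy_transform (\<lambda>u. cnj u ^ m * \<phi> u) z"
proof -
  have "(\<lambda>k. fourier (\<lambda>u. cnj u ^ m * \<phi> u) k * z ^ k) sums cauchy_transform (\<lambda>u. cnj u ^ m * \<phi> u) z"
    using assms by (intro cauchy_transform_sums continuous_intros)
  then have "(\<lambda>k. z ^ m * (fourier (\<lambda>u. cnj u ^ m * \<phi> u) k * z ^ k)) sums (z ^ m * cauchy_transform (\<lambda>u. cnj u ^ m * \<phi> u) z)"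
    by (rule sums_mult)
  then have 1: "(\<lambda>k. fourier \<phi> (k + m) * z ^ (k + m)) sums (z ^ m * cauchy_transform (\<lambda>u. cnj u ^ m * \<phi> u) z)"
    unfolding fourier_shift by (simp add: power_add mult_ac)
  have 2: "(\<lambda>k. fourier \<phi> (k + m) * z ^ (k + m)) sums (cauchy_transform \<phi> z - (\<Sum>k<m. fourier \<phi> k * z ^ k))"
    using cauchy_transform_sums[OF assms] by (rule sums_split_initial_segment)
  from sums_unique2[OF 1 2] show ?thesis
    by (simp add: partial_fourier_def atLeast0LessThan)
qed

text \<open>Bounds for Cauchy transforms hold strictly inside the disc; for a function continuous up
  to the circle, such as a partial sum, they pass to the boundary along the radii n / (n +
  1).\<close>

lemma mean_pow_limit:
  assumes "0 < p" "continuous_on UNIV P" "\<And>r. 0 \<le> r \<Longrightarrow> r < 1 \<Longrightarrow> mean_pow p P r \<le> K"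
  shows "(\<integral>v. norm (P v) powr p \<partial>arc_measure) \<le> K"
proof -
  have "bounded (P ` cball 0 1)"
    using assms by (intro compact_imp_bounded compact_continuous_image continuous_on_subset[OF assms(2)]) auto
  then obtain B where B: "\<And>z. norm z \<le> 1 \<Longrightarrow> norm (P z) \<le> B" unfolding bounded_iff by (meson imageI mem_cball_0)
  define r where "r n = real n / real (Suc n)" for n
  have r: "0 \<le> r n" "r n < 1" "r \<longlonglongrightarrow> 1" for n
    using LIMSEQ_n_over_Suc_n by (auto simp: r_def[abs_def] simp del: of_nat_Suc)
  have "(\<lambda>n. \<integral>v. norm (P (of_real (r n) * v)) powr p \<partial>arc_measure) \<longlonglongrightarrow> (\<integral>v. norm (P v) powr p \<partial>arc_measure)"
  proof (rule integral_dominated_convergence[where w = "\<lambda>_. B powr p"])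
    show "(\<lambda>v. norm (P v) powr p) \<in> borel_measurable arc_measure"
      "(\<lambda>v. norm (P (of_real (r n) * v)) powr p) \<in> borel_measurable arc_measure" for n
      using assms by (auto intro!: continuous_on_circle_measurable continuous_on_powr_norm
           continuous_on_compose2[OF assms(2)] continuous_intros continuous_on_subset[OF assms(2)])
    show "AE v in arc_measure. norm (norm (P (of_real (r n) * v)) powr p) \<le> B powr p" for n
      using r(1,2)[of n] assms B by (intro AE_I2) (auto intro!: powr_mono2 B simp: circle_norm norm_mult less_imp_le)
    show "AE v in arc_measure. (\<lambda>n. norm (P (of_real (r n) * v)) powr p) \<longlonglongrightarrow> norm (P v) powr p"
    proof (intro AE_I2 tendsto_powr' tendsto_norm tendsto_const)
      fix v
      have "(\<lambda>n. complex_of_real (r n) * v) \<longlonglongrightarrow> of_real 1 * v" by (intro tendsto_intros r(3))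
      then have "(\<lambda>n. P (of_real (r n) * v)) \<longlonglongrightarrow> P (of_real 1 * v)"
        using assms(2) by (intro continuous_on_tendsto_compose[OF assms(2)]) auto
      then show "(\<lambda>n. P (of_real (r n) * v)) \<longlonglongrightarrow> P v" by simp
    qed (use assms in auto)
  qed auto
  then show ?thesis
    by (rule LIMSEQ_le_const2) (use assms(3) r in \<open>auto simp: mean_pow_def\<close>)
qed

lemma Riesz_partial_le2:
  assumes p: "1 < p" "p \<le> 2"
  shows "\<exists>C>0. \<forall>\<phi> a b. continuous_on circle \<phi> \<longrightarrow>
     (\<integral>v. norm (partial_fourier a b \<phi> v) powr p \<partial>arc_measure) \<le> C * (\<integral>u. norm (\<phi> u) powr p \<partial>arc_measure)"
proof -
  obtain C where C: "0 < C" and R: "\<And>\<phi> r. continuous_on circle \<phi> \<Longrightarrow> 0 \<le> r \<Longrightarrow> r < 1 \<Longrightarrow>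
     mean_pow p (cauchy_transform \<phi>) r \<le> C * (\<integral>u. norm (\<phi> u) powr p \<partial>arc_measure)"
    using Riesz_cauchy[OF p] by blast
  define D where "D = 2 powr p * (2 * C)"
  have norm_shift: "(\<integral>u. norm (cnj u ^ m * \<phi> u) powr p \<partial>arc_measure) = (\<integral>u. norm (\<phi> u) powr p \<partial>arc_measure)" for m and \<phi> :: "complex \<Rightarrow> complex"
    by (intro Bochner_Integration.integral_cong) (auto simp: norm_mult norm_power circle_norm)
  have init: "(\<integral>v. norm (partial_fourier 0 m \<phi> v) powr p \<partial>arc_measure) \<le> D * (\<integral>u. norm (\<phi> u) powr p \<partial>arc_measure)"
    if cont: "continuous_on circle \<phi>" for m \<phi>
  proof (rule mean_pow_limit)
    show "0 < p" using p by simp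
    show "continuous_on UNIV (partial_fourier 0 m \<phi>)" by (intro continuous_intros)
    fix r :: real assume r: "0 \<le> r" "r < 1"
    let ?\<psi> = "\<lambda>u. cnj u ^ m * \<phi> u"
    have cont': "continuous_on circle ?\<psi>" using cont by (intro continuous_intros)
    have intT: "integrable arc_measure (\<lambda>v. norm (cauchy_transform f (of_real r * v)) powr p)" if "continuous_on circle f" for f
      using r that p by (intro continuous_on_circle_integrable continuous_on_powr_norm
         holomorphic_circle_continuous[OF cauchy_transform_holomorphic]) auto
    have "mean_pow p (partial_fourier 0 m \<phi>) r \<le> (\<integral>v. 2 powr p * (norm (cauchy_transform \<phi> (of_real r * v)) powr p + norm (cauchy_transform ?\<psi> (of_real r * v)) powr p) \<partial>arc_measure)"
      unfolding mean_pow_def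
    proof (rule integral_mono)
      show "integrable arc_measure (\<lambda>v. norm (partial_fourier 0 m \<phi> (of_real r * v)) powr p)"
        using p by (intro continuous_on_circle_integrable continuous_on_powr_norm continuous_intros) auto
      show "integrable arc_measure (\<lambda>v. 2 powr p * (norm (cauchy_transform \<phi> (of_real r * v)) powr p + norm (cauchy_transform ?\<psi> (of_real r * v)) powr p))"
        by (intro integrable_mult_right Bochner_Integration.integrable_add intT cont cont')
      fix v assume "v \<in> space arc_measure"
      then have z: "norm (of_real r * v) < 1" using r by (simp add: circle_norm norm_mult)
      let ?z = "of_real r * v"
      have "norm (partial_fourier 0 m \<phi> ?z) \<le> norm (cauchy_transform \<phi> ?z) + norm (?z ^ m * cauchy_transform ?\<psi> ?z)"
        unfolding partial_fourier_cauchy[OF cont z] by (rule norm_triangle_ineq4)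
      also have "norm (?z ^ m * cauchy_transform ?\<psi> ?z) \<le> norm (cauchy_transform ?\<psi> ?z)"
        unfolding norm_mult[of "?z ^ m"] norm_power using z by (intro mult_left_le_one_le power_le_one) auto
      finally have "norm (partial_fourier 0 m \<phi> ?z) powr p \<le> (norm (cauchy_transform \<phi> ?z) + norm (cauchy_transform ?\<psi> ?z)) powr p"
        using p by (intro powr_mono2) auto
      also have "\<dots> \<le> 2 powr p * (norm (cauchy_transform \<phi> ?z) powr p + norm (cauchy_transform ?\<psi> ?z) powr p)"
        using p by (intro powr_add_le) auto
      finally show "norm (partial_fourier 0 m \<phi> ?z) powr p \<le> 2 powr p * (norm (cauchy_transform \<phi> ?z) powr p + norm (cauchy_transform ?\<psi> ?z) powr p)" .
    qed
    also have "\<dots> = 2 powr p * (mean_pow p (cauchy_transform \<phi>) r + mean_pow p (cauchy_transform ?\<psi>) r)"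
      unfolding mean_pow_def using intT[OF cont] intT[OF cont'] by simp
    also have "\<dots> \<le> 2 powr p * (C * (\<integral>u. norm (\<phi> u) powr p \<partial>arc_measure) + C * (\<integral>u. norm (?\<psi> u) powr p \<partial>arc_measure))"
      by (intro mult_left_mono add_mono R cont cont' r) auto
    also have "\<dots> = D * (\<integral>u. norm (\<phi> u) powr p \<partial>arc_measure)"
      unfolding norm_shift by (simp add: D_def algebra_simps)
    finally show "mean_pow p (partial_fourier 0 m \<phi>) r \<le> D * (\<integral>u. norm (\<phi> u) powr p \<partial>arc_measure)" .
  qed
  have "(\<integral>v. norm (partial_fourier a b \<phi> v) powr p \<partial>arc_measure) \<le> D * (\<integral>u. norm (\<phi> u) powr p \<partial>arc_measure)"
    if cont: "continuous_on circle \<phi>" for a b \<phi>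
  proof (cases "a \<le> b")
    case True
    \<comment> \<open>Multiplication by a unimodular power moves a general frequency range to one
      starting at 0.\<close>
    let ?\<psi> = "\<lambda>u. cnj u ^ a * \<phi> u"
    have "partial_fourier a b \<phi> v = v ^ a * partial_fourier 0 (b - a) ?\<psi> v" for v
    proof -
      have "partial_fourier a b \<phi> v = (\<Sum>k=0+a..<(b-a)+a. fourier \<phi> k * v ^ k)"
        unfolding partial_fourier_def using True by simp
      also have "\<dots> = (\<Sum>k=0..<b-a. fourier \<phi> (k+a) * v ^ (k+a))"
        by (rule sum.shift_bounds_nat_ivl)
      finally show ?thesis
        unfolding partial_fourier_def fourier_shift by (simp add: sum_distrib_left power_add mult_ac)
    qed
    then have "(\<integral>v. norm (partial_fourier a b \<phi> v) powr p \<partial>arc_measure) = (\<integral>v. norm (partial_fourier 0 (b - a) ?\<psi> v) powr p \<partial>arc_measure)"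
      by (intro Bochner_Integration.integral_cong) (auto simp: norm_mult norm_power circle_norm)
    also have "\<dots> \<le> D * (\<integral>u. norm (?\<psi> u) powr p \<partial>arc_measure)"
      using cont by (intro init continuous_intros)
    finally show ?thesis unfolding norm_shift .
  next
    case False
    then have "partial_fourier a b \<phi> v = 0" for v by (simp add: partial_fourier_def)
    moreover have "0 \<le> D * (\<integral>u. norm (\<phi> u) powr p \<partial>arc_measure)"
      using C by (auto simp: D_def intro!: mult_nonneg_nonneg integral_nonneg_AE)
    ultimately show ?thesis using p by simp
  qed
  moreover have "0 < D" using C by (simp add: D_def)
  ultimately show ?thesis by blast
qed

text \<open>The duality map of L^p: its product with \<open>cnj z\<close> is \<open>|z|^p\<close>,
  and by \<open>(p - 1) * q = p\<close> its q-th power has modulus \<open>|z|^p\<close> too. It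
  supplies extremal test functions here and in \<open>dual_representation\<close>.\<close>

definition dual_pow :: "real \<Rightarrow> complex \<Rightarrow> complex" where
  "dual_pow p z = of_real (norm z powr (p - 1)) * sgn z"

lemma norm_dual_pow: "norm (dual_pow p z) = norm z powr (p - 1)"
  by (cases "z = 0") (auto simp: dual_pow_def norm_mult norm_sgn)

lemma dual_pow_mult_cnj: "dual_pow p z * cnj z = of_real (norm z powr p)"
proof (cases "z = 0")
  case False
  then have "sgn z * cnj z = of_real (norm z)"
    by (simp add: sgn_div_norm scaleR_conv_of_real field_simps complex_norm_square[symmetric] power2_eq_square)
  then have "dual_pow p z * cnj z = of_real (norm z powr (p - 1) * norm z)"
    by (simp add: dual_pow_def mult.assoc)
  also have "norm z powr (p - 1) * norm z = norm z powr p"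
    using False by (simp add: powr_diff)
  finally show ?thesis .
qed (simp add: dual_pow_def)

lemma continuous_dual_pow:
  assumes "1 < p" shows "continuous_on UNIV (dual_pow p)"
proof (rule continuous_at_imp_continuous_on, rule ballI)
  fix z :: complex
  show "isCont (dual_pow p) z"
  proof (cases "z = 0")
    case False
    then show ?thesis unfolding dual_pow_def sgn_div_norm
      by (intro continuous_intros) auto
  next
    case True
    have "(\<lambda>x::complex. norm x powr (p - 1)) \<midarrow>0\<rightarrow> norm (0::complex) powr (p - 1)"
      using assms by (intro tendsto_powr' tendsto_intros) auto
    then have "(\<lambda>x. norm (dual_pow p x)) \<midarrow>0\<rightarrow> 0" by (simp add: norm_dual_pow)
    then have "dual_pow p \<midarrow>0\<rightarrow> 0" by (rule tendsto_norm_zero_cancel)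
    then show ?thesis using True by (simp add: isCont_def dual_pow_def)
  qed
qed

lemma Hoelder_circle:
  fixes f g :: "complex \<Rightarrow> complex"
  assumes "1 < p" "1 / p + 1 / q = 1" "continuous_on circle f" "continuous_on circle g"
  shows "norm (\<integral>u. f u * g u \<partial>arc_measure) \<le>
    (\<integral>u. norm (f u) powr p \<partial>arc_measure) powr (1 / p) * (\<integral>u. norm (g u) powr q \<partial>arc_measure) powr (1 / q)"
proof -
  note q = conjugate_exponent[OF assms(1,2)]
  have "norm (\<integral>u. f u * g u \<partial>arc_measure) \<le> (\<integral>u. norm (f u * g u) \<partial>arc_measure)"
    by (rule integral_norm_bound)
  also have "\<dots> = (\<integral>u. norm (f u) * norm (g u) \<partial>arc_measure)" by (simp add: norm_mult)
  also have "\<dots> \<le> (\<integral>u. norm (f u) powr p \<partial>arc_measure) powr (1 / p) * (\<integral>u. norm (g u) powr q \<partial>arc_measure) powr (1 / q)"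
    using assms q(1) by (intro Hoelder_inequality(2) continuous_on_circle_measurable continuous_on_circle_integrable continuous_on_powr_norm continuous_intros) auto
  finally show ?thesis .
qed

text \<open>Both pairings are the Parseval sum over the range of frequencies, so truncation may be
  moved from one factor to the other.\<close>

lemma partial_fourier_selfadjoint:
  assumes "continuous_on circle f" "continuous_on circle g"
  shows "(\<integral>u. partial_fourier a b f u * cnj (g u) \<partial>arc_measure) = (\<Sum>k=a..<b. fourier f k * cnj (fourier g k))"
    and "(\<integral>u. f u * cnj (partial_fourier a b g u) \<partial>arc_measure) = (\<Sum>k=a..<b. fourier f k * cnj (fourier g k))"
proof -
  have fc: "cnj (fourier g k) = (\<integral>u. u ^ k * cnj (g u) \<partial>arc_measure)" for k
    unfolding fourier_def by (subst Bochner_Integration.integral_cnj[symmetric]) (simp add: mult.commute)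
  have "(\<integral>u. partial_fourier a b f u * cnj (g u) \<partial>arc_measure) = (\<integral>u. (\<Sum>k=a..<b. fourier f k * (u ^ k * cnj (g u))) \<partial>arc_measure)"
    unfolding partial_fourier_def by (simp add: sum_distrib_right mult.assoc)
  also have "\<dots> = (\<Sum>k=a..<b. (\<integral>u. fourier f k * (u ^ k * cnj (g u)) \<partial>arc_measure))"
    using assms by (intro Bochner_Integration.integral_sum continuous_on_circle_integrable continuous_intros)
  finally show "(\<integral>u. partial_fourier a b f u * cnj (g u) \<partial>arc_measure) = (\<Sum>k=a..<b. fourier f k * cnj (fourier g k))"
    by (simp add: fc)
  have "(\<integral>u. f u * cnj (partial_fourier a b g u) \<partial>arc_measure) = (\<integral>u. (\<Sum>k=a..<b. cnj (fourier g k) * (f u * cnj u ^ k)) \<partial>arc_measure)"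
    unfolding partial_fourier_def by (simp add: sum_distrib_left mult_ac)
  also have "\<dots> = (\<Sum>k=a..<b. (\<integral>u. cnj (fourier g k) * (f u * cnj u ^ k) \<partial>arc_measure))"
    using assms by (intro Bochner_Integration.integral_sum continuous_on_circle_integrable continuous_intros)
  finally show "(\<integral>u. f u * cnj (partial_fourier a b g u) \<partial>arc_measure) = (\<Sum>k=a..<b. fourier f k * cnj (fourier g k))"
    by (simp add: fourier_def mult.commute)
qed

text \<open>For p > 2 the conjugate exponent is below 2. Pair the partial sum with its own dual
  function, move the truncation onto that function, and apply the bound for exponent q.\<close>

theorem Riesz_partial:
  assumes p: "1 < p"
  shows "\<exists>C>0. \<forall>\<phi> a b. continuous_on circle \<phi> \<longrightarrow>
     (\<integral>v. norm (partial_fourier a b \<phi> v) powr p \<partial>arc_measure) \<le> C * (\<integral>u. norm (\<phi> u) powr p \<partial>arc_measure)"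
proof (cases "p \<le> 2")
  case True
  then show ?thesis using Riesz_partial_le2[OF p] by blast
next
  case False
  define q where "q = p / (p - 1)"
  have pq: "1 / p + 1 / q = 1" using p by (simp add: q_def field_simps)
  note q = conjugate_exponent[OF p pq]
  have "q \<le> 2" using False by (simp add: q_def field_simps)
  then obtain C where C: "0 < C" and R: "\<And>\<phi> a b. continuous_on circle \<phi> \<Longrightarrow>
     (\<integral>v. norm (partial_fourier a b \<phi> v) powr q \<partial>arc_measure) \<le> C * (\<integral>u. norm (\<phi> u) powr q \<partial>arc_measure)"
    using Riesz_partial_le2[of q] q(1) by blast
  \<comment> \<open>Cancelling \<open>N powr (1/q)\<close> in the estimate below leaves
    \<open>N^(1/p) \<le> I^(1/p) C^(1/q)\<close>; this constant is the p-th power of the last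
    factor.\<close>
  define D where "D = C powr (p / q)"
  have "(\<integral>v. norm (partial_fourier a b f v) powr p \<partial>arc_measure) \<le> D * (\<integral>u. norm (f u) powr p \<partial>arc_measure)"
    if cont: "continuous_on circle f" for f a b
  proof -
    let ?S = "partial_fourier a b f"
    define N where "N = (\<integral>v. norm (?S v) powr p \<partial>arc_measure)"
    define I where "I = (\<integral>u. norm (f u) powr p \<partial>arc_measure)"
    have N0: "0 \<le> N" and I0: "0 \<le> I" unfolding N_def I_def by (auto intro: integral_nonneg_AE)
    define \<phi> where "\<phi> v = dual_pow p (?S v)" for v
    have cont\<phi>: "continuous_on circle \<phi>" unfolding \<phi>_def
      by (intro continuous_on_compose2[OF continuous_dual_pow[OF p]] continuous_intros) auto
    have norm\<phi>: "norm (\<phi> v) powr q = norm (?S v) powr p" for v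
      using q(2) by (simp add: \<phi>_def norm_dual_pow powr_powr)
    have "complex_of_real N = (\<integral>v. cnj (\<phi> v * cnj (?S v)) \<partial>arc_measure)"
      unfolding N_def \<phi>_def dual_pow_mult_cnj by simp
    also have "\<dots> = (\<integral>v. ?S v * cnj (\<phi> v) \<partial>arc_measure)" by (simp add: mult.commute)
    also have "\<dots> = (\<integral>v. f v * cnj (partial_fourier a b \<phi> v) \<partial>arc_measure)"
      using partial_fourier_selfadjoint[OF cont cont\<phi>] by simp
    finally have "N = norm (\<integral>v. f v * cnj (partial_fourier a b \<phi> v) \<partial>arc_measure)"
      using N0 by (metis abs_of_nonneg norm_of_real)
    also have "\<dots> \<le> I powr (1/p) * (\<integral>v. norm (cnj (partial_fourier a b \<phi> v)) powr q \<partial>arc_measure) powr (1/q)"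
      unfolding I_def using cont by (intro Hoelder_circle p pq continuous_intros)
    also have "\<dots> \<le> I powr (1/p) * (C * N) powr (1/q)"
      using R[OF cont\<phi>, of a b] q(1) unfolding norm\<phi> N_def
      by (intro mult_left_mono powr_mono2) (auto intro!: integral_nonneg_AE)
    finally have *: "N \<le> I powr (1/p) * (C * N) powr (1/q)" .
    show ?thesis
    proof (cases "N = 0")
      case True
      then show ?thesis using I0 by (simp add: D_def flip: N_def I_def)
    next
      case False
      then have N: "0 < N" using N0 by simp
      have "N powr (1/p) * N powr (1/q) = N" using N pq by (simp flip: powr_add)
      with * have "N powr (1/p) * N powr (1/q) \<le> (I powr (1/p) * C powr (1/q)) * N powr (1/q)"
        using C N by (simp add: powr_mult mult.assoc)
      then have "N powr (1/p) \<le> I powr (1/p) * C powr (1/q)"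
        using N by (simp add: mult_le_cancel_right)
      then have "(N powr (1/p)) powr p \<le> (I powr (1/p) * C powr (1/q)) powr p"
        using p by (intro powr_mono2) auto
      then have "N \<le> I * D"
        using N0 I0 p C by (simp add: powr_mult powr_powr D_def)
      then show ?thesis by (simp add: N_def I_def mult.commute)
    qed
  qed
  moreover have "0 < D" using C by (simp add: D_def)
  ultimately show ?thesis by blast
qed

definition circle_norm_p :: "real \<Rightarrow> (complex \<Rightarrow> complex) \<Rightarrow> real" where
  "circle_norm_p p f = (\<integral>u. norm (f u) powr p \<partial>arc_measure) powr (1 / p)"

lemma circle_norm_p_nonneg [simp]: "0 \<le> circle_norm_p p f"
  by (simp add: circle_norm_p_def)

lemma circle_norm_p_powr: "0 < p \<Longrightarrow> circle_norm_p p f powr p = (\<integral>u. norm (f u) powr p \<partial>arc_measure)"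
  by (simp add: circle_norm_p_def powr_powr integral_nonneg_AE)

lemma circle_norm_p_triangle:
  assumes "1 < p" "continuous_on circle f" "continuous_on circle g"
  shows "circle_norm_p p (\<lambda>u. f u + g u) \<le> circle_norm_p p f + circle_norm_p p g"
proof -
  have "circle_norm_p p (\<lambda>u. f u + g u) \<le> (\<integral>u. (norm (f u) + norm (g u)) powr p \<partial>arc_measure) powr (1/p)"
    unfolding circle_norm_p_def using assms
    by (intro powr_mono2 integral_mono continuous_on_circle_integrable continuous_on_powr_norm continuous_on_powr' continuous_intros)
       (auto intro!: integral_nonneg_AE powr_mono2 norm_triangle_ineq)
  also have "\<dots> \<le> circle_norm_p p f + circle_norm_p p g"
    unfolding circle_norm_p_def using assms
    by (intro Minkowski_inequality continuous_on_circle_measurable continuous_on_circle_integrable continuous_on_powr_norm continuous_intros) auto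
  finally show ?thesis .
qed

lemma circle_norm_p_scale:
  assumes "0 < p" shows "circle_norm_p p (\<lambda>u. c * f u) = norm c * circle_norm_p p f"
  using assms by (simp add: circle_norm_p_def norm_mult powr_mult powr_powr integral_nonneg_AE)

lemma circle_norm_p_sum:
  assumes "1 < p" "finite I" "\<And>i. i \<in> I \<Longrightarrow> continuous_on circle (f i)"
  shows "circle_norm_p p (\<lambda>u. \<Sum>i\<in>I. f i u) \<le> (\<Sum>i\<in>I. circle_norm_p p (f i))"
  using assms(2,3)
proof (induction I rule: finite_induct)
  case empty
  then show ?case using assms(1) by (simp add: circle_norm_p_def)
next
  case (insert i I)
  have "circle_norm_p p (\<lambda>u. f i u + (\<Sum>i\<in>I. f i u)) \<le> circle_norm_p p (f i) + circle_norm_p p (\<lambda>u. \<Sum>i\<in>I. f i u)"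
    using insert by (intro circle_norm_p_triangle assms(1) continuous_intros) auto
  with insert show ?case by (auto intro: order_trans)
qed

text \<open>Abel summation as an induction on the length of the range: take out
  \<open>\<mu> a\<close> times the whole partial sum; the remaining multiplier vanishes at a and is
  again nonnegative and increasing. The bound depends on the last value of the multiplier
  only.\<close>

theorem Riesz_multiplier:
  assumes p: "1 < p"
  shows "\<exists>C>0. \<forall>\<phi> (\<mu>::nat \<Rightarrow> real) a b. continuous_on circle \<phi> \<longrightarrow> mono \<mu> \<longrightarrow> 0 \<le> \<mu> a \<longrightarrow>
     circle_norm_p p (\<lambda>v. \<Sum>k=a..<Suc b. of_real (\<mu> k) * fourier \<phi> k * v ^ k) \<le> C * \<bar>\<mu> b\<bar> * circle_norm_p p \<phi>"
proof -
  obtain C where C: "0 < C" and R: "\<And>\<phi> a b. continuous_on circle \<phi> \<Longrightarrow>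
     (\<integral>v. norm (partial_fourier a b \<phi> v) powr p \<partial>arc_measure) \<le> C * (\<integral>u. norm (\<phi> u) powr p \<partial>arc_measure)"
    using Riesz_partial[OF p] by blast
  define D where "D = C powr (1 / p)"
  have D: "0 < D" using C by (simp add: D_def)
  have R': "circle_norm_p p (partial_fourier a b \<phi>) \<le> D * circle_norm_p p \<phi>" if "continuous_on circle \<phi>" for \<phi> a b
  proof -
    have "circle_norm_p p (partial_fourier a b \<phi>) \<le> (C * (\<integral>u. norm (\<phi> u) powr p \<partial>arc_measure)) powr (1 / p)"
      unfolding circle_norm_p_def using R[OF that, of a b] p by (intro powr_mono2) (auto intro!: integral_nonneg_AE)
    then show ?thesis by (simp add: D_def circle_norm_p_def powr_mult)
  qed
  have "circle_norm_p p (\<lambda>v. \<Sum>k=a..<Suc b. of_real (\<mu> k) * fourier \<phi> k * v ^ k) \<le> D * \<bar>\<mu> b\<bar> * circle_norm_p p \<phi>"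
    if cont: "continuous_on circle \<phi>" and "mono \<mu>" "0 \<le> \<mu> a" for \<phi> and \<mu> :: "nat \<Rightarrow> real" and a b
    using that(2,3)
  proof (induction "Suc b - a" arbitrary: a \<mu>)
    case 0
    then show ?case using D p by (simp add: circle_norm_p_def)
  next
    case (Suc n)
    then have ab: "a \<le> b" by simp
    let ?\<nu> = "\<lambda>k. \<mu> k - \<mu> a"
    have "(\<lambda>v. \<Sum>k=a..<Suc b. of_real (\<mu> k) * fourier \<phi> k * v ^ k)
       = (\<lambda>v. of_real (\<mu> a) * partial_fourier a (Suc b) \<phi> v + (\<Sum>k=Suc a..<Suc b. of_real (?\<nu> k) * fourier \<phi> k * v ^ k))"
    proof
      fix v
      have "(\<Sum>k=a..<Suc b. of_real (\<mu> k) * fourier \<phi> k * v ^ k) = (\<Sum>k=a..<Suc b. of_real (\<mu> a) * (fourier \<phi> k * v ^ k) + of_real (?\<nu> k) * fourier \<phi> k * v ^ k)"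
        by (intro sum.cong) (auto simp: algebra_simps)
      also have "\<dots> = of_real (\<mu> a) * partial_fourier a (Suc b) \<phi> v + (\<Sum>k=a..<Suc b. of_real (?\<nu> k) * fourier \<phi> k * v ^ k)"
        by (simp only: sum.distrib partial_fourier_def sum_distrib_left)
      also have "(\<Sum>k=a..<Suc b. of_real (?\<nu> k) * fourier \<phi> k * v ^ k) = (\<Sum>k=Suc a..<Suc b. of_real (?\<nu> k) * fourier \<phi> k * v ^ k)"
        using ab by (subst sum.atLeast_Suc_lessThan) auto
      finally show "(\<Sum>k=a..<Suc b. of_real (\<mu> k) * fourier \<phi> k * v ^ k) = of_real (\<mu> a) * partial_fourier a (Suc b) \<phi> v + (\<Sum>k=Suc a..<Suc b. of_real (?\<nu> k) * fourier \<phi> k * v ^ k)" .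
    qed
    then have "circle_norm_p p (\<lambda>v. \<Sum>k=a..<Suc b. of_real (\<mu> k) * fourier \<phi> k * v ^ k)
      \<le> circle_norm_p p (\<lambda>v. of_real (\<mu> a) * partial_fourier a (Suc b) \<phi> v) + circle_norm_p p (\<lambda>v. \<Sum>k=Suc a..<Suc b. of_real (?\<nu> k) * fourier \<phi> k * v ^ k)"
      by (simp only:) (intro circle_norm_p_triangle p continuous_intros)
    also have "circle_norm_p p (\<lambda>v. of_real (\<mu> a) * partial_fourier a (Suc b) \<phi> v) \<le> \<mu> a * (D * circle_norm_p p \<phi>)"
      using p Suc.prems R'[OF cont, of a "Suc b"] by (subst circle_norm_p_scale) (auto intro!: mult_left_mono)
    also have "circle_norm_p p (\<lambda>v. \<Sum>k=Suc a..<Suc b. of_real (?\<nu> k) * fourier \<phi> k * v ^ k) \<le> D * \<bar>?\<nu> b\<bar> * circle_norm_p p \<phi>"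
      using Suc.hyps(2) Suc.prems by (intro Suc.hyps(1)) (auto simp: mono_def)
    also have "\<bar>?\<nu> b\<bar> = \<mu> b - \<mu> a" using Suc.prems ab by (simp add: mono_def)
    \<comment> \<open>The contributions telescope, so the induction loses nothing in the
      constant.\<close>
    also have "\<mu> a * (D * circle_norm_p p \<phi>) + D * (\<mu> b - \<mu> a) * circle_norm_p p \<phi> = D * \<mu> b * circle_norm_p p \<phi>"
      by (simp add: algebra_simps)
    \<comment> \<open>The absolute value in the claim is for the base case: on an empty range
      \<open>\<mu> b\<close> may be negative.\<close>
    also have "\<dots> \<le> D * \<bar>\<mu> b\<bar> * circle_norm_p p \<phi>"
      using D by (intro mult_right_mono mult_left_mono) auto
    finally show ?case by simp
  qed
  with D show ?thesis by blast
qed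

section \<open>Polar coordinates for radial weights\<close>

abbreviation unit_lebesgue :: "real measure" where "unit_lebesgue \<equiv> lebesgue_on {0..<1}"

lemma borel_unit_lebesgue:
  "f \<in> borel_measurable borel \<Longrightarrow> f \<in> borel_measurable unit_lebesgue"
  by (intro measurable_restrict_space1 measurable_completion) simp

lemma integrable_iff_nn_integral:
  fixes f :: "'a \<Rightarrow> real"
  assumes "f \<in> borel_measurable M" "AE x in M. 0 \<le> f x"
  shows "integrable M f \<longleftrightarrow> (\<integral>\<^sup>+x. ennreal (f x) \<partial>M) < \<infinity>"
proof -
  have "(\<integral>\<^sup>+x. ennreal (norm (f x)) \<partial>M) = (\<integral>\<^sup>+x. ennreal (f x) \<partial>M)"
    using assms(2) by (intro nn_integral_cong_AE) auto
  then show ?thesis using assms(1) by (simp add: integrable_iff_bounded)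
qed

lemma emeasure_area:
  assumes "S \<in> sets borel" "S \<subseteq> disc"
  shows "emeasure area_measure S = ennreal (1 / pi) * emeasure lborel S"
proof -
  have S: "S \<in> sets area_measure"
    using assms by (auto simp: sets_area sets_restrict_space intro!: image_eqI[of _ _ S])
  have "indicator S z * indicator disc z = (indicator S z :: ennreal)" for z
    using assms by (auto simp: indicator_def)
  then show ?thesis
    using nn_integral_area[of "indicator S"] S assms(1) by simp
qed

text \<open>The radius has density 2r. Both measures are finite, so it suffices to compare them on
  half-lines, where the area of an annulus meets the integral of 2r.\<close>

lemma distr_area_norm:
  "distr area_measure borel norm = density lborel (\<lambda>r. ennreal (2 * r) * indicator {0..<1} r)"
proof (rule measure_eqI_lessThan)
  fix x :: real
  show "emeasure (distr area_measure borel norm) {x<..} = emeasure (density lborel (\<lambda>r. ennreal (2 * r) * indicator {0..<1} r)) {x<..}"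
  proof -
    \<comment> \<open>Clamping x to [0, 1] covers the half-lines that contain or miss the whole
      interval.\<close>
    define y where "y = min 1 (max 0 x)"
    have y: "0 \<le> y" "y \<le> 1" by (auto simp: y_def)
    have l: "emeasure (distr area_measure borel norm) {x<..} = ennreal (1 - y\<^sup>2)"
    proof (cases "0 \<le> x \<and> x < 1")
      case True
      have "emeasure area_measure (cball 0 x) = ennreal (1/pi) * ennreal (pi * x^2)"
        using True content_cball[of x "0::complex"] emeasure_lborel_cball_finite[of "0::complex" x]
        by (subst emeasure_area) (auto simp: emeasure_eq_ennreal_measure eval_unit_ball_vol)
      also have "\<dots> = ennreal (x^2)"
        by (subst ennreal_mult[symmetric]) auto
      finally have cb: "emeasure area_measure (cball 0 x) = ennreal (x^2)" .
      have "cball (0::complex) x \<in> sets area_measure"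
        using True by (auto simp: sets_area sets_restrict_space intro!: image_eqI[of _ _ "cball 0 x"])
      then have "emeasure area_measure (disc - cball 0 x) = 1 - ennreal (x^2)"
        using cb True emeasure_area_disc by (subst emeasure_Diff) (auto simp: sets_area sets_restrict_space intro!: image_eqI[of _ _ disc])
      also have "disc - cball 0 x = norm -` {x<..} \<inter> space area_measure" by auto
      finally show ?thesis using True
        by (subst emeasure_distr) (auto simp: y_def ennreal_minus ennreal_1[symmetric] simp del: ennreal_1)
    next
      case False
      have neg: "x < norm z" if "x < 0" for z :: complex using that norm_ge_zero[of z] by linarith
      from False have "norm -` {x<..} \<inter> space area_measure = (if 1 \<le> x then {} else disc)"
        using neg by (auto simp: not_le)
      then show ?thesis using False emeasure_area_disc
        by (subst emeasure_distr) (auto simp: y_def min_def max_def)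
    qed
    have "emeasure (density lborel (\<lambda>r. ennreal (2 * r) * indicator {0..<1} r)) {x<..}
       = (\<integral>\<^sup>+r. ennreal (2 * r) * indicator {0..<1} r * indicator {x<..} r \<partial>lborel)"
      by (rule emeasure_density) auto
    also have "\<dots> = (\<integral>\<^sup>+r. ennreal (2 * r) * indicator {y..1} r \<partial>lborel)"
      using AE_lborel_singleton[of y] AE_lborel_singleton[of 1]
      by (intro nn_integral_cong_AE) (auto simp: indicator_def y_def elim!: eventually_elim2 split: if_splits)
    also have "\<dots> = ennreal (1\<^sup>2 - y\<^sup>2)"
      using y by (intro nn_integral_FTC_Icc[where F = "\<lambda>x. x\<^sup>2"]) (auto intro!: derivative_eq_intros)
    finally show ?thesis using l by simp
  qed
  show "emeasure (distr area_measure borel norm) {x<..} < \<infinity>"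
    using area.emeasure_finite by (subst emeasure_distr) (auto simp: less_top[symmetric])
qed simp_all

lemma nn_integral_area_norm_borel:
  assumes "H \<in> borel_measurable borel"
  shows "(\<integral>\<^sup>+z. H (norm z) \<partial>area_measure) = (\<integral>\<^sup>+r. ennreal (2 * r) * indicator {0..<1} r * H r \<partial>lborel)"
proof -
  have "(\<integral>\<^sup>+z. H (norm z) \<partial>area_measure) = (\<integral>\<^sup>+r. H r \<partial>distr area_measure borel norm)"
    using assms by (intro nn_integral_distr[symmetric]) auto
  also have "\<dots> = (\<integral>\<^sup>+r. ennreal (2 * r) * indicator {0..<1} r * H r \<partial>lborel)"
    unfolding distr_area_norm using assms by (intro nn_integral_density) auto
  finally show ?thesis .
qed

lemma null_sets_area_norm:
  assumes "N \<in> null_sets lborel"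
  shows "AE z in area_measure. norm z \<notin> N"
proof -
  have [measurable]: "N \<in> sets borel" using assms by auto
  have "(\<integral>\<^sup>+z. indicator N (norm z) \<partial>area_measure) = (\<integral>\<^sup>+r. ennreal (2 * r) * indicator {0..<1} r * indicator N r \<partial>lborel)"
    by (intro nn_integral_area_norm_borel) auto
  also have "\<dots> = 0"
    using AE_not_in[OF assms] by (subst nn_integral_0_iff_AE) (auto elim!: eventually_mono)
  finally have "AE z in area_measure. indicator N (norm z) = (0::ennreal)"
    by (subst (asm) nn_integral_0_iff_AE) auto
  then show ?thesis by eventually_elim (auto simp: indicator_def split: if_splits)
qed

lemma complete_area: "complete_measure area_measure"
proof
  fix A B assume "B \<subseteq> A" "A \<in> null_sets area_measure"
  then have A: "A \<in> sets lebesgue" "A \<subseteq> disc" "emeasure area_measure A = 0"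
    by (auto simp: null_sets_def sets_area sets_restrict_space)
  have "emeasure area_measure A = ennreal (1/pi) * emeasure lebesgue A"
    using A by (simp add: area_measure_def emeasure_restrict_space)
  then have "A \<in> null_sets lebesgue" using A by auto
  then have "B \<in> sets lebesgue" using \<open>B \<subseteq> A\<close> completion.complete by blast
  then show "B \<in> sets area_measure"
    using \<open>B \<subseteq> A\<close> A by (auto simp: sets_area sets_restrict_space)
qed

text \<open>Weights are merely Lebesgue measurable, so composing them with \<open>norm\<close>
  requires measurability between completed sigma-algebras. This rests on completeness of area and on
  preimages of null sets of radii being null.\<close>

lemma measurable_norm_area: "norm \<in> measurable area_measure unit_lebesgue"
proof (intro measurable_restrict_space2 complete_measure.measurable_completion2[OF complete_area])
  show "null_sets lborel \<subseteq> null_sets (distr area_measure lborel (norm :: complex \<Rightarrow> real))"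
  proof
    fix N :: "real set" assume N: "N \<in> null_sets lborel"
    then have [measurable]: "N \<in> sets borel" by auto
    have "emeasure area_measure (norm -` N \<inter> space area_measure) = 0"
      using emeasure_eq_0_AE[of "\<lambda>z. norm z \<in> N" area_measure] null_sets_area_norm[OF N]
      by (simp add: vimage_def Int_def conj_commute)
    then show "N \<in> null_sets (distr area_measure lborel (norm :: complex \<Rightarrow> real))"
      by (auto simp: null_sets_def emeasure_distr)
  qed
qed auto

text \<open>W agrees with a Borel function off a null set of radii, and that set is invisible to
  area by \<open>null_sets_area_norm\<close>.\<close>

lemma nn_integral_area_norm:
  assumes W: "W \<in> borel_measurable unit_lebesgue"
  shows "(\<integral>\<^sup>+z. W (norm z) \<partial>area_measure) = (\<integral>\<^sup>+r. ennreal (2 * r) * W r \<partial>unit_lebesgue)"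
proof -
  have "(\<lambda>r. W r * indicator {0..<1} r) \<in> borel_measurable lebesgue"
    using W by (subst borel_measurable_restrict_space_iff_ennreal[symmetric]) auto
  then obtain W' where W': "W' \<in> borel_measurable lborel" "AE r in lborel. W r * indicator {0..<1} r = W' r"
    using completion_ex_borel_measurable by blast
  then obtain N where N: "N \<in> null_sets lborel" "\<And>r. r \<notin> N \<Longrightarrow> W r * indicator {0..<1} r = W' r"
    by (auto elim!: AE_E3)
  have "(\<integral>\<^sup>+z. W (norm z) \<partial>area_measure) = (\<integral>\<^sup>+z. W' (norm z) \<partial>area_measure)"
    using null_sets_area_norm[OF N(1)] AE_space
  proof (intro nn_integral_cong_AE, eventually_elim)
    fix z assume "norm z \<notin> N" "z \<in> space area_measure"
    then have "W (norm z) * indicator {0..<1} (norm z) = W' (norm z)" using N(2) by blast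
    then show "W (norm z) = W' (norm z)" using \<open>z \<in> space area_measure\<close> by (auto simp: indicator_def)
  qed
  also have "\<dots> = (\<integral>\<^sup>+r. ennreal (2 * r) * indicator {0..<1} r * W' r \<partial>lborel)"
    using W' by (intro nn_integral_area_norm_borel) auto
  also have "\<dots> = (\<integral>\<^sup>+r. ennreal (2 * r) * W r * indicator {0..<1} r \<partial>lborel)"
    using W'(2) by (intro nn_integral_cong_AE, eventually_elim) (auto simp: indicator_def split: if_splits)
  also have "\<dots> = (\<integral>\<^sup>+r. ennreal (2 * r) * W r * indicator {0..<1} r \<partial>lebesgue)"
    by (simp add: nn_integral_completion)
  also have "\<dots> = (\<integral>\<^sup>+r. ennreal (2 * r) * W r \<partial>unit_lebesgue)"
    by (rule nn_integral_restrict_space[symmetric]) auto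
  finally show ?thesis .
qed

text \<open>Positivity of the tails is added only in \<open>positive_weight\<close>, so that this
  locale can be instantiated with \<open>weight_times_dist w \<beta>\<close> as well.\<close>

locale weight =
  fixes w :: "real \<Rightarrow> real"
  assumes w_nonneg: "\<And>r. 0 \<le> r \<Longrightarrow> r < 1 \<Longrightarrow> 0 \<le> w r"
    and w_integrable: "integrable unit_lebesgue w"
begin

definition radial_measure :: "real measure" where
  "radial_measure = density unit_lebesgue (\<lambda>r. ennreal (w r))"

text \<open>Pushing forward by the identity cuts the sigma-algebra down to Borel sets. The map (z,
  u) to \<open>u z\<close> is then measurable on the product with the circle, as averaging over
  rotations requires.\<close>

definition disc_measure :: "complex measure" where
  "disc_measure = distr (density area_measure (\<lambda>z. ennreal (w (norm z)))) (restrict_space borel disc) (\<lambda>z. z)"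

lemma w_measurable [measurable]: "w \<in> borel_measurable unit_lebesgue"
  using w_integrable by auto

lemma w_norm_measurable [measurable]: "(\<lambda>z. w (norm z)) \<in> borel_measurable area_measure"
  by (rule measurable_compose[OF measurable_norm_area w_measurable])

lemma measurable_id_area: "(\<lambda>z. z) \<in> measurable area_measure (restrict_space borel disc)"
  by (intro measurable_restrict_space2 measurable_area_borel) auto

lemma space_radial [simp]: "space radial_measure = {0..<1}"
  and sets_radial [measurable_cong]: "sets radial_measure = sets unit_lebesgue"
  by (auto simp: radial_measure_def space_restrict_space)

lemma space_disc_measure [simp]: "space disc_measure = disc"
  and sets_disc_measure [measurable_cong]: "sets disc_measure = sets (restrict_space borel disc)"
  by (auto simp: disc_measure_def space_restrict_space)

lemma nn_integral_radial:
  assumes "F \<in> borel_measurable unit_lebesgue"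
  shows "(\<integral>\<^sup>+r. F r \<partial>radial_measure) = (\<integral>\<^sup>+r. ennreal (w r) * F r \<partial>unit_lebesgue)"
  unfolding radial_measure_def using assms by (intro nn_integral_density) auto

lemma nn_integral_disc_measure:
  assumes "F \<in> borel_measurable (restrict_space borel disc)"
  shows "(\<integral>\<^sup>+z. F z \<partial>disc_measure) = (\<integral>\<^sup>+z. ennreal (w (norm z)) * F z \<partial>area_measure)"
proof -
  have F: "F \<in> borel_measurable area_measure" using assms by (rule measurable_area_lborel)
  have id: "(\<lambda>z. z) \<in> measurable (density area_measure (\<lambda>z. ennreal (w (norm z)))) (restrict_space borel disc)"
    using measurable_id_area by simp
  have "(\<integral>\<^sup>+z. F z \<partial>disc_measure) = (\<integral>\<^sup>+z. F z \<partial>density area_measure (\<lambda>z. ennreal (w (norm z))))"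
    unfolding disc_measure_def by (rule nn_integral_distr[OF id]) (use assms in simp)
  also have "\<dots> = (\<integral>\<^sup>+z. ennreal (w (norm z)) * F z \<partial>area_measure)"
    using F by (intro nn_integral_density) auto
  finally show ?thesis .
qed

lemma finite_radial: "finite_measure radial_measure"
proof (rule finite_measureI)
  have "emeasure radial_measure (space radial_measure) = (\<integral>\<^sup>+r. 1 \<partial>radial_measure)" by simp
  also have "\<dots> = (\<integral>\<^sup>+r. ennreal (w r) \<partial>unit_lebesgue)" by (subst nn_integral_radial) auto
  also have "\<dots> < \<infinity>"
    using w_integrable w_nonneg by (subst nn_integral_eq_integral) auto
  finally show "emeasure radial_measure (space radial_measure) \<noteq> \<infinity>" by simp
qed

sublocale rad: finite_measure radial_measure by (rule finite_radial)

lemma nn_integral_disc_norm: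
  assumes "H \<in> borel_measurable unit_lebesgue" "(\<lambda>z. H (norm z)) \<in> borel_measurable (restrict_space borel disc)"
  shows "(\<integral>\<^sup>+z. H (norm z) \<partial>disc_measure) = (\<integral>\<^sup>+r. ennreal (2 * r) * H r \<partial>radial_measure)"
proof -
  have "(\<integral>\<^sup>+z. H (norm z) \<partial>disc_measure) = (\<integral>\<^sup>+z. ennreal (w (norm z)) * H (norm z) \<partial>area_measure)"
    by (rule nn_integral_disc_measure[OF assms(2)])
  also have "\<dots> = (\<integral>\<^sup>+r. ennreal (2 * r) * (ennreal (w r) * H r) \<partial>unit_lebesgue)"
    using assms by (intro nn_integral_area_norm) auto
  also have "\<dots> = (\<integral>\<^sup>+r. ennreal (2 * r) * H r \<partial>radial_measure)"
    using assms borel_unit_lebesgue[of "\<lambda>r. ennreal (2 * r)"] by (subst nn_integral_radial) (auto simp: mult_ac)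
  finally show ?thesis .
qed

lemma finite_disc_measure: "finite_measure disc_measure"
proof (rule finite_measureI)
  have "emeasure disc_measure (space disc_measure) = (\<integral>\<^sup>+z. 1 \<partial>disc_measure)" by simp
  also have "\<dots> = (\<integral>\<^sup>+r. ennreal (2 * r) * 1 \<partial>radial_measure)"
    by (rule nn_integral_disc_norm[of "\<lambda>_. 1"]) auto
  also have "\<dots> \<le> (\<integral>\<^sup>+r. 2 \<partial>radial_measure)"
    by (intro nn_integral_mono) (auto simp: ennreal_le_iff simp flip: ennreal_numeral)
  also have "\<dots> < \<infinity>" proof -
    have "emeasure radial_measure {0..<1} < top" using rad.emeasure_finite by (simp add: less_top[symmetric])
    then show ?thesis by (simp add: ennreal_mult_less_top)
  qed
  finally show "emeasure disc_measure (space disc_measure) \<noteq> \<infinity>" by simp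
qed

sublocale dsc: finite_measure disc_measure by (rule finite_disc_measure)

lemma measurable_disc_rotate:
  "norm c = 1 \<Longrightarrow> (*) c \<in> measurable disc_measure disc_measure"
  using measurable_restrict_space3[of "(*) c" borel borel disc disc]
  by (simp cong: measurable_cong_sets add: sets_disc_measure norm_mult)

text \<open>Rotation invariance of area was shown for Borel integrands, while w is only Lebesgue
  measurable; an almost everywhere equal radial Borel version bridges the gap.\<close>

lemma ex_borel_w: "\<exists>w'\<in>borel_measurable borel. AE z in area_measure. ennreal (w (norm z)) = w' (norm z)"
proof -
  have "(\<lambda>r. ennreal (w r)) \<in> borel_measurable unit_lebesgue" by measurable
  then have "(\<lambda>r. ennreal (w r) * indicator {0..<1} r) \<in> borel_measurable lebesgue"
    by (subst borel_measurable_restrict_space_iff_ennreal[symmetric]) auto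
  then obtain W' where W': "W' \<in> borel_measurable lborel" "AE r in lborel. ennreal (w r) * indicator {0..<1} r = W' r"
    using completion_ex_borel_measurable by blast
  then obtain N where N: "N \<in> null_sets lborel" "\<And>r. r \<notin> N \<Longrightarrow> ennreal (w r) * indicator {0..<1} r = W' r"
    by (auto elim!: AE_E3)
  have "AE z in area_measure. ennreal (w (norm z)) = W' (norm z)"
    using null_sets_area_norm[OF N(1)] AE_space
  proof eventually_elim
    fix z assume "norm z \<notin> N" "z \<in> space area_measure"
    then have "ennreal (w (norm z)) * indicator {0..<1} (norm z) = W' (norm z)" using N(2) by blast
    then show "ennreal (w (norm z)) = W' (norm z)" using \<open>z \<in> space area_measure\<close> by (auto simp: indicator_def)
  qed
  then show ?thesis using W'(1) by auto
qed

lemma distr_disc_rotate: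
  assumes c: "norm c = 1"
  shows "distr disc_measure disc_measure ((*) c) = disc_measure"
proof (rule measure_eqI)
  fix A assume "A \<in> sets (distr disc_measure disc_measure ((*) c))"
  then have A: "A \<in> sets disc_measure" by simp
  then have A': "A \<in> sets borel" "A \<subseteq> disc"
    by (auto simp: sets_disc_measure sets_restrict_space)
  obtain w' where w': "w' \<in> borel_measurable borel" "AE z in area_measure. ennreal (w (norm z)) = w' (norm z)"
    using ex_borel_w by blast
  note [measurable] = A'(1) w'(1)
  have "emeasure (distr disc_measure disc_measure ((*) c)) A = (\<integral>\<^sup>+u. indicator A (c * u) \<partial>disc_measure)"
    using A by (subst nn_integral_distr[symmetric, OF measurable_disc_rotate[OF c]]) auto
  also have "\<dots> = (\<integral>\<^sup>+z. ennreal (w (norm z)) * indicator A (c * z) \<partial>area_measure)"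
    by (intro nn_integral_disc_measure measurable_restrict_space1) measurable
  also have "\<dots> = (\<integral>\<^sup>+z. w' (norm (c * z)) * indicator A (c * z) \<partial>area_measure)"
    using w'(2) by (intro nn_integral_cong_AE, eventually_elim) (simp add: norm_mult c)
  also have "\<dots> = (\<integral>\<^sup>+z. w' (norm z) * indicator A z \<partial>area_measure)"
    by (intro nn_integral_area_rotate[OF c, of "\<lambda>z. w' (norm z) * indicator A z"]) measurable
  also have "\<dots> = (\<integral>\<^sup>+z. ennreal (w (norm z)) * indicator A z \<partial>area_measure)"
    using w'(2) by (intro nn_integral_cong_AE, eventually_elim) simp
  also have "\<dots> = (\<integral>\<^sup>+z. indicator A z \<partial>disc_measure)"
    by (intro nn_integral_disc_measure[symmetric] measurable_restrict_space1) measurable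
  finally show "emeasure (distr disc_measure disc_measure ((*) c)) A = emeasure disc_measure A"
    using A by simp
qed simp

sublocale da: pair_sigma_finite disc_measure arc_measure ..

lemma measurable_rotation:
  "(\<lambda>x. snd x * fst x) \<in> measurable (disc_measure \<Otimes>\<^sub>M arc_measure) (restrict_space borel disc)"
proof (intro measurable_restrict_space2 borel_measurable_times)
  have "(\<lambda>x. x) \<in> borel_measurable disc_measure"
    using measurable_ident_sets[OF sets_disc_measure] by (auto intro: measurable_restrict_space1 simp: measurable_restrict_space2_iff)
  then show "fst \<in> borel_measurable (disc_measure \<Otimes>\<^sub>M arc_measure)"
    by (rule measurable_compose[OF measurable_fst])
  have "(\<lambda>x. x) \<in> borel_measurable arc_measure"
    by (intro continuous_on_circle_measurable continuous_intros)
  then show "snd \<in> borel_measurable (disc_measure \<Otimes>\<^sub>M arc_measure)"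
    by (rule measurable_compose[OF measurable_snd])
qed (auto simp: space_pair_measure norm_mult circle_norm)

text \<open>The substitute for the angular integral in polar coordinates: each rotation preserves
  the measure, so averaging over all of them changes nothing, and Fubini moves the average
  inside.\<close>

lemma disc_average:
  fixes F :: "complex \<Rightarrow> complex"
  assumes "F \<in> borel_measurable (restrict_space borel disc)" "integrable disc_measure F"
  shows "(\<integral>z. F z \<partial>disc_measure) = (\<integral>z. (\<integral>u. F (u * z) \<partial>arc_measure) \<partial>disc_measure)"
proof -
  have G: "(\<lambda>x. F (snd x * fst x)) \<in> borel_measurable (disc_measure \<Otimes>\<^sub>M arc_measure)"
    by (rule measurable_compose[OF measurable_rotation assms(1)])
  have F': "F \<in> borel_measurable disc_measure" using assms(2) by auto
  have rot: "(\<integral>\<^sup>+z. norm (F (u * z)) \<partial>disc_measure) = (\<integral>\<^sup>+z. norm (F z) \<partial>disc_measure)"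
    "(\<integral>z. F (u * z) \<partial>disc_measure) = (\<integral>z. F z \<partial>disc_measure)" if "u \<in> circle" for u
  proof -
    have u: "norm u = 1" using that by (simp add: circle_norm)
    show "(\<integral>\<^sup>+z. norm (F (u * z)) \<partial>disc_measure) = (\<integral>\<^sup>+z. norm (F z) \<partial>disc_measure)"
      using nn_integral_distr[OF measurable_disc_rotate[OF u], of "\<lambda>z. ennreal (norm (F z))"] F'
      unfolding distr_disc_rotate[OF u] by simp
    show "(\<integral>z. F (u * z) \<partial>disc_measure) = (\<integral>z. F z \<partial>disc_measure)"
      using integral_distr[OF measurable_disc_rotate[OF u], of F] F' unfolding distr_disc_rotate[OF u] by simp
  qed
  have int: "integrable (disc_measure \<Otimes>\<^sub>M arc_measure) (\<lambda>(z, u). F (u * z))"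
  proof (rule integrableI_bounded)
    show "(\<lambda>(z, u). F (u * z)) \<in> borel_measurable (disc_measure \<Otimes>\<^sub>M arc_measure)"
      using G by (simp add: case_prod_unfold)
    have "(\<integral>\<^sup>+x. ennreal (norm (case x of (z, u) \<Rightarrow> F (u * z))) \<partial>(disc_measure \<Otimes>\<^sub>M arc_measure))
      = (\<integral>\<^sup>+u. (\<integral>\<^sup>+z. norm (F (u * z)) \<partial>disc_measure) \<partial>arc_measure)"
      using G by (subst da.nn_integral_snd[symmetric]) (auto simp: case_prod_unfold)
    also have "\<dots> = (\<integral>\<^sup>+u. (\<integral>\<^sup>+z. norm (F z) \<partial>disc_measure) \<partial>arc_measure)"
      by (intro nn_integral_cong rot) simp
    also have "\<dots> = (\<integral>\<^sup>+z. norm (F z) \<partial>disc_measure)" by (simp add: emeasure_arc_circle)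
    also have "\<dots> < \<infinity>" using assms(2) by (simp add: integrable_iff_bounded)
    finally show "(\<integral>\<^sup>+x. ennreal (norm (case x of (z, u) \<Rightarrow> F (u * z))) \<partial>(disc_measure \<Otimes>\<^sub>M arc_measure)) < \<infinity>" .
  qed
  have "(\<integral>z. F z \<partial>disc_measure) = (\<integral>u. (\<integral>z. F z \<partial>disc_measure) \<partial>arc_measure)" by simp
  also have "\<dots> = (\<integral>u. (\<integral>z. F (u * z) \<partial>disc_measure) \<partial>arc_measure)"
    by (intro Bochner_Integration.integral_cong refl rot(2)[symmetric]) simp
  also have "\<dots> = (\<integral>z. (\<integral>u. F (u * z) \<partial>arc_measure) \<partial>disc_measure)"
    by (rule da.Fubini_integral[OF int])
  finally show ?thesis .
qed

lemma nn_disc_average: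
  assumes F: "F \<in> borel_measurable (restrict_space borel disc)"
  shows "(\<integral>\<^sup>+z. F z \<partial>disc_measure) = (\<integral>\<^sup>+z. (\<integral>\<^sup>+u. F (u * z) \<partial>arc_measure) \<partial>disc_measure)"
proof -
  have G: "(\<lambda>(z, u). F (u * z)) \<in> borel_measurable (disc_measure \<Otimes>\<^sub>M arc_measure)"
    using measurable_compose[OF measurable_rotation F] by (simp add: case_prod_unfold)
  have F': "F \<in> borel_measurable disc_measure" using F by (simp cong: measurable_cong_sets add: sets_disc_measure)
  have rot: "(\<integral>\<^sup>+z. F (u * z) \<partial>disc_measure) = (\<integral>\<^sup>+z. F z \<partial>disc_measure)" if "u \<in> circle" for u
  proof -
    have u: "norm u = 1" using that by (simp add: circle_norm)
    show ?thesis
      using nn_integral_distr[OF measurable_disc_rotate[OF u], of F] F' unfolding distr_disc_rotate[OF u] by simp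
  qed
  have "(\<integral>\<^sup>+z. F z \<partial>disc_measure) = (\<integral>\<^sup>+u. (\<integral>\<^sup>+z. F z \<partial>disc_measure) \<partial>arc_measure)" by (simp add: emeasure_arc_circle)
  also have "\<dots> = (\<integral>\<^sup>+u. (\<integral>\<^sup>+z. F (u * z) \<partial>disc_measure) \<partial>arc_measure)"
    by (intro nn_integral_cong rot[symmetric]) simp
  also have "\<dots> = (\<integral>\<^sup>+z. (\<integral>\<^sup>+u. F (u * z) \<partial>arc_measure) \<partial>disc_measure)"
    by (rule da.Fubini'[OF G])
  finally show ?thesis .
qed

text \<open>Monotonicity in r gives measurability at once.\<close>

lemma mean_pow_measurable:
  assumes "1 < p" "f holomorphic_on disc"
  shows "mean_pow p f \<in> borel_measurable unit_lebesgue" "mean_pow p f \<in> borel_measurable radial_measure"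
    "mean_pow p f \<in> borel_measurable (restrict_space borel {0..<1})"
proof -
  have "mono_on {0..<1} (mean_pow p f)"
    using mean_pow_mono[OF assms] by (intro mono_onI) auto
  then show b: "mean_pow p f \<in> borel_measurable (restrict_space borel {0..<1})"
    by (rule borel_measurable_mono_on_fnc)
  have "(\<lambda>r. r) \<in> measurable unit_lebesgue (restrict_space borel {0..<1})"
    by (intro measurable_restrict_space3 measurable_completion) auto
  from measurable_compose[OF this b] show "mean_pow p f \<in> borel_measurable unit_lebesgue" .
  then show "mean_pow p f \<in> borel_measurable radial_measure"
    by (simp cong: measurable_cong_sets add: sets_radial)
qed

lemma norm_powr_measurable_disc:
  assumes "f holomorphic_on disc" "0 < p"
  shows "(\<lambda>z. norm (f z) powr p) \<in> borel_measurable (restrict_space borel disc)"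
  using assms by (intro borel_measurable_continuous_on_restrict continuous_on_powr_norm holomorphic_on_imp_continuous_on)

text \<open>Averaging over rotations replaces \<open>|f|^p\<close> by its mean on the circle through
  z, a function of the radius, whose density contributes 2r.\<close>

lemma polar_mean_pow:
  assumes p: "1 < p" and f: "f holomorphic_on disc"
  shows "(\<integral>\<^sup>+z. ennreal (norm (f z) powr p * w (norm z)) \<partial>area_measure)
     = (\<integral>\<^sup>+r. ennreal (2 * r * mean_pow p f r) \<partial>radial_measure)"
proof -
  have m: "(\<lambda>z. ennreal (norm (f z) powr p)) \<in> borel_measurable (restrict_space borel disc)"
    using norm_powr_measurable_disc[OF f, of p] p by simp
  have "(\<integral>\<^sup>+z. ennreal (norm (f z) powr p * w (norm z)) \<partial>area_measure)
     = (\<integral>\<^sup>+z. ennreal (w (norm z)) * ennreal (norm (f z) powr p) \<partial>area_measure)"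
    by (intro nn_integral_cong) (auto simp: ennreal_mult' w_nonneg mult.commute)
  also have "\<dots> = (\<integral>\<^sup>+z. ennreal (norm (f z) powr p) \<partial>disc_measure)"
    by (rule nn_integral_disc_measure[symmetric, OF m])
  also have "\<dots> = (\<integral>\<^sup>+z. (\<integral>\<^sup>+u. ennreal (norm (f (u * z)) powr p) \<partial>arc_measure) \<partial>disc_measure)"
    by (rule nn_disc_average[OF m])
  also have "\<dots> = (\<integral>\<^sup>+z. ennreal (mean_pow p f (norm z)) \<partial>disc_measure)"
  proof (rule nn_integral_cong)
    fix z assume "z \<in> space disc_measure"
    then have z: "norm z < 1" by simp
    have "(\<integral>\<^sup>+u. ennreal (norm (f (u * z)) powr p) \<partial>arc_measure) = ennreal (\<integral>u. norm (f (z * u)) powr p \<partial>arc_measure)"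
      unfolding mult.commute[of z] using z p holomorphic_circle_continuous[OF f z]
      by (intro nn_integral_eq_integral continuous_on_circle_integrable continuous_on_powr_norm) (auto simp: mult.commute)
    then show "(\<integral>\<^sup>+u. ennreal (norm (f (u * z)) powr p) \<partial>arc_measure) = ennreal (mean_pow p f (norm z))"
      using mean_pow_rotate[OF f z] p by simp
  qed
  also have "\<dots> = (\<integral>\<^sup>+r. ennreal (2 * r) * ennreal (mean_pow p f r) \<partial>radial_measure)"
  proof (rule nn_integral_disc_norm)
    show "(\<lambda>r. ennreal (mean_pow p f r)) \<in> borel_measurable unit_lebesgue"
      using mean_pow_measurable(1)[OF p f] by simp
    have n: "norm \<in> measurable (restrict_space borel disc) (restrict_space borel {0..<1})"
      by (intro measurable_restrict_space3) auto
    show "(\<lambda>z. ennreal (mean_pow p f (norm z))) \<in> borel_measurable (restrict_space borel disc)"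
      using measurable_compose[OF n mean_pow_measurable(3)[OF p f]] by simp
  qed
  also have "\<dots> = (\<integral>\<^sup>+r. ennreal (2 * r * mean_pow p f r) \<partial>radial_measure)"
    by (intro nn_integral_cong) (auto simp: ennreal_mult' mean_pow_nonneg ennreal_mult'')
  finally show ?thesis .
qed

lemma bergman_iff:
  assumes p: "1 < p" and f: "f holomorphic_on disc"
  shows "f \<in> bergman_space p w \<longleftrightarrow> integrable radial_measure (\<lambda>r. 2 * r * mean_pow p f r)" (is ?A)
    and "Lp_norm p w f = (\<integral>r. 2 * r * mean_pow p f r \<partial>radial_measure) powr (1 / p)" (is ?B)
proof -
  have fm: "f \<in> borel_measurable area_measure"
    using f by (intro borel_measurable_area_continuous holomorphic_on_imp_continuous_on)
  then have "f \<in> borel_measurable (lebesgue_on disc)" by (simp add: measurable_area_iff)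
  then have "f \<in> bergman_space p w \<longleftrightarrow> integrable area_measure (\<lambda>z. norm (f z) powr p * w (norm z))"
    using f by (simp add: bergman_space_def Lp_space_def)
  have m1: "(\<lambda>z. norm (f z) powr p * w (norm z)) \<in> borel_measurable area_measure" using fm by measurable
  have m2: "(\<lambda>r. 2 * r * mean_pow p f r) \<in> borel_measurable radial_measure"
  proof (intro borel_measurable_times mean_pow_measurable(2)[OF p f] borel_measurable_const)
    have "(\<lambda>r::real. r) \<in> borel_measurable unit_lebesgue" by (intro borel_unit_lebesgue) simp
    then show "(\<lambda>r. r) \<in> borel_measurable radial_measure" by (simp cong: measurable_cong_sets add: sets_radial)
  qed
  have n1: "AE z in area_measure. 0 \<le> norm (f z) powr p * w (norm z)"
    by (intro AE_I2) (auto simp: w_nonneg)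
  have n2: "AE r in radial_measure. 0 \<le> 2 * r * mean_pow p f r"
    by (intro AE_I2) (auto simp: mean_pow_nonneg)
  have "f \<in> bergman_space p w \<longleftrightarrow> integrable area_measure (\<lambda>z. norm (f z) powr p * w (norm z))" by fact
  also have "\<dots> \<longleftrightarrow> integrable radial_measure (\<lambda>r. 2 * r * mean_pow p f r)"
    unfolding integrable_iff_nn_integral[OF m1 n1] integrable_iff_nn_integral[OF m2 n2] polar_mean_pow[OF p f] ..
  finally show ?A .
  show ?B unfolding Lp_norm_def
    using integral_eq_nn_integral[OF m1 n1] integral_eq_nn_integral[OF m2 n2] polar_mean_pow[OF p f] by simp
qed

lemma integral_disc_measure:
  fixes F :: "complex \<Rightarrow> complex"
  assumes "F \<in> borel_measurable (restrict_space borel disc)"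
  shows "(\<integral>z. F z \<partial>disc_measure) = (\<integral>z. F z * of_real (w (norm z)) \<partial>area_measure)"
    and "integrable disc_measure F \<longleftrightarrow> integrable area_measure (\<lambda>z. F z * of_real (w (norm z)))"
proof -
  have F: "F \<in> borel_measurable area_measure" using assms by (rule measurable_area_lborel)
  have id: "(\<lambda>z. z) \<in> measurable (density area_measure (\<lambda>z. ennreal (w (norm z)))) (restrict_space borel disc)"
    using measurable_id_area by simp
  have nn: "AE z in area_measure. 0 \<le> w (norm z)" by (intro AE_I2) (auto simp: w_nonneg)
  show "(\<integral>z. F z \<partial>disc_measure) = (\<integral>z. F z * of_real (w (norm z)) \<partial>area_measure)"
    unfolding disc_measure_def using assms F nn
    by (simp add: integral_distr[OF id] integral_density scaleR_conv_of_real mult.commute)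
  show "integrable disc_measure F \<longleftrightarrow> integrable area_measure (\<lambda>z. F z * of_real (w (norm z)))"
    unfolding disc_measure_def using assms F nn
    by (simp add: integrable_distr_eq[OF id] integrable_density scaleR_conv_of_real mult.commute)
qed

lemma moment_radial: "weight_moment w x = (\<integral>r. r powr x \<partial>radial_measure)"
proof -
  have "(\<integral>r. r powr x \<partial>radial_measure) = (\<integral>r. w r *\<^sub>R (r powr x) \<partial>unit_lebesgue)"
    unfolding radial_measure_def using w_nonneg
    by (intro integral_density[OF borel_unit_lebesgue w_measurable]) auto
  then show ?thesis by (simp add: weight_moment_def mult.commute)
qed

lemma tail_radial:
  assumes "0 \<le> r" shows "weight_tail w r = measure radial_measure {r..<1}"
proof -
  have s: "{r..<1} \<in> sets unit_lebesgue"
    using assms by (auto simp: sets_restrict_space intro!: image_eqI[of _ _ "{r..<1}"])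
  have "weight_tail w r = (\<integral>s. indicator {r..<1} s *\<^sub>R w s \<partial>lebesgue)"
    unfolding weight_tail_def by (rule integral_restrict_space) simp
  also have "\<dots> = (\<integral>s. indicator {0..<1} s *\<^sub>R (indicator {r..<1} s * w s) \<partial>lebesgue)"
    using assms by (intro Bochner_Integration.integral_cong) (auto simp: indicator_def)
  also have "\<dots> = (\<integral>s. indicator {r..<1} s * w s \<partial>unit_lebesgue)"
    by (rule integral_restrict_space[symmetric]) simp
  also have "\<dots> = (\<integral>s. indicator {r..<1} s \<partial>radial_measure)"
    unfolding radial_measure_def using w_nonneg s by (subst integral_density) (auto simp: mult.commute)
  also have "\<dots> = measure radial_measure {r..<1}"
    using assms Bochner_Integration.integral_indicator[of radial_measure "{r..<1}"] by (simp add: Int_absorb2)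
  finally show ?thesis .
qed

text \<open>Averaging over rotations isolates one Taylor coefficient and leaves
  \<open>|z|^(2n)\<close>; the density 2r then produces the odd exponent 2n + 1 and the factor 2.
  Integrability of g against w is all that is asked, so this also serves members of the
  Dirichlet-type space that have a pairing.\<close>

lemma coeff_disc:
  assumes g: "g holomorphic_on disc" and int: "integrable area_measure (\<lambda>z. g z * of_real (w (norm z)))"
  shows "(\<integral>z. cnj z ^ n * g z * of_real (w (norm z)) \<partial>area_measure)
     = taylor_coeff g n * of_real (2 * weight_moment w (2 * real n + 1))"
    and "integrable area_measure (\<lambda>z. cnj z ^ n * g z * of_real (w (norm z)))"
proof -
  have contg: "continuous_on disc g" using g by (rule holomorphic_on_imp_continuous_on)
  let ?F = "\<lambda>z. cnj z ^ n * g z"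
  have m: "?F \<in> borel_measurable (restrict_space borel disc)" "g \<in> borel_measurable (restrict_space borel disc)"
    by (intro borel_measurable_continuous_on_restrict continuous_intros contg)+
  show int': "integrable area_measure (\<lambda>z. cnj z ^ n * g z * of_real (w (norm z)))"
  proof (rule Bochner_Integration.integrable_bound[OF int])
    show "(\<lambda>z. cnj z ^ n * g z * of_real (w (norm z))) \<in> borel_measurable area_measure"
      using measurable_area_lborel[OF m(1)] by measurable
    show "AE z in area_measure. norm (cnj z ^ n * g z * of_real (w (norm z))) \<le> norm (g z * of_real (w (norm z)))"
      by (intro AE_I2) (auto simp: norm_mult norm_power mult.assoc intro!: mult_left_le_one_le power_le_one mult_nonneg_nonneg)
  qed
  then have intF: "integrable disc_measure ?F" using integral_disc_measure(2)[OF m(1)] by simp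
  have "(\<integral>z. cnj z ^ n * g z * of_real (w (norm z)) \<partial>area_measure) = (\<integral>z. ?F z \<partial>disc_measure)"
    using integral_disc_measure(1)[OF m(1)] by simp
  also have "\<dots> = (\<integral>z. (\<integral>u. ?F (u * z) \<partial>arc_measure) \<partial>disc_measure)"
    by (rule disc_average[OF m(1) intF])
  also have "\<dots> = (\<integral>z. taylor_coeff g n * of_real (norm z ^ (2 * n)) \<partial>disc_measure)"
  proof (rule Bochner_Integration.integral_cong[OF refl])
    fix z assume "z \<in> space disc_measure"
    then have z: "norm z < 1" by simp
    have eq: "of_real (norm z) * (direction z * u) = u * z" for u
      using norm_times_direction[of z] by (metis mult.assoc mult.commute)
    have "continuous_on circle (\<lambda>u. ?F (of_real (norm z) * u))"
      using z by (intro continuous_intros holomorphic_circle_continuous[OF g]) auto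
    then have "(\<integral>u. ?F (of_real (norm z) * (direction z * u)) \<partial>arc_measure) = (\<integral>u. ?F (of_real (norm z) * u) \<partial>arc_measure)"
      using direction_in_circle[of z] unfolding circle_norm
      by (intro integral_arc_rotate[of "direction z" "\<lambda>u. ?F (of_real (norm z) * u)"] continuous_on_circle_measurable)
    then have "(\<integral>u. ?F (u * z) \<partial>arc_measure) = (\<integral>u. ?F (of_real (norm z) * u) \<partial>arc_measure)"
      unfolding eq .
    also have "\<dots> = (\<integral>u. of_real (norm z ^ n) * (cnj u ^ n * g (of_real (norm z) * u)) \<partial>arc_measure)"
      by (simp add: power_mult_distrib mult.assoc)
    also have "\<dots> = of_real (norm z ^ n) * (taylor_coeff g n * of_real (norm z) ^ n)"
      using coeff_integral[OF g, of "norm z" n] z by simp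
    finally show "(\<integral>u. ?F (u * z) \<partial>arc_measure) = taylor_coeff g n * of_real (norm z ^ (2 * n))"
      by (simp add: mult_2 power_add)
  qed
  also have "\<dots> = taylor_coeff g n * of_real (\<integral>z. norm z ^ (2 * n) \<partial>disc_measure)"
    by (subst integral_mult_right_zero, subst integral_complex_of_real) (rule refl)
  also have "(\<integral>z. norm z ^ (2 * n) \<partial>disc_measure) = 2 * weight_moment w (2 * real n + 1)"
  proof -
    have mz: "(\<lambda>z. norm z ^ (2 * n)) \<in> borel_measurable disc_measure"
      using borel_measurable_continuous_on_restrict[of disc "\<lambda>z. norm z ^ (2 * n)"]
      by (simp cong: measurable_cong_sets add: sets_disc_measure continuous_intros)
    have "(\<integral>\<^sup>+z. ennreal (norm z ^ (2 * n)) \<partial>disc_measure) = (\<integral>\<^sup>+r. ennreal (2 * r) * ennreal (r ^ (2 * n)) \<partial>radial_measure)"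
      by (rule nn_integral_disc_norm) (auto intro!: measurable_restrict_space1 borel_unit_lebesgue)
    also have "\<dots> = (\<integral>\<^sup>+r. ennreal (2 * (r powr (2 * real n + 1))) \<partial>radial_measure)"
    proof (rule nn_integral_cong)
      fix r assume "r \<in> space radial_measure"
      then have r: "0 \<le> r" by simp
      have "r powr (2 * real n + 1) = r * r ^ (2 * n)"
      proof (cases "r = 0")
        case False
        then have "r powr (real (2 * n) + 1) = r ^ (2 * n) * r" using r powr_realpow[of r "2 * n"] by (simp add: powr_add)
        then show ?thesis by (simp add: mult.commute)
      qed simp
      then show "ennreal (2 * r) * ennreal (r ^ (2 * n)) = ennreal (2 * (r powr (2 * real n + 1)))"
        using r by (simp add: ennreal_mult'[symmetric] mult.assoc)
    qed
    finally have nn: "(\<integral>\<^sup>+z. ennreal (norm z ^ (2 * n)) \<partial>disc_measure) = (\<integral>\<^sup>+r. ennreal (2 * (r powr (2 * real n + 1))) \<partial>radial_measure)" .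
    have "(\<lambda>r::real. r) \<in> borel_measurable unit_lebesgue" by (intro borel_unit_lebesgue) simp
    then have [measurable]: "(\<lambda>r. r) \<in> borel_measurable radial_measure" by (simp cong: measurable_cong_sets add: sets_radial)
    have "(\<integral>z. norm z ^ (2 * n) \<partial>disc_measure) = (\<integral>r. 2 * (r powr (2 * real n + 1)) \<partial>radial_measure)"
      using nn mz by (subst (1 2) integral_eq_nn_integral) auto
    then show ?thesis by (simp add: moment_radial)
  qed
  finally show "(\<integral>z. cnj z ^ n * g z * of_real (w (norm z)) \<partial>area_measure)
     = taylor_coeff g n * of_real (2 * weight_moment w (2 * real n + 1))" .
qed

end

section \<open>Doubling weights and derivatives\<close>

text \<open>Negative values of f are harmless: \<open>ennreal\<close> truncates them and only levels
  t at or above 0 are integrated.\<close>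

lemma nn_integral_layer_cake:
  fixes f :: "'a \<Rightarrow> real"
  assumes "sigma_finite_measure M" and [measurable]: "f \<in> borel_measurable M"
  shows "(\<integral>\<^sup>+x. ennreal (f x) \<partial>M) = (\<integral>\<^sup>+t. indicator {0..} t * emeasure M {x\<in>space M. t < f x} \<partial>lborel)"
proof -
  interpret M: sigma_finite_measure M by fact
  interpret P: pair_sigma_finite M "lborel :: real measure" ..
  have "(\<integral>\<^sup>+x. ennreal (f x) \<partial>M) = (\<integral>\<^sup>+x. (\<integral>\<^sup>+t. indicator {0..} t * indicator {..<f x} t \<partial>lborel) \<partial>M)"
  proof (rule nn_integral_cong)
    fix x
    have "(\<integral>\<^sup>+t. indicator {0..} t * indicator {..<f x} t \<partial>lborel) = (\<integral>\<^sup>+t. indicator {0..<f x} t \<partial>lborel)"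
      by (intro nn_integral_cong) (auto simp: indicator_def)
    then show "ennreal (f x) = (\<integral>\<^sup>+t. indicator {0..} t * indicator {..<f x} t \<partial>lborel)"
      by (cases "0 \<le> f x") (auto simp: ennreal_neg)
  qed
  also have "\<dots> = (\<integral>\<^sup>+t. (\<integral>\<^sup>+x. indicator {0..} t * indicator {..<f x} t \<partial>M) \<partial>lborel)"
    by (rule P.Fubini'[symmetric]) (simp add: lessThan_def)
  also have "\<dots> = (\<integral>\<^sup>+t. indicator {0..} t * emeasure M {x\<in>space M. t < f x} \<partial>lborel)"
  proof (rule nn_integral_cong)
    fix t
    have "(\<integral>\<^sup>+x. indicator {0..} t * indicator {..<f x} t \<partial>M) = indicator {0..} t * (\<integral>\<^sup>+x. indicator {x\<in>space M. t < f x} x \<partial>M)"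
      by (subst nn_integral_cmult[symmetric]) (auto intro!: nn_integral_cong simp: indicator_def)
    then show "(\<integral>\<^sup>+x. indicator {0..} t * indicator {..<f x} t \<partial>M) = indicator {0..} t * emeasure M {x\<in>space M. t < f x}"
      by simp
  qed
  finally show ?thesis .
qed

section \<open>Tails, moments and the doubling condition\<close>

context weight begin

lemma borel_radial: "f \<in> borel_measurable borel \<Longrightarrow> f \<in> borel_measurable radial_measure"
  using borel_unit_lebesgue by (simp cong: measurable_cong_sets add: sets_radial)

lemma interval_sets_radial:
  "0 \<le> a \<Longrightarrow> {a..<1} \<in> sets radial_measure" "0 \<le> a \<Longrightarrow> {a<..<1} \<in> sets radial_measure"
  by (auto simp: sets_radial sets_restrict_space intro: image_eqI[of _ _ "{a..<1}"] image_eqI[of _ _ "{a<..<1}"])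

lemma emeasure_radial_tail:
  "0 \<le> r \<Longrightarrow> emeasure radial_measure {r..<1} = ennreal (weight_tail w r)"
  by (simp add: tail_radial rad.emeasure_eq_measure)

lemma emeasure_radial_open_tail:
  assumes "0 \<le> r" shows "emeasure radial_measure {r<..<1} = ennreal (weight_tail w r)"
proof -
  have "AE s in lebesgue. s \<noteq> r" using AE_lborel_singleton[of r] by (rule AE_completion)
  then have "AE s in unit_lebesgue. s \<noteq> r" by (subst AE_restrict_space_iff) auto
  then have "AE s in radial_measure. s \<noteq> r"
    unfolding radial_measure_def by (subst AE_density) auto
  then have "emeasure radial_measure {r<..<1} = emeasure radial_measure {r..<1}"
    using interval_sets_radial[OF assms] by (intro emeasure_eq_AE) (auto elim!: eventually_mono)
  then show ?thesis using assms by (simp add: emeasure_radial_tail)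
qed

lemma tail_nonneg: "0 \<le> r \<Longrightarrow> 0 \<le> weight_tail w r"
  by (simp add: tail_radial)

lemma tail_antimono: "0 \<le> r \<Longrightarrow> r \<le> s \<Longrightarrow> weight_tail w s \<le> weight_tail w r"
  by (simp add: tail_radial) (intro rad.finite_measure_mono interval_sets_radial, auto)

text \<open>Superlevel sets of a nondecreasing function are intervals ending at 1, so the doubling
  condition on tails is exactly what the layer cake formula needs.\<close>
lemma doubling_transfer:
  assumes C: "0 \<le> C" "\<And>r. 0 \<le> r \<Longrightarrow> r < 1 \<Longrightarrow> weight_tail w r \<le> C * weight_tail w ((1 + r) / 2)"
    and mono: "mono_on {0..<1} \<phi>"
  shows "(\<integral>\<^sup>+r. ennreal (\<phi> ((1 + r) / 2)) \<partial>radial_measure) \<le> ennreal C * (\<integral>\<^sup>+r. ennreal (\<phi> r) \<partial>radial_measure)"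
proof -
  have mb: "\<psi> \<in> borel_measurable radial_measure" if "mono_on {0..<1} \<psi>" for \<psi> :: "real \<Rightarrow> real"
  proof -
    have "(\<lambda>r. r) \<in> measurable unit_lebesgue (restrict_space borel {0..<1})"
      by (intro measurable_restrict_space3 measurable_completion) auto
    from measurable_compose[OF this borel_measurable_mono_on_fnc[OF that]] show ?thesis
      by (simp cong: measurable_cong_sets add: sets_radial)
  qed
  have [measurable]: "\<phi> \<in> borel_measurable radial_measure" by (rule mb[OF mono])
  have [measurable]: "(\<lambda>r. \<phi> ((1 + r) / 2)) \<in> borel_measurable radial_measure"
    by (intro mb mono_onI mono_onD[OF mono]) auto
  have level: "emeasure radial_measure {r\<in>space radial_measure. t < \<phi> ((1 + r) / 2)}
     \<le> ennreal C * emeasure radial_measure {r\<in>space radial_measure. t < \<phi> r}" for t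
  proof -
    let ?V = "{r\<in>space radial_measure. t < \<phi> ((1 + r) / 2)}" and ?U = "{r\<in>space radial_measure. t < \<phi> r}"
    show ?thesis
    proof (cases "?V = {}")
      case False
      \<comment> \<open>\<open>?V\<close> lies in [s, 1), and \<open>?U\<close> contains everything
        beyond (1 + s) / 2: exactly the two tails that the doubling condition compares.\<close>
      define s where "s = Inf ?V"
      have bb: "bdd_below ?V" by (intro bdd_belowI[of _ 0]) auto
      have s: "0 \<le> s" "s < 1"
        using False cInf_greatest[OF False, of 0] cInf_lower[OF _ bb] by (force simp: s_def)+
      have "?V \<subseteq> {s..<1}" using cInf_lower[OF _ bb] by (auto simp: s_def)
      then have "emeasure radial_measure ?V \<le> emeasure radial_measure {s..<1}"
        using s by (intro emeasure_mono interval_sets_radial)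
      also have "\<dots> \<le> ennreal (C * weight_tail w ((1 + s) / 2))"
        using s C by (simp add: emeasure_radial_tail ennreal_leI)
      \<comment> \<open>The infimum need not be attained, so only the open interval is known to lie
        in \<open>?U\<close>; its left endpoint is null.\<close>
      also have "\<dots> = ennreal C * emeasure radial_measure {(1 + s) / 2<..<1}"
        using s C by (simp add: emeasure_radial_open_tail ennreal_mult')
      also have "emeasure radial_measure {(1 + s) / 2<..<1} \<le> emeasure radial_measure ?U"
      proof (rule emeasure_mono)
        show "{(1 + s) / 2<..<1} \<subseteq> ?U"
        proof
          fix r assume r: "r \<in> {(1 + s) / 2<..<1}"
          then have "s < 2 * r - 1" by auto
          then obtain v where v: "v \<in> ?V" "v < 2 * r - 1"
            using cInf_lessD[OF False, of "2 * r - 1"] by (auto simp: s_def)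
          then have "\<phi> ((1 + v) / 2) \<le> \<phi> r" using r s by (intro mono_onD[OF mono]) auto
          then show "r \<in> ?U" using v r s by auto
        qed
      qed measurable
      finally show ?thesis by (simp add: mult_left_mono)
    next
      case True
      then have "emeasure radial_measure ?V = 0" by (simp only: emeasure_empty)
      then show ?thesis by (simp only: zero_le)
    qed
  qed
  have sf: "sigma_finite_measure radial_measure" by unfold_locales
  have "(\<integral>\<^sup>+r. ennreal (\<phi> ((1 + r) / 2)) \<partial>radial_measure)
     = (\<integral>\<^sup>+t. indicator {0..} t * emeasure radial_measure {r\<in>space radial_measure. t < \<phi> ((1 + r) / 2)} \<partial>lborel)"
    by (rule nn_integral_layer_cake[OF sf]) measurable
  also have "\<dots> \<le> (\<integral>\<^sup>+t. ennreal C * (indicator {0..} t * emeasure radial_measure {r\<in>space radial_measure. t < \<phi> r}) \<partial>lborel)"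
    using level by (intro nn_integral_mono) (auto simp: indicator_def)
  also have "\<dots> = ennreal C * (\<integral>\<^sup>+t. indicator {0..} t * emeasure radial_measure {r\<in>space radial_measure. t < \<phi> r} \<partial>lborel)"
    by (intro nn_integral_cmult) measurable
  also have "(\<integral>\<^sup>+t. indicator {0..} t * emeasure radial_measure {r\<in>space radial_measure. t < \<phi> r} \<partial>lborel) = (\<integral>\<^sup>+r. ennreal (\<phi> r) \<partial>radial_measure)"
    by (rule nn_integral_layer_cake[OF sf, symmetric]) measurable
  finally show ?thesis .
qed

lemma integrable_powr_radial: "0 \<le> x \<Longrightarrow> integrable radial_measure (\<lambda>r. r powr x)"
  by (intro rad.integrable_const_bound[where B=1] borel_radial AE_I2) (auto intro: powr_le1)

lemma nn_integral_powr_radial: "0 \<le> x \<Longrightarrow> (\<integral>\<^sup>+r. ennreal (r powr x) \<partial>radial_measure) = ennreal (weight_moment w x)"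
  unfolding moment_radial by (intro nn_integral_eq_integral integrable_powr_radial) auto

lemma moment_nonneg: "0 \<le> weight_moment w x"
  unfolding moment_radial by (intro integral_nonneg_AE) auto

lemma moment_antimono:
  assumes "0 \<le> x" "x \<le> y" shows "weight_moment w y \<le> weight_moment w x"
  unfolding moment_radial using assms
  by (intro integral_mono integrable_powr_radial powr_mono') auto

lemma moment_ge_tail:
  assumes "0 \<le> s" "0 \<le> x" shows "s powr x * weight_tail w s \<le> weight_moment w x"
proof -
  have "s powr x * weight_tail w s = (\<integral>r. s powr x * indicator {s..<1} r \<partial>radial_measure)"
    using assms by (simp add: tail_radial Int_absorb2)
  also have "\<dots> \<le> weight_moment w x"
    unfolding moment_radial using assms
    by (intro integral_mono' integrable_powr_radial) (auto simp: indicator_def intro!: powr_mono2)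
  finally show ?thesis .
qed

lemma moment_doubling:
  assumes C: "0 \<le> C" "\<And>r. 0 \<le> r \<Longrightarrow> r < 1 \<Longrightarrow> weight_tail w r \<le> C * weight_tail w ((1 + r) / 2)"
    and y: "0 \<le> y"
  shows "weight_moment w (y / 2) \<le> C * weight_moment w y"
proof -
  have "ennreal (weight_moment w (y / 2)) = (\<integral>\<^sup>+r. ennreal (r powr (y / 2)) \<partial>radial_measure)"
    using y by (simp add: nn_integral_powr_radial)
  also have "\<dots> \<le> (\<integral>\<^sup>+r. ennreal (((1 + r) / 2) powr y) \<partial>radial_measure)"
  proof (intro nn_integral_mono ennreal_leI)
    fix r assume "r \<in> space radial_measure"
    then have r: "0 \<le> r" "r < 1" by auto
    have "sqrt r \<le> (1 + r) / 2" using arith_geo_mean_sqrt[of 1 r] r by simp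
    then have "sqrt r powr y \<le> ((1 + r) / 2) powr y" using y r by (intro powr_mono2) auto
    moreover have "sqrt r powr y = r powr (y / 2)"
      using r by (simp add: powr_half_sqrt[symmetric] powr_powr)
    ultimately show "r powr (y / 2) \<le> ((1 + r) / 2) powr y" by simp
  qed
  also have "\<dots> \<le> ennreal C * (\<integral>\<^sup>+r. ennreal (r powr y) \<partial>radial_measure)"
    using y by (intro doubling_transfer[of C "\<lambda>r. r powr y"] C mono_onI powr_mono2) auto
  also have "\<dots> = ennreal (C * weight_moment w y)"
    using y C by (simp add: nn_integral_powr_radial ennreal_mult')
  finally show ?thesis using C moment_nonneg by (subst (asm) ennreal_le_iff) auto
qed

text \<open>Ensures that the moments fall below every dyadic level, so that \<open>block\<close> is
  well defined.\<close>

lemma moment_tendsto_0: "(\<lambda>n. weight_moment w (2 * real n + 1)) \<longlonglongrightarrow> 0"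
proof -
  have "(\<lambda>n. \<integral>r. r powr (2 * real n + 1) \<partial>radial_measure) \<longlonglongrightarrow> (\<integral>r. 0 \<partial>radial_measure)"
  proof (rule integral_dominated_convergence[where w = "\<lambda>_. 1"])
    show "AE r in radial_measure. norm (r powr (2 * real n + 1)) \<le> 1" for n
      by (intro AE_I2) (auto intro: powr_le1)
    show "AE r in radial_measure. (\<lambda>n. r powr (2 * real n + 1)) \<longlonglongrightarrow> 0"
    proof (intro AE_I2)
      fix r assume "r \<in> space radial_measure"
      then have r: "0 \<le> r" "r < 1" by auto
      have "(\<lambda>n. r * (r ^ 2) ^ n) \<longlonglongrightarrow> r * 0"
        using r by (intro tendsto_mult tendsto_const LIMSEQ_realpow_zero) (auto simp: abs_square_less_1)
      moreover have "r powr (2 * real n + 1) = r * (r ^ 2) ^ n" for n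
        using r powr_realpow[of r "2 * n"] by (cases "r = 0") (auto simp: powr_add power_mult)
      ultimately show "(\<lambda>n. r powr (2 * real n + 1)) \<longlonglongrightarrow> 0" by simp
    qed
  qed (auto intro!: borel_radial)
  then show ?thesis by (simp add: moment_radial)
qed

lemma weight_times_dist: "0 \<le> \<beta> \<Longrightarrow> weight (weight_times_dist w \<beta>)"
proof
  assume \<beta>: "0 \<le> \<beta>"
  show "0 \<le> weight_times_dist w \<beta> r" if "0 \<le> r" "r < 1" for r
    using that w_nonneg by (simp add: weight_times_dist_def)
  show "integrable unit_lebesgue (weight_times_dist w \<beta>)"
  proof (rule Bochner_Integration.integrable_bound[OF w_integrable])
    have [measurable]: "(\<lambda>r. (1 - r) powr \<beta>) \<in> borel_measurable unit_lebesgue" by (intro borel_unit_lebesgue) measurable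
    show "weight_times_dist w \<beta> \<in> borel_measurable unit_lebesgue"
      unfolding weight_times_dist_def[abs_def] by measurable
    show "AE r in unit_lebesgue. norm (weight_times_dist w \<beta> r) \<le> norm (w r)"
      using w_nonneg \<beta> by (intro AE_I2) (auto simp: weight_times_dist_def abs_mult intro!: mult_right_le_one_le powr_le1)
  qed
qed

lemma nn_integral_weight_times_dist:
  assumes "0 \<le> \<beta>" and [measurable]: "f \<in> borel_measurable unit_lebesgue"
  shows "(\<integral>\<^sup>+r. f r \<partial>weight.radial_measure (weight_times_dist w \<beta>)) = (\<integral>\<^sup>+r. ennreal ((1 - r) powr \<beta>) * f r \<partial>radial_measure)"
proof -
  interpret W: weight "weight_times_dist w \<beta>" by (rule weight_times_dist) fact
  have [measurable]: "(\<lambda>r. ennreal ((1 - r) powr \<beta>)) \<in> borel_measurable unit_lebesgue" by (intro borel_unit_lebesgue) measurable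
  have "(\<integral>\<^sup>+r. f r \<partial>W.radial_measure) = (\<integral>\<^sup>+r. ennreal (weight_times_dist w \<beta> r) * f r \<partial>unit_lebesgue)"
    by (rule W.nn_integral_radial) fact
  also have "\<dots> = (\<integral>\<^sup>+r. ennreal (w r) * (ennreal ((1 - r) powr \<beta>) * f r) \<partial>unit_lebesgue)"
    by (intro nn_integral_cong) (auto simp: weight_times_dist_def ennreal_mult' w_nonneg mult.assoc)
  also have "\<dots> = (\<integral>\<^sup>+r. ennreal ((1 - r) powr \<beta>) * f r \<partial>radial_measure)"
    by (intro nn_integral_radial[symmetric]) measurable
  finally show ?thesis .
qed

lemma bergman_integral:
  assumes "1 < p" "f \<in> bergman_space p w"
  shows "(\<integral>\<^sup>+r. ennreal (2 * r * mean_pow p f r) \<partial>radial_measure) = ennreal (Lp_norm p w f powr p)"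
    and "f holomorphic_on disc"
proof -
  show f: "f holomorphic_on disc" using assms by (simp add: bergman_space_def)
  have int: "integrable radial_measure (\<lambda>r. 2 * r * mean_pow p f r)"
    using bergman_iff(1)[OF assms(1) f] assms(2) by simp
  have "(\<integral>\<^sup>+r. ennreal (2 * r * mean_pow p f r) \<partial>radial_measure) = ennreal (\<integral>r. 2 * r * mean_pow p f r \<partial>radial_measure)"
    by (intro nn_integral_eq_integral int AE_I2) (auto simp: mean_pow_nonneg)
  also have "(\<integral>r. 2 * r * mean_pow p f r \<partial>radial_measure) = Lp_norm p w f powr p"
    unfolding bergman_iff(2)[OF assms(1) f] using assms(1)
    by (simp add: powr_powr, subst abs_of_nonneg) (auto intro!: integral_nonneg_AE AE_I2 simp: mean_pow_nonneg)
  finally show "(\<integral>\<^sup>+r. ennreal (2 * r * mean_pow p f r) \<partial>radial_measure) = ennreal (Lp_norm p w f powr p)" .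
qed

lemma bergmanI:
  assumes p: "1 < p" and f: "f holomorphic_on disc" and K: "0 \<le> K"
    and le: "(\<integral>\<^sup>+r. ennreal (2 * r * mean_pow p f r) \<partial>radial_measure) \<le> ennreal (K powr p)"
  shows "f \<in> bergman_space p w" "Lp_norm p w f \<le> K"
proof -
  have "(\<lambda>r::real. r) \<in> borel_measurable radial_measure" by (intro borel_radial) simp
  then have m: "(\<lambda>r. 2 * r * mean_pow p f r) \<in> borel_measurable radial_measure"
    by (intro borel_measurable_times mean_pow_measurable(2)[OF p f] borel_measurable_const)
  have nn: "AE r in radial_measure. 0 \<le> 2 * r * mean_pow p f r"
    by (intro AE_I2) (auto simp: mean_pow_nonneg)
  have int: "integrable radial_measure (\<lambda>r. 2 * r * mean_pow p f r)"
    using le by (subst integrable_iff_nn_integral[OF m nn]) (auto intro: le_less_trans)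
  then show "f \<in> bergman_space p w" using bergman_iff(1)[OF p f] by simp
  have "(\<integral>r. 2 * r * mean_pow p f r \<partial>radial_measure) \<le> K powr p"
    using le nn_integral_eq_integral[OF int nn] by simp
  then have "Lp_norm p w f \<le> (K powr p) powr (1 / p)"
    unfolding bergman_iff(2)[OF p f] using p nn by (intro powr_mono2) (auto intro: integral_nonneg_AE)
  then show "Lp_norm p w f \<le> K" using p K by (simp add: powr_powr)
qed

lemma Lp_norm_nonneg: "0 \<le> Lp_norm p w f" by (simp add: Lp_norm_def)

end

locale positive_weight = weight +
  assumes tail_pos: "\<And>r. 0 \<le> r \<Longrightarrow> r < 1 \<Longrightarrow> 0 < weight_tail w r"
begin

lemma moment_pos: "0 \<le> x \<Longrightarrow> 0 < weight_moment w x"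
  using moment_ge_tail[of "1/2" x] tail_pos[of "1/2"] by (auto intro: less_le_trans[rotated] mult_pos_pos)

text \<open>Cauchy's estimate bounds derivatives at 0 by the mean at radius 1/2. By monotonicity
  that mean is dominated by all later ones, which carry the positive mass \<open>T\<close>.\<close>

lemma deriv_at_0_bound:
  assumes p: "1 < p"
  shows "\<exists>K\<ge>0. \<forall>f\<in>bergman_space p w. norm ((deriv ^^ j) f 0) \<le> K * Lp_norm p w f"
proof -
  define T where "T = weight_tail w (1/2)"
  have T: "0 < T" using tail_pos[of "1/2"] by (simp add: T_def)
  define c where "c = fact j / (1/2::real) ^ j"
  have c: "0 < c" by (simp add: c_def)
  have "norm ((deriv ^^ j) f 0) \<le> c * (1 / T) powr (1/p) * Lp_norm p w f" if "f \<in> bergman_space p w" for f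
  proof -
    note f = bergman_integral[OF p that]
    have m: "mean_pow p f (1/2) * T \<le> Lp_norm p w f powr p"
    proof -
      have "ennreal (mean_pow p f (1/2) * T) = (\<integral>\<^sup>+r. ennreal (mean_pow p f (1/2)) * indicator {1/2..<1} r \<partial>radial_measure)"
        using emeasure_radial_tail[of "1/2"] interval_sets_radial(1)[of "1/2"]
        by (subst nn_integral_cmult_indicator) (auto simp: T_def ennreal_mult' mean_pow_nonneg)
      also have "\<dots> \<le> (\<integral>\<^sup>+r. ennreal (2 * r * mean_pow p f r) \<partial>radial_measure)"
      proof (rule nn_integral_mono)
        fix r assume "r \<in> space radial_measure"
        then have r: "0 \<le> r" "r < 1" by auto
        show "ennreal (mean_pow p f (1/2)) * indicator {1/2..<1} r \<le> ennreal (2 * r * mean_pow p f r)"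
        proof (cases "1/2 \<le> r")
          case True
          have "1 * mean_pow p f (1/2) \<le> (2 * r) * mean_pow p f r"
            using True r mean_pow_mono[OF p f(2), of "1/2" r] by (intro mult_mono) (auto simp: mean_pow_nonneg)
          then show ?thesis using True r by (simp add: ennreal_leI)
        qed simp
      qed
      finally show ?thesis unfolding f(1) by (subst (asm) ennreal_le_iff) auto
    qed
    have "norm ((deriv ^^ j) f 0) powr p = mean_pow p ((deriv ^^ j) f) 0"
      by (simp add: mean_pow_def)
    also have "\<dots> \<le> c powr p * mean_pow p f (1/2)"
      using mean_pow_deriv[OF p f(2), of 0 "1/2" j] by (simp add: c_def)
    also have "\<dots> \<le> c powr p * (Lp_norm p w f powr p * (1 / T))"
      using m T by (intro mult_left_mono) (auto simp: field_simps)
    finally have "(norm ((deriv ^^ j) f 0) powr p) powr (1/p) \<le> (c powr p * (Lp_norm p w f powr p * (1 / T))) powr (1/p)"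
      using p by (intro powr_mono2) auto
    also have "(c powr p * (Lp_norm p w f powr p * (1 / T))) powr (1/p) = c powr (p * (1/p)) * (Lp_norm p w f powr (p * (1/p)) * (1 / T) powr (1/p))"
      by (simp only: powr_mult powr_powr)
    finally show ?thesis
      using p c T Lp_norm_nonneg by (simp add: powr_powr mult_ac)
  qed
  moreover have "0 \<le> c * (1 / T) powr (1/p)" using c by simp
  ultimately show ?thesis by blast
qed

lemma holomorphic_higher_deriv': "f holomorphic_on disc \<Longrightarrow> (deriv ^^ k) f holomorphic_on disc"
  by (intro holomorphic_higher_deriv) auto

theorem identity_bounded:
  assumes p: "1 < p" and dbl: "upper_doubling w"
  shows "bounded_between (bergman_space p w) (Lp_norm p w) (dirichlet_space p w k) (dirichlet_norm p w k) (\<lambda>f. f)"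
proof -
  obtain C where C: "1 \<le> C" "\<And>r. 0 \<le> r \<Longrightarrow> r < 1 \<Longrightarrow> weight_tail w r \<le> C * weight_tail w ((1 + r) / 2)"
    using dbl unfolding upper_doubling_def by auto
  let ?v = "weight_times_dist w (real k * p)"
  interpret V: weight ?v using p by (intro weight_times_dist) auto
  \<comment> \<open>With distance d = (1 - r) / 2 in Cauchy's estimate, the factor
    \<open>(1 - r)^(kp)\<close> cancels \<open>d^(-kp)\<close> up to this constant.\<close>
  define K where "K = (fact k * 2 ^ k) powr p"
  have K: "0 < K" by (simp add: K_def)
  define B where "B = (2 * K * C) powr (1/p)"
  have main: "(deriv ^^ k) f \<in> bergman_space p ?v \<and> Lp_norm p ?v ((deriv ^^ k) f) \<le> B * Lp_norm p w f"
    if fb: "f \<in> bergman_space p w" for f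
  proof -
    note f = bergman_integral[OF p fb]
    have fk: "(deriv ^^ k) f holomorphic_on disc" using f(2) by (rule holomorphic_higher_deriv')
    \<comment> \<open>Cutting off below 1/2 keeps the function monotone and brings it under
      \<open>2 * r * mean_pow p f r\<close>, whose factor r would otherwise be missing near 0. After
      the shift to (1 + r) / 2 the cut is invisible.\<close>
    define \<psi> where "\<psi> r = (if r < 1/2 then 0 else mean_pow p f r)" for r
    have mono: "mono_on {0..<1} \<psi>"
      using mean_pow_mono[OF p f(2)] by (intro mono_onI) (auto simp: \<psi>_def mean_pow_nonneg)
    have [measurable]: "mean_pow p ((deriv ^^ k) f) \<in> borel_measurable unit_lebesgue"
      by (rule mean_pow_measurable(1)[OF p fk])
    have [measurable]: "(\<lambda>r::real. r) \<in> borel_measurable unit_lebesgue" by (intro borel_unit_lebesgue) simp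
    have mp: "(\<lambda>r. ennreal (2 * r * mean_pow p ((deriv ^^ k) f) r)) \<in> borel_measurable unit_lebesgue"
      by (intro measurable_compose[OF _ measurable_ennreal] borel_measurable_times borel_measurable_const) measurable
    have "(\<integral>\<^sup>+r. ennreal (2 * r * mean_pow p ((deriv ^^ k) f) r) \<partial>V.radial_measure)
       = (\<integral>\<^sup>+r. ennreal ((1 - r) powr (real k * p)) * ennreal (2 * r * mean_pow p ((deriv ^^ k) f) r) \<partial>radial_measure)"
      using p mp by (intro nn_integral_weight_times_dist) auto
    also have "\<dots> \<le> (\<integral>\<^sup>+r. ennreal (2 * K) * ennreal (\<psi> ((1 + r) / 2)) \<partial>radial_measure)"
    proof (rule nn_integral_mono)
      fix r assume "r \<in> space radial_measure"
      then have r: "0 \<le> r" "r < 1" by auto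
      define d where "d = (1 - r) / 2"
      have d: "0 < d" "r + d = (1 + r) / 2" "r + d < 1" "1 - r = 2 * d" using r by (auto simp: d_def field_simps)
      have "(1 - r) powr (real k * p) * (2 * r * mean_pow p ((deriv ^^ k) f) r)
         \<le> (1 - r) powr (real k * p) * (2 * ((fact k / d ^ k) powr p * mean_pow p f (r + d)))"
      proof (intro mult_left_mono)
        have "2 * r * mean_pow p ((deriv ^^ k) f) r \<le> 2 * 1 * mean_pow p ((deriv ^^ k) f) r"
          using r by (intro mult_right_mono) (auto simp: mean_pow_nonneg)
        also have "\<dots> \<le> 2 * ((fact k / d ^ k) powr p * mean_pow p f (r + d))"
          using mean_pow_deriv[OF p f(2) r(1) d(1,3), of k] by simp
        finally show "2 * r * mean_pow p ((deriv ^^ k) f) r \<le> 2 * ((fact k / d ^ k) powr p * mean_pow p f (r + d))" .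
      qed auto
      also have "(1 - r) powr (real k * p) * (2 * ((fact k / d ^ k) powr p * mean_pow p f (r + d)))
         = 2 * (((1 - r) powr (real k * p) * (fact k / d ^ k) powr p) * mean_pow p f (r + d))"
        by (simp add: mult_ac)
      also have "(1 - r) powr (real k * p) * (fact k / d ^ k) powr p = K"
      proof -
        have "(1 - r) powr (real k * p) = ((1 - r) ^ k) powr p"
          using r by (simp add: powr_powr[symmetric] powr_realpow)
        then have "(1 - r) powr (real k * p) * (fact k / d ^ k) powr p = ((1 - r) ^ k * (fact k / d ^ k)) powr p"
          by (simp only: powr_mult)
        also have "(1 - r) ^ k * (fact k / d ^ k) = fact k * 2 ^ k"
          unfolding d(4) using d(1) by (simp add: power_mult_distrib)
        finally show ?thesis by (simp add: K_def)
      qed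
      finally have "(1 - r) powr (real k * p) * (2 * r * mean_pow p ((deriv ^^ k) f) r) \<le> 2 * (K * \<psi> ((1 + r) / 2))"
        using r d(2) by (simp add: \<psi>_def)
      then have "ennreal ((1 - r) powr (real k * p) * (2 * r * mean_pow p ((deriv ^^ k) f) r)) \<le> ennreal ((2 * K) * \<psi> ((1 + r) / 2))"
        by (intro ennreal_leI) (simp add: mult.assoc)
      then show "ennreal ((1 - r) powr (real k * p)) * ennreal (2 * r * mean_pow p ((deriv ^^ k) f) r) \<le> ennreal (2 * K) * ennreal (\<psi> ((1 + r) / 2))"
        using K by (simp add: ennreal_mult')
    qed
    also have "\<dots> = ennreal (2 * K) * (\<integral>\<^sup>+r. ennreal (\<psi> ((1 + r) / 2)) \<partial>radial_measure)"
    proof (rule nn_integral_cmult)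
      have "mono_on {0..<1} (\<lambda>r. \<psi> ((1 + r) / 2))" by (intro mono_onI mono_onD[OF mono]) auto
      then have "(\<lambda>r. \<psi> ((1 + r) / 2)) \<in> borel_measurable (restrict_space borel {0..<1})" by (rule borel_measurable_mono_on_fnc)
      moreover have "(\<lambda>r. r) \<in> measurable unit_lebesgue (restrict_space borel {0..<1})"
        by (intro measurable_restrict_space3 measurable_completion) auto
      ultimately have "(\<lambda>r. \<psi> ((1 + r) / 2)) \<in> borel_measurable unit_lebesgue" by (rule measurable_compose[rotated])
      then show "(\<lambda>r. ennreal (\<psi> ((1 + r) / 2))) \<in> borel_measurable radial_measure"
        by (simp cong: measurable_cong_sets add: sets_radial)
    qed
    also have "\<dots> \<le> ennreal (2 * K) * (ennreal C * (\<integral>\<^sup>+r. ennreal (\<psi> r) \<partial>radial_measure))"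
      using C by (intro mult_left_mono doubling_transfer mono) auto
    also have "\<dots> \<le> ennreal (2 * K) * (ennreal C * (\<integral>\<^sup>+r. ennreal (2 * r * mean_pow p f r) \<partial>radial_measure))"
    proof (intro mult_left_mono nn_integral_mono ennreal_leI)
      fix r assume "r \<in> space radial_measure"
      then show "\<psi> r \<le> 2 * r * mean_pow p f r"
        using mult_right_mono[of 1 "2 * r" "mean_pow p f r"] by (auto simp: \<psi>_def mean_pow_nonneg)
    qed auto
    also have "\<dots> = ennreal ((B * Lp_norm p w f) powr p)"
      unfolding f(1) using K C p Lp_norm_nonneg by (simp add: B_def powr_mult powr_powr ennreal_mult'[symmetric] mult.assoc)
    finally show ?thesis
      using Lp_norm_nonneg p by (intro conjI V.bergmanI fk) (auto simp: B_def)
  qed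
  obtain Kj where Kj: "\<And>j f. f \<in> bergman_space p w \<Longrightarrow> norm ((deriv ^^ j) f 0) \<le> Kj j * Lp_norm p w f"
    using deriv_at_0_bound[OF p] by metis
  show ?thesis unfolding bounded_between_def
  proof (intro exI ballI conjI)
    fix f assume fb: "f \<in> bergman_space p w"
    then show "f \<in> dirichlet_space p w k"
      using main[OF fb] bergman_integral(2)[OF p fb] by (simp add: dirichlet_space_def)
    have "dirichlet_norm p w k f \<le> B * Lp_norm p w f + (\<Sum>j=0..k. Kj j * Lp_norm p w f)"
      unfolding dirichlet_norm_def using main[OF fb] Kj[OF fb] by (intro add_mono sum_mono) auto
    then show "dirichlet_norm p w k f \<le> (B + (\<Sum>j=0..k. Kj j)) * Lp_norm p w f"
      by (simp add: distrib_right sum_distrib_right)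
  qed
qed

end

section \<open>Necessity of doubling by testing on monomials\<close>

lemma one_minus_ge_exp:
  fixes x :: real assumes "0 \<le> x" "x \<le> 1/2" shows "exp (- 2 * x) \<le> 1 - x"
proof -
  have "1 \<le> (1 - x) * (1 + 2 * x)"
    using assms mult_nonneg_nonneg[of x "1 - 2 * x"] by (simp add: algebra_simps)
  also have "\<dots> \<le> (1 - x) * exp (2 * x)" using assms by (intro mult_left_mono exp_ge_add_one_self) auto
  finally show ?thesis by (simp add: exp_minus field_simps)
qed

context positive_weight begin

lemma mean_pow_power:
  assumes "0 \<le> r" shows "mean_pow p (\<lambda>z. c * z ^ n) r = norm c powr p * (r powr p) ^ n"
proof -
  have pw: "(r ^ n) powr p = (r powr p) ^ n" by (induction n) (auto simp: powr_mult)
  have "mean_pow p (\<lambda>z. c * z ^ n) r = (\<integral>u. norm c powr p * (r powr p) ^ n \<partial>arc_measure)"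
    unfolding mean_pow_def using assms
    by (intro Bochner_Integration.integral_cong) (auto simp: norm_mult norm_power circle_norm powr_mult pw power_mult_distrib)
  then show ?thesis by simp
qed

lemma r_powr_power:
  assumes "0 \<le> r" "0 < p" shows "r * (r powr p) ^ n = r powr (real n * p + 1)"
proof (cases "r = 0")
  case False
  then have "(r powr p) ^ n = r powr (real n * p)"
    using assms by (simp add: powr_power mult.commute)
  then show ?thesis using False assms by (simp add: powr_add mult.commute)
qed simp

lemma power_in_bergman:
  assumes p: "1 < p"
  shows "(\<lambda>z. z ^ n) \<in> bergman_space p w"
    and "Lp_norm p w (\<lambda>z. z ^ n) = (2 * weight_moment w (real n * p + 1)) powr (1 / p)"
proof -
  have hol: "(\<lambda>z::complex. z ^ n) holomorphic_on disc" by (intro holomorphic_intros)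
  have eq: "2 * r * mean_pow p (\<lambda>z. z ^ n) r = 2 * (r powr (real n * p + 1))" if "r \<in> space radial_measure" for r
    using that mean_pow_power[of r p 1 n] r_powr_power[of r p n] p by simp
  have "integrable radial_measure (\<lambda>r. 2 * r * mean_pow p (\<lambda>z. z ^ n) r)"
    using p by (subst Bochner_Integration.integrable_cong[OF refl eq]) (auto intro!: integrable_powr_radial)
  then show "(\<lambda>z. z ^ n) \<in> bergman_space p w" using bergman_iff(1)[OF p hol] by simp
  have "(\<integral>r. 2 * r * mean_pow p (\<lambda>z. z ^ n) r \<partial>radial_measure) = (\<integral>r. 2 * (r powr (real n * p + 1)) \<partial>radial_measure)"
    by (intro Bochner_Integration.integral_cong eq refl)
  also have "\<dots> = 2 * weight_moment w (real n * p + 1)" by (simp add: moment_radial)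
  finally show "Lp_norm p w (\<lambda>z. z ^ n) = (2 * weight_moment w (real n * p + 1)) powr (1 / p)"
    using bergman_iff(2)[OF p hol] by simp
qed

text \<open>Each of the k factors n, n - 1, ..., n - k + 1 is at least n / 2 once n is at least
  2k.\<close>

lemma higher_deriv_power_lower:
  assumes "2 * k \<le> n"
  shows "\<exists>c. (real n / 2) ^ k \<le> norm c \<and> (deriv ^^ k) (\<lambda>z. z ^ n) = (\<lambda>z::complex. c * z ^ (n - k))"
proof -
  define c where "c = (pochhammer (of_nat (Suc n - k)) k :: complex)"
  have "(deriv ^^ k) (\<lambda>z. z ^ n) = (\<lambda>z::complex. c * z ^ (n - k))"
    using higher_deriv_power[of k 0 n] by (auto simp: c_def)
  moreover have "(real n / 2) ^ k \<le> norm c"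
  proof -
    have "c = (\<Prod>i<k. complex_of_real (real (Suc n - k) + real i))"
      by (simp add: c_def pochhammer_prod lessThan_atLeast0)
    then have "norm c = (\<Prod>i<k. real (Suc n - k) + real i)"
      by (simp add: prod_norm[symmetric] del: of_real_add)
    moreover have "(\<Prod>i<k. real n / 2) \<le> (\<Prod>i<k. real (Suc n - k) + real i)"
      using assms by (intro prod_mono) auto
    ultimately show ?thesis by simp
  qed
  ultimately show ?thesis by blast
qed

text \<open>The hypothesis \<open>test\<close> forces at least half of the mass of \<open>r powr (n * p + 1)\<close> to sit within
  distance \<open>K / n\<close> of 1, where \<open>r ^ n\<close> is bounded below.\<close>
lemma upper_doubling_from_moments:
  assumes p: "1 < p" and k: "1 \<le> k" and D: "0 < D"
    and test: "\<And>n. 2 * k \<le> n \<Longrightarrow> (real n / 2) powr (real k * p) * (\<integral>r. (1 - r) powr (real k * p) * r powr (real n * p + 1) \<partial>radial_measure)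
      \<le> D * weight_moment w (real n * p + 1)"
  shows "upper_doubling w"
proof -
  let ?\<beta> = "real k * p" and ?M = "\<lambda>n. weight_moment w (real n * p + 1)"
  have \<beta>: "0 < ?\<beta>" using p k by simp
  \<comment> \<open>Away from 1 by more than K / n the hypothesis bounds the mass by
    \<open>D / (K/2)^\<beta>\<close> times the moment; this K makes that at most one half.\<close>
  define K where "K = max 1 (2 * (2 * D) powr (1 / ?\<beta>))"
  have K1: "1 \<le> K" by (simp add: K_def)
  have KD: "2 * D \<le> (K / 2) powr ?\<beta>"
  proof -
    have "2 * D = ((2 * D) powr (1 / ?\<beta>)) powr ?\<beta>" using \<beta> D p k by (simp add: powr_powr)
    also have "\<dots> \<le> (K / 2) powr ?\<beta>" using \<beta> by (intro powr_mono2) (auto simp: K_def)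
    finally show ?thesis .
  qed
  have mint: "integrable radial_measure (\<lambda>r. r powr (real n * p + 1))" for n
    using p by (intro integrable_powr_radial) auto
  have half: "?M n \<le> 2 * (\<integral>r. indicator {1 - K / real n..<1} r * r powr (real n * p + 1) \<partial>radial_measure)"
    if n: "2 * k \<le> n" "K \<le> real n" for n
  proof -
    have n0: "0 < real n" using n K1 by linarith
    define a where "a = 1 - K / real n"
    have a: "0 \<le> a" "a < 1" using n K1 n0 by (auto simp: a_def field_simps)
    let ?I = "\<lambda>r. indicator {a..<1} r * r powr (real n * p + 1)"
    have intI: "integrable radial_measure ?I"
      using mint[of n] a interval_sets_radial(1)[of a]
        Bochner_Integration.integrable_real_mult_indicator[OF interval_sets_radial(1)[of a] mint[of n]]
      by (simp add: mult.commute)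
    have intb: "integrable radial_measure (\<lambda>r. (1 - r) powr ?\<beta> * r powr (real n * p + 1))"
      using p by (intro rad.integrable_const_bound[where B=1] borel_radial AE_I2)
        (auto simp: abs_mult intro!: mult_le_one powr_le1)
    have "?M n = (\<integral>r. r powr (real n * p + 1) \<partial>radial_measure)" by (simp add: moment_radial)
    also have "\<dots> \<le> (\<integral>r. ?I r + (real n / K) powr ?\<beta> * ((1 - r) powr ?\<beta> * r powr (real n * p + 1)) \<partial>radial_measure)"
    proof (intro integral_mono mint Bochner_Integration.integrable_add intI integrable_mult_right intb)
      fix r assume "r \<in> space radial_measure"
      then have r: "0 \<le> r" "r < 1" by auto
      show "r powr (real n * p + 1) \<le> ?I r + (real n / K) powr ?\<beta> * ((1 - r) powr ?\<beta> * r powr (real n * p + 1))"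
      proof (cases "a \<le> r")
        case False
        then have "1 \<le> real n / K * (1 - r)" using n0 K1 by (simp add: a_def field_simps)
        then have "1 \<le> (real n / K * (1 - r)) powr ?\<beta>" using \<beta> by (intro ge_one_powr_ge_zero) auto
        also have "\<dots> = (real n / K) powr ?\<beta> * (1 - r) powr ?\<beta>" by (rule powr_mult)
        finally have "1 * r powr (real n * p + 1) \<le> ((real n / K) powr ?\<beta> * (1 - r) powr ?\<beta>) * r powr (real n * p + 1)"
          by (intro mult_right_mono) auto
        then show ?thesis using False by (simp add: mult.assoc)
      qed (use r in auto)
    qed
    also have "\<dots> = (\<integral>r. ?I r \<partial>radial_measure) + (real n / K) powr ?\<beta> * (\<integral>r. (1 - r) powr ?\<beta> * r powr (real n * p + 1) \<partial>radial_measure)"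
      using intI intb by simp
    also have "(real n / K) powr ?\<beta> * (\<integral>r. (1 - r) powr ?\<beta> * r powr (real n * p + 1) \<partial>radial_measure) \<le> ?M n / 2"
    proof -
      have "(real n / K) powr ?\<beta> * (K / 2) powr ?\<beta> = (real n / 2) powr ?\<beta>"
        using K1 by (simp flip: powr_mult)
      then have "(real n / K) powr ?\<beta> = (real n / 2) powr ?\<beta> / (K / 2) powr ?\<beta>"
        using K1 by (simp add: field_simps)
      then have "(real n / K) powr ?\<beta> * (\<integral>r. (1 - r) powr ?\<beta> * r powr (real n * p + 1) \<partial>radial_measure)
        = ((real n / 2) powr ?\<beta> * (\<integral>r. (1 - r) powr ?\<beta> * r powr (real n * p + 1) \<partial>radial_measure)) / (K / 2) powr ?\<beta>"
        by simp
      also have "\<dots> \<le> (D * ?M n) / (K / 2) powr ?\<beta>"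
        using test[OF n(1)] by (intro divide_right_mono) auto
      also have "\<dots> \<le> (D * ?M n) / (2 * D)"
      proof (rule divide_left_mono[OF KD])
        show "0 \<le> D * ?M n" using D moment_nonneg by simp
        show "0 < (K / 2) powr ?\<beta> * (2 * D)" using K1 D by simp
      qed
      also have "\<dots> = ?M n / 2" using D by simp
      finally show ?thesis .
    qed
    finally show ?thesis unfolding a_def by simp
  qed
  \<comment> \<open>The 2 comes from \<open>half\<close>; the exponential is the price for inserting
    \<open>r^(np)\<close> on \<open>r \<ge> 1 - K/n\<close>, by
    \<open>1 - x \<ge> exp (-2x)\<close>.\<close>
  define B where "B = 2 * exp (2 * K * p)"
  have "0 \<le> 2 * K * p" using K1 p by simp
  then have "1 \<le> exp (2 * K * p)" by (simp only: one_le_exp_iff)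
  then have B1: "1 \<le> B" unfolding B_def by linarith
  \<comment> \<open>From N on the hypothesis is available and K / n is at most 1/2, as the
    exponential bound requires.\<close>
  define N where "N = max (2 * k) (nat \<lceil>2 * K\<rceil>)"
  have N: "2 * k \<le> N" "2 * K \<le> real N" by (auto simp: N_def) linarith
  have N0: "0 < N" using N(1) k by auto
  have double: "?M n \<le> B * ?M (2 * n)" if n: "N \<le> n" for n
  proof -
    have n': "2 * k \<le> n" "2 * K \<le> real n" "0 < real n" using n N N0 by auto
    define a where "a = 1 - K / real n"
    have Kn: "0 \<le> K / real n" "K / real n \<le> 1/2" using n' K1 by (auto simp: field_simps)
    have "?M n \<le> 2 * (\<integral>r. indicator {a..<1} r * r powr (real n * p + 1) \<partial>radial_measure)"
      using half[of n] n' K1 unfolding a_def by simp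
    also have "\<dots> \<le> 2 * (\<integral>r. exp (2 * K * p) * r powr (real (2 * n) * p + 1) \<partial>radial_measure)"
    proof (intro mult_left_mono integral_mono' integrable_mult_right mint)
      fix r assume "r \<in> space radial_measure"
      then have r: "0 \<le> r" "r < 1" by auto
      show "indicator {a..<1} r * r powr (real n * p + 1) \<le> exp (2 * K * p) * r powr (real (2 * n) * p + 1)"
      proof (cases "a \<le> r")
        case True
        have "exp (- 2 * (K / real n)) \<le> r" using one_minus_ge_exp[OF Kn] True unfolding a_def by linarith
        then have "exp (- 2 * (K / real n)) powr (real n * p) \<le> r powr (real n * p)"
          using p by (intro powr_mono2) auto
        moreover have "exp (- 2 * (K / real n)) powr (real n * p) = exp (- (2 * K * p))"
          using n' by (simp add: powr_def)
        ultimately have "exp (- (2 * K * p)) \<le> r powr (real n * p)" by simp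
        then have "exp (2 * K * p) * exp (- (2 * K * p)) \<le> exp (2 * K * p) * r powr (real n * p)"
          by (intro mult_left_mono) auto
        then have "1 \<le> exp (2 * K * p) * r powr (real n * p)"
          by (simp only: exp_add[symmetric] add.right_inverse exp_zero)
        then have "1 * r powr (real n * p + 1) \<le> (exp (2 * K * p) * r powr (real n * p)) * r powr (real n * p + 1)"
          by (intro mult_right_mono) auto
        also have "\<dots> = exp (2 * K * p) * r powr (real (2 * n) * p + 1)"
          by (simp add: mult.assoc powr_add[symmetric]) (simp add: algebra_simps)
        finally show ?thesis using True r by simp
      qed auto
    qed auto
    also have "\<dots> = B * ?M (2 * n)" by (simp add: B_def moment_radial)
    finally show ?thesis .
  qed
  have iter: "?M n \<le> B ^ m * ?M (2 ^ m * n)" if n: "N \<le> n" for m n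
  proof (induction m)
    case (Suc m)
    have "N \<le> 2 ^ m * n" using n by (rule order_trans) simp
    then have "B ^ m * ?M (2 ^ m * n) \<le> B ^ m * (B * ?M (2 * (2 ^ m * n)))"
      using B1 by (intro mult_left_mono double) auto
    with Suc show ?case by (simp add: mult_ac)
  qed simp
  \<comment> \<open>After m doublings of an exponent n of size at least 1 / (1 - r), half of the
    moment sits within (1 - r) / 2 of 1, that is, beyond (1 + r) / 2.\<close>
  obtain m where m: "2 * K \<le> 2 ^ m" using real_arch_pow[of 2 "2 * K"] by (auto intro: less_imp_le)
  have near: "weight_tail w r \<le> (exp (4 * p + 2) * (B ^ m * 2)) * weight_tail w ((1 + r) / 2)"
    if r: "0 \<le> r" "r < 1" "real N * (1 - r) \<le> 1" for r
  proof -
    \<comment> \<open>With n about 1 / (1 - r), \<open>r^(np+1)\<close> is bounded below, so the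
      tail at r is dominated by the moment of this order.\<close>
    define n where "n = nat \<lceil>1 / (1 - r)\<rceil>"
    have pos: "0 < 1 - r" "1 \<le> 1 / (1 - r)" using r by auto
    have n1: "1 / (1 - r) \<le> real n" unfolding n_def by linarith
    have n2: "real n \<le> 1 / (1 - r) + 1" unfolding n_def using pos(2) by linarith
    have "real N \<le> 1 / (1 - r)" using r pos by (simp add: field_simps)
    then have nN: "N \<le> n" using n1 by linarith
    have rn: "(1 - r) * real n \<le> 2"
    proof -
      have "(1 - r) * real n \<le> (1 - r) * (1 / (1 - r) + 1)" using n2 pos by (intro mult_left_mono) auto
      also have "\<dots> = 1 + (1 - r)" using pos by (simp add: field_simps)
      finally show ?thesis using r by simp
    qed
    have rn1: "1 \<le> (1 - r) * real n" using n1 pos by (simp add: field_simps)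
    have "2 \<le> N" using N(1) k by linarith
    then have "1 - r \<le> 1 / 2" using r(3) pos mult_right_mono[of 2 "real N" "1 - r"] by simp
    then have "exp (- 2 * (1 - r)) \<le> r" using one_minus_ge_exp[of "1 - r"] pos by simp
    then have "exp (- 2 * (1 - r)) powr (real n * p + 1) \<le> r powr (real n * p + 1)"
      using p by (intro powr_mono2) auto
    moreover have "exp (- (4 * p + 2)) \<le> exp (- 2 * (1 - r)) powr (real n * p + 1)"
    proof -
      have "2 * ((1 - r) * real n) * p + 2 * (1 - r) \<le> 2 * 2 * p + 2 * 1"
        using rn p r by (intro add_mono mult_mono) auto
      then have "- (4 * p + 2) \<le> (real n * p + 1) * (- 2 * (1 - r))"
        by (simp add: algebra_simps)
      then show ?thesis by (simp add: powr_def)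
    qed
    ultimately have "exp (- (4 * p + 2)) * weight_tail w r \<le> r powr (real n * p + 1) * weight_tail w r"
      using tail_nonneg[OF r(1)] by (intro mult_right_mono) auto
    also have "\<dots> \<le> ?M n" using r p by (intro moment_ge_tail) auto
    also have "\<dots> \<le> B ^ m * ?M (2 ^ m * n)" by (rule iter[OF nN])
    also have "?M (2 ^ m * n) \<le> 2 * weight_tail w ((1 + r) / 2)"
    proof -
      let ?n = "2 ^ m * n"
      have nn: "N \<le> ?n" using nN by (rule order_trans) simp
      define a where "a = 1 - K / real ?n"
      have npos: "0 < real n" using nN N0 by simp
      have "K / real ?n \<le> (1 - r) / 2"
      proof -
        have "2 * K * 1 \<le> 2 ^ m * ((1 - r) * real n)" using m rn1 K1 by (intro mult_mono) auto
        then show ?thesis using npos by (simp add: field_simps)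
      qed
      then have a: "(1 + r) / 2 \<le> a" by (simp add: a_def field_simps)
      have "2 * K \<le> real ?n" using nn N(2) by (intro order_trans[OF N(2)] of_nat_mono)
      then have "?M ?n \<le> 2 * (\<integral>s. indicator {a..<1} s * s powr (real ?n * p + 1) \<partial>radial_measure)"
        unfolding a_def using nn N(1) K1 by (intro half) auto
      also have "(\<integral>s. indicator {a..<1} s * s powr (real ?n * p + 1) \<partial>radial_measure) \<le> (\<integral>s. indicator {(1 + r) / 2..<1} s \<partial>radial_measure)"
      proof (rule integral_mono')
        show "integrable radial_measure (indicat_real {(1 + r) / 2..<1})"
          using r interval_sets_radial(1)[of "(1 + r) / 2"] by (intro integrable_real_indicator) (auto simp: less_top[symmetric])
        fix s assume "s \<in> space radial_measure"
        then show "indicator {a..<1} s * s powr (real ?n * p + 1) \<le> indicat_real {(1 + r) / 2..<1} s"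
          using a p by (auto simp: indicator_def intro!: powr_le1)
      qed auto
      also have "\<dots> = weight_tail w ((1 + r) / 2)"
        using r Bochner_Integration.integral_indicator[of radial_measure "{(1 + r) / 2..<1}"] by (simp add: tail_radial Int_absorb2)
      finally show ?thesis by simp
    qed
    finally have "exp (- (4 * p + 2)) * weight_tail w r \<le> B ^ m * (2 * weight_tail w ((1 + r) / 2))"
      using B1 by (simp add: mult_left_mono)
    then have "exp (4 * p + 2) * (exp (- (4 * p + 2)) * weight_tail w r) \<le> exp (4 * p + 2) * (B ^ m * (2 * weight_tail w ((1 + r) / 2)))"
      by (intro mult_left_mono) auto
    then show ?thesis by (simp add: mult.assoc[symmetric] exp_add[symmetric])
  qed
  \<comment> \<open>For r bounded away from 1 doubling is trivial: the tail at (1 + r) / 2 is at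
    least T, and the tail at r is at most the full mass.\<close>
  define T where "T = weight_tail w (1 - 1 / (2 * real N))"
  have T: "0 < T" unfolding T_def using N0 by (intro tail_pos) auto
  have far: "weight_tail w r \<le> (weight_tail w 0 / T) * weight_tail w ((1 + r) / 2)"
    if r: "0 \<le> r" "r < 1" "1 < real N * (1 - r)" for r
  proof -
    have "(1 + r) / 2 \<le> 1 - 1 / (2 * real N)" using r N0 by (simp add: field_simps)
    then have "T \<le> weight_tail w ((1 + r) / 2)" unfolding T_def using r by (intro tail_antimono) auto
    then have "(weight_tail w 0 / T) * T \<le> (weight_tail w 0 / T) * weight_tail w ((1 + r) / 2)"
      using T tail_nonneg[of 0] by (intro mult_left_mono) auto
    moreover have "weight_tail w r \<le> weight_tail w 0" using r by (intro tail_antimono) auto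
    ultimately show ?thesis using T by simp
  qed
  define C where "C = max 1 (max (exp (4 * p + 2) * (B ^ m * 2)) (weight_tail w 0 / T))"
  have "weight_tail w r \<le> C * weight_tail w ((1 + r) / 2)" if r: "0 \<le> r" "r < 1" for r
  proof -
    have t: "0 \<le> weight_tail w ((1 + r) / 2)" using r by (intro tail_nonneg) auto
    show ?thesis
    proof (cases "real N * (1 - r) \<le> 1")
      case True
      from near[OF r True] show ?thesis by (rule order_trans) (intro mult_right_mono t, simp add: C_def)
    next
      case False
      then have "1 < real N * (1 - r)" by simp
      from far[OF r this] show ?thesis by (rule order_trans) (intro mult_right_mono t, simp add: C_def)
    qed
  qed
  moreover have "1 \<le> C" by (simp add: C_def)
  ultimately show ?thesis unfolding upper_doubling_def by auto
qed

theorem identity_bounded_imp_doubling: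
  assumes p: "1 < p" and k: "1 \<le> k"
    and bdd: "bounded_between (bergman_space p w) (Lp_norm p w) (dirichlet_space p w k) (dirichlet_norm p w k) (\<lambda>f. f)"
  shows "upper_doubling w"
proof -
  obtain C0 where C0: "\<And>f. f \<in> bergman_space p w \<Longrightarrow> f \<in> dirichlet_space p w k"
    "\<And>f. f \<in> bergman_space p w \<Longrightarrow> dirichlet_norm p w k f \<le> C0 * Lp_norm p w f"
    using bdd unfolding bounded_between_def by blast
  \<comment> \<open>The constant in the boundedness hypothesis carries no sign, but the moment test
    needs a positive one.\<close>
  define C where "C = max 1 C0"
  have C: "1 \<le> C" by (simp add: C_def)
  have Cb: "dirichlet_norm p w k f \<le> C * Lp_norm p w f" if "f \<in> bergman_space p w" for f
    using C0(2)[OF that] by (rule order_trans) (intro mult_right_mono Lp_norm_nonneg, simp add: C_def)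
  let ?\<beta> = "real k * p"
  let ?v = "weight_times_dist w ?\<beta>"
  interpret V: weight ?v using p by (intro weight_times_dist) auto
  show ?thesis
  proof (rule upper_doubling_from_moments[OF p k])
    show "0 < C powr p" using C by simp
    fix n assume n: "2 * k \<le> n"
    let ?f = "\<lambda>z::complex. z ^ n"
    obtain c where c: "(real n / 2) ^ k \<le> norm c" "(deriv ^^ k) ?f = (\<lambda>z. c * z ^ (n - k))"
      using higher_deriv_power_lower[OF n] by blast
    have fb: "?f \<in> bergman_space p w" by (rule power_in_bergman(1)[OF p])
    have gb: "(deriv ^^ k) ?f \<in> bergman_space p ?v" using C0(1)[OF fb] by (simp add: dirichlet_space_def)
    have "0 \<le> (\<Sum>j=0..k. norm ((deriv ^^ j) ?f 0))" by (intro sum_nonneg) auto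
    then have "Lp_norm p ?v ((deriv ^^ k) ?f) \<le> C * Lp_norm p w ?f"
      using Cb[OF fb] unfolding dirichlet_norm_def by linarith
    then have "Lp_norm p ?v ((deriv ^^ k) ?f) powr p \<le> (C * Lp_norm p w ?f) powr p"
      using p V.Lp_norm_nonneg by (intro powr_mono2) auto
    also have "\<dots> = C powr p * (2 * weight_moment w (real n * p + 1))"
      unfolding power_in_bergman(2)[OF p] using p C moment_nonneg by (simp add: powr_mult powr_powr)
    finally have up: "Lp_norm p ?v ((deriv ^^ k) ?f) powr p \<le> C powr p * (2 * weight_moment w (real n * p + 1))" .
    have hol: "(\<lambda>z::complex. c * z ^ (n - k)) holomorphic_on disc" by (intro holomorphic_intros)
    have [measurable]: "(\<lambda>r::real. r) \<in> borel_measurable unit_lebesgue" by (intro borel_unit_lebesgue) simp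
    have mp: "(\<lambda>r. ennreal (2 * r * mean_pow p (\<lambda>z. c * z ^ (n - k)) r)) \<in> borel_measurable unit_lebesgue"
      by (intro measurable_compose[OF _ measurable_ennreal] borel_measurable_times borel_measurable_const mean_pow_measurable(1)[OF p hol]) measurable
    have intb: "integrable radial_measure (\<lambda>r. (1 - r) powr ?\<beta> * r powr (real n * p + 1))"
      using p by (intro rad.integrable_const_bound[where B=1] borel_radial AE_I2)
        (auto simp: abs_mult intro!: mult_le_one powr_le1)
    let ?A = "(real n / 2) powr ?\<beta>"
    have "ennreal (2 * (?A * (\<integral>r. (1 - r) powr ?\<beta> * r powr (real n * p + 1) \<partial>radial_measure)))
       = ennreal (\<integral>r. 2 * ?A * ((1 - r) powr ?\<beta> * r powr (real n * p + 1)) \<partial>radial_measure)" by simp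
    also have "\<dots> = (\<integral>\<^sup>+r. ennreal (2 * ?A * ((1 - r) powr ?\<beta> * r powr (real n * p + 1))) \<partial>radial_measure)"
      by (intro nn_integral_eq_integral[symmetric] integrable_mult_right intb) auto
    also have "\<dots> \<le> (\<integral>\<^sup>+r. ennreal ((1 - r) powr ?\<beta>) * ennreal (2 * r * mean_pow p (\<lambda>z. c * z ^ (n - k)) r) \<partial>radial_measure)"
    proof (rule nn_integral_mono)
      fix r assume "r \<in> space radial_measure"
      then have r: "0 \<le> r" "r < 1" by auto
      have "?A = ((real n / 2) ^ k) powr p"
        using n k by (simp add: powr_powr[symmetric] powr_realpow)
      also have "\<dots> \<le> norm c powr p" using c p by (intro powr_mono2) auto
      finally have A: "?A \<le> norm c powr p" .
      \<comment> \<open>Differentiating lowers the exponent to n - k, which only increases the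
        integrand since r < 1; the original exponent can be restored.\<close>
      have "r powr (real n * p + 1) \<le> r powr (real (n - k) * p + 1)"
        using r p by (intro powr_mono') auto
      then have "?A * r powr (real n * p + 1) \<le> norm c powr p * r powr (real (n - k) * p + 1)"
        using A by (intro mult_mono) auto
      also have "\<dots> = r * mean_pow p (\<lambda>z. c * z ^ (n - k)) r"
        using r p r_powr_power[of r p "n - k"] by (simp add: mean_pow_power mult_ac)
      finally have "(2 * (1 - r) powr ?\<beta>) * (?A * r powr (real n * p + 1)) \<le> (2 * (1 - r) powr ?\<beta>) * (r * mean_pow p (\<lambda>z. c * z ^ (n - k)) r)"
        by (intro mult_left_mono) auto
      then have "ennreal (2 * ?A * ((1 - r) powr ?\<beta> * r powr (real n * p + 1))) \<le> ennreal ((1 - r) powr ?\<beta> * (2 * r * mean_pow p (\<lambda>z. c * z ^ (n - k)) r))"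
        by (intro ennreal_leI) (simp add: mult_ac)
      then show "ennreal (2 * ?A * ((1 - r) powr ?\<beta> * r powr (real n * p + 1))) \<le> ennreal ((1 - r) powr ?\<beta>) * ennreal (2 * r * mean_pow p (\<lambda>z. c * z ^ (n - k)) r)"
        by (simp add: ennreal_mult')
    qed
    also have "\<dots> = (\<integral>\<^sup>+r. ennreal (2 * r * mean_pow p (\<lambda>z. c * z ^ (n - k)) r) \<partial>V.radial_measure)"
      using p mp by (intro nn_integral_weight_times_dist[symmetric]) auto
    also have "\<dots> = ennreal (Lp_norm p ?v ((deriv ^^ k) ?f) powr p)"
      using V.bergman_integral(1)[OF p gb] unfolding c(2) .
    also have "\<dots> \<le> ennreal (C powr p * (2 * weight_moment w (real n * p + 1)))" using up by (rule ennreal_leI)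
    finally have "2 * (?A * (\<integral>r. (1 - r) powr ?\<beta> * r powr (real n * p + 1) \<partial>radial_measure)) \<le> C powr p * (2 * weight_moment w (real n * p + 1))"
      using moment_nonneg by (subst (asm) ennreal_le_iff) auto
    then show "?A * (\<integral>r. (1 - r) powr ?\<beta> * r powr (real n * p + 1) \<partial>radial_measure) \<le> C powr p * weight_moment w (real n * p + 1)"
      by simp
  qed
qed

end

section \<open>The Bergman projection\<close>

text \<open>Projections and representing functions agree on the disc but are functions on the whole
  plane. Derivatives are local on the open disc, so space and norm see only the restriction.\<close>

lemma dirichlet_cong:
  assumes f: "f holomorphic_on disc" and eq: "\<And>z. z \<in> disc \<Longrightarrow> h z = f z"
    and fk: "f \<in> dirichlet_space p w k"
  shows "h \<in> dirichlet_space p w k" "dirichlet_norm p w k h = dirichlet_norm p w k f"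
proof -
  have h: "h holomorphic_on disc" using f eq holomorphic_cong by metis
  have d: "(deriv ^^ j) h z = (deriv ^^ j) f z" if "z \<in> disc" for j z
    by (rule higher_deriv_transform_within_open[OF h f open_ball that eq])
  let ?v = "weight_times_dist w (real k * p)"
  have hk: "(deriv ^^ k) h holomorphic_on disc" using h by (intro holomorphic_higher_deriv) auto
  have eqi: "norm ((deriv ^^ k) h z) powr p * ?v (norm z) = norm ((deriv ^^ k) f z) powr p * ?v (norm z)"
    if "z \<in> space area_measure" for z using that d by simp
  have "(deriv ^^ k) f \<in> bergman_space p ?v" using fk by (simp add: dirichlet_space_def)
  then have "integrable area_measure (\<lambda>z. norm ((deriv ^^ k) h z) powr p * ?v (norm z))"
    by (subst Bochner_Integration.integrable_cong[OF refl eqi]) (auto simp: bergman_space_def Lp_space_def)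
  moreover have "(deriv ^^ k) h \<in> borel_measurable (lebesgue_on disc)"
    using hk borel_measurable_area_continuous[OF holomorphic_on_imp_continuous_on] by (simp add: measurable_area_iff)
  ultimately show "h \<in> dirichlet_space p w k"
    using h hk by (simp add: dirichlet_space_def bergman_space_def Lp_space_def)
  have "Lp_norm p ?v ((deriv ^^ k) h) = Lp_norm p ?v ((deriv ^^ k) f)"
    unfolding Lp_norm_def by (subst Bochner_Integration.integral_cong[OF refl eqi]) auto
  then show "dirichlet_norm p w k h = dirichlet_norm p w k f"
    by (simp add: dirichlet_norm_def d)
qed

context positive_weight begin

abbreviation kappa :: "nat \<Rightarrow> real" where "kappa n \<equiv> weight_moment w (2 * real n + 1)"

lemma kappa_pos: "0 < kappa n" by (intro moment_pos) auto

text \<open>Positive tails prevent the moments from decaying exponentially: each s < 1 gives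
  \<open>kappa n\<close> at least a multiple of \<open>s^(2n)\<close>. This is absolute convergence
  of the kernel series.\<close>

lemma summable_inverse_kappa:
  assumes "0 \<le> x" "x < 1" shows "summable (\<lambda>n. x ^ n / kappa n)"
proof -
  define t where "t = (1 + x) / 2"
  have t: "0 < t" "x < t" "t < 1" using assms by (auto simp: t_def)
  \<comment> \<open>Because the moment has exponent 2n + 1, the square root yields the geometric
    rate t, which still exceeds x.\<close>
  define s where "s = sqrt t"
  have s: "0 < s" "s < 1" "s ^ 2 = t" using t by (auto simp: s_def)
  have T: "0 < weight_tail w s" using s by (intro tail_pos) auto
  have "summable (\<lambda>n. (1 / (s * weight_tail w s)) * (x / t) ^ n)"
    using assms t by (intro summable_mult summable_geometric) auto
  then show ?thesis
  proof (rule summable_comparison_test'[where N = 0])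
    fix n :: nat
    have "s powr (2 * real n + 1) = s * t ^ n"
      using s powr_realpow[of s "2 * n"] by (simp add: powr_add power_mult)
    then have "s * t ^ n * weight_tail w s \<le> kappa n"
      using moment_ge_tail[of s "2 * real n + 1"] s by simp
    then have "x ^ n / kappa n \<le> x ^ n / (s * t ^ n * weight_tail w s)"
      using assms s t T kappa_pos by (intro divide_left_mono) (auto intro!: mult_pos_pos)
    also have "\<dots> = (1 / (s * weight_tail w s)) * (x / t) ^ n" by (simp add: power_divide)
    finally show "norm (x ^ n / kappa n) \<le> (1 / (s * weight_tail w s)) * (x / t) ^ n"
      using assms kappa_pos[of n] by simp
  qed
qed

lemma nonneg_on_disc: "z \<in> space area_measure \<Longrightarrow> 0 \<le> w (norm z)"
  by (auto intro: w_nonneg)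

lemma Lp_measurable: "f \<in> Lp_space p w \<Longrightarrow> f \<in> borel_measurable area_measure"
  by (simp add: Lp_space_def measurable_area_iff)

text \<open>The weight is split as \<open>w^(1/p) w^(1/q)\<close> over plain area, because members
  of \<open>Lp_space\<close> are Lebesgue measurable while \<open>disc_measure\<close> has only
  Borel sets.\<close>

lemma Hoelder_disc:
  assumes pq: "1 < p" "1 / p + 1 / q = 1" and f: "f \<in> Lp_space p w" and g: "g \<in> Lp_space q w"
  shows "integrable area_measure (\<lambda>z. f z * g z * of_real (w (norm z)))"
    and "norm (\<integral>z. f z * g z * of_real (w (norm z)) \<partial>area_measure) \<le> Lp_norm p w f * Lp_norm q w g"
proof -
  note q = conjugate_exponent[OF pq]
  note [measurable] = Lp_measurable[OF f] Lp_measurable[OF g]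
  let ?F = "\<lambda>z. norm (f z) * w (norm z) powr (1 / p)" and ?G = "\<lambda>z. norm (g z) * w (norm z) powr (1 / q)"
  have Fp: "?F z powr p = norm (f z) powr p * w (norm z)" if "z \<in> space area_measure" for z
    using nonneg_on_disc[OF that] pq(1) by (simp add: powr_mult powr_powr)
  have Gq: "?G z powr q = norm (g z) powr q * w (norm z)" if "z \<in> space area_measure" for z
    using nonneg_on_disc[OF that] q(1) by (simp add: powr_mult powr_powr)
  have FG: "?F z * ?G z = norm (f z * g z * of_real (w (norm z)))" if "z \<in> space area_measure" for z
  proof -
    have "w (norm z) powr (1 / p) * w (norm z) powr (1 / q) = w (norm z)"
      using nonneg_on_disc[OF that] pq by (simp flip: powr_add)
    then have "?F z * ?G z = norm (f z) * norm (g z) * w (norm z)" by (simp add: mult_ac)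
    then show ?thesis using nonneg_on_disc[OF that] by (simp add: norm_mult)
  qed
  have intF: "integrable area_measure (\<lambda>z. ?F z powr p)"
    using f by (subst Bochner_Integration.integrable_cong[OF refl Fp]) (auto simp: Lp_space_def)
  have intG: "integrable area_measure (\<lambda>z. ?G z powr q)"
    using g by (subst Bochner_Integration.integrable_cong[OF refl Gq]) (auto simp: Lp_space_def)
  have H: "integrable area_measure (\<lambda>z. ?F z * ?G z)"
    "(\<integral>z. ?F z * ?G z \<partial>area_measure) \<le> (\<integral>z. ?F z powr p \<partial>area_measure) powr (1 / p) * (\<integral>z. ?G z powr q \<partial>area_measure) powr (1 / q)"
    by (intro Hoelder_inequality[OF pq _ _ _ _ intF intG]; simp)+
  have n: "integrable area_measure (\<lambda>z. norm (f z * g z * of_real (w (norm z))))"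
    using H(1) by (subst Bochner_Integration.integrable_cong[OF refl FG[symmetric]]) auto
  then show "integrable area_measure (\<lambda>z. f z * g z * of_real (w (norm z)))"
    by (rule integrable_norm_cancel) measurable
  have "norm (\<integral>z. f z * g z * of_real (w (norm z)) \<partial>area_measure) \<le> (\<integral>z. norm (f z * g z * of_real (w (norm z))) \<partial>area_measure)"
    by (rule integral_norm_bound)
  also have "\<dots> = (\<integral>z. ?F z * ?G z \<partial>area_measure)"
    by (intro Bochner_Integration.integral_cong refl FG[symmetric])
  also note H(2)
  also have "(\<integral>z. ?F z powr p \<partial>area_measure) = (\<integral>z. norm (f z) powr p * w (norm z) \<partial>area_measure)"
    by (intro Bochner_Integration.integral_cong refl Fp)
  also have "(\<integral>z. ?G z powr q \<partial>area_measure) = (\<integral>z. norm (g z) powr q * w (norm z) \<partial>area_measure)"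
    by (intro Bochner_Integration.integral_cong refl Gq)
  finally show "norm (\<integral>z. f z * g z * of_real (w (norm z)) \<partial>area_measure) \<le> Lp_norm p w f * Lp_norm q w g"
    by (simp add: Lp_norm_def)
qed

lemma Lp_cnj: "f \<in> Lp_space p w \<Longrightarrow> (\<lambda>z. cnj (f z)) \<in> Lp_space p w" "Lp_norm p w (\<lambda>z. cnj (f z)) = Lp_norm p w f"
proof -
  have c: "cnj \<in> borel_measurable borel" by (intro borel_measurable_continuous_onI continuous_intros)
  show "(\<lambda>z. cnj (f z)) \<in> Lp_space p w" if "f \<in> Lp_space p w"
    using that by (auto simp: Lp_space_def intro: measurable_compose[OF _ c])
  show "Lp_norm p w (\<lambda>z. cnj (f z)) = Lp_norm p w f" by (simp add: Lp_norm_def)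
qed

lemma bergman_Lp: "f \<in> bergman_space p w \<Longrightarrow> f \<in> Lp_space p w" by (simp add: bergman_space_def)

text \<open>Puts constants and dilations into the space, and turns uniform convergence of Taylor
  sums into norm convergence in \<open>dual_dilation\<close>.\<close>

lemma bergman_bounded:
  assumes p: "1 < p" and f: "f holomorphic_on disc" and B: "0 \<le> B" "\<And>z. z \<in> disc \<Longrightarrow> norm (f z) \<le> B"
  shows "f \<in> bergman_space p w" "Lp_norm p w f \<le> B * (2 * kappa 0) powr (1 / p)"
proof -
  have mp: "mean_pow p f r \<le> B powr p" if r: "0 \<le> r" "r < 1" for r
  proof -
    have "mean_pow p f r \<le> (\<integral>u. B powr p \<partial>arc_measure)" unfolding mean_pow_def
      using p r holomorphic_circle_continuous[OF f, of "of_real r"] B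
      by (intro integral_mono continuous_on_circle_integrable continuous_on_powr_norm powr_mono2 continuous_on_const) (auto simp: circle_norm norm_mult)
    then show ?thesis by simp
  qed
  have "(\<integral>\<^sup>+r. ennreal (2 * r * mean_pow p f r) \<partial>radial_measure) \<le> (\<integral>\<^sup>+r. ennreal (2 * B powr p * r powr 1) \<partial>radial_measure)"
  proof (intro nn_integral_mono ennreal_leI)
    fix r assume "r \<in> space radial_measure"
    then have r: "0 \<le> r" "r < 1" by auto
    have "2 * r * mean_pow p f r \<le> 2 * r * B powr p" using r mp by (intro mult_left_mono) auto
    then show "2 * r * mean_pow p f r \<le> 2 * B powr p * r powr 1" using r by (simp add: mult_ac)
  qed
  also have "\<dots> = ennreal (2 * B powr p) * (\<integral>\<^sup>+r. ennreal (r powr 1) \<partial>radial_measure)"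
    unfolding ennreal_mult'[of "2 * B powr p", simplified] by (intro nn_integral_cmult borel_radial) auto
  also have "\<dots> = ennreal ((B * (2 * kappa 0) powr (1 / p)) powr p)"
  proof -
    have e: "(\<integral>\<^sup>+r. ennreal (r powr 1) \<partial>radial_measure) = ennreal (kappa 0)"
      using nn_integral_powr_radial[of 1] by simp
    have "(B * (2 * kappa 0) powr (1 / p)) powr p = 2 * B powr p * kappa 0"
      using p B kappa_pos[of 0] by (simp add: powr_mult powr_powr)
    then show ?thesis unfolding e by (simp add: ennreal_mult')
  qed
  finally have le: "(\<integral>\<^sup>+r. ennreal (2 * r * mean_pow p f r) \<partial>radial_measure) \<le> ennreal ((B * (2 * kappa 0) powr (1 / p)) powr p)" .
  show "f \<in> bergman_space p w" "Lp_norm p w f \<le> B * (2 * kappa 0) powr (1 / p)"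
    using B by (intro bergmanI[OF p f _ le]; simp)+
qed

lemma Lp_integrable:
  assumes p: "1 < p" and f: "f \<in> Lp_space p w"
  shows "integrable area_measure (\<lambda>z. f z * of_real (w (norm z)))"
proof -
  define q where "q = p / (p - 1)"
  have pq: "1 / p + 1 / q = 1" using p by (simp add: q_def field_simps)
  have "(\<lambda>z. 1) \<in> bergman_space q w"
    by (rule bergman_bounded(1)[of q _ 1]) (auto simp: conjugate_exponent(1)[OF p pq])
  from Hoelder_disc(1)[OF p pq f bergman_Lp[OF this]] show ?thesis by simp
qed

text \<open>For fixed z the kernel series is dominated uniformly in \<open>\<zeta>\<close> by
  \<open>|z|^n / kappa n\<close>, so it may be integrated termwise. The projection therefore depends
  on f only through the integrals of \<open>cnj \<zeta> ^ n * f \<zeta>\<close> against the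
  weight.\<close>

lemma bergman_projection_sums:
  assumes p: "1 < p" and f: "f \<in> Lp_space p w" and z: "z \<in> disc"
  shows "(\<lambda>n. z ^ n / of_real (2 * kappa n) * (\<integral>\<zeta>. cnj \<zeta> ^ n * f \<zeta> * of_real (w (norm \<zeta>)) \<partial>area_measure))
     sums bergman_projection w f z"
proof -
  have zn: "norm z < 1" using z by simp
  note [measurable] = Lp_measurable[OF f]
  let ?g = "\<lambda>n \<zeta>. (z * cnj \<zeta>) ^ n / of_real (2 * kappa n)"
  let ?F = "\<lambda>n \<zeta>. f \<zeta> * ?g n \<zeta> * of_real (w (norm \<zeta>))"
  let ?c = "\<lambda>n. norm z ^ n / kappa n"
  have sc: "summable ?c" using zn by (intro summable_inverse_kappa) auto
  have gb: "norm (?g n \<zeta>) \<le> ?c n" if "\<zeta> \<in> space area_measure" for n \<zeta>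
  proof -
    have "norm (?g n \<zeta>) = (norm z * norm \<zeta>) ^ n / (2 * kappa n)"
      using kappa_pos[of n] by (simp add: norm_divide norm_power norm_mult)
    also have "\<dots> \<le> norm z ^ n / (2 * kappa n)"
      using that kappa_pos[of n] by (intro divide_right_mono power_mono mult_right_le_one_le) auto
    also have "\<dots> \<le> ?c n" using kappa_pos[of n] by (intro divide_left_mono) auto
    finally show ?thesis .
  qed
  have intf: "integrable area_measure (\<lambda>\<zeta>. norm (f \<zeta> * of_real (w (norm \<zeta>))))"
    using Lp_integrable[OF p f] by (rule integrable_norm)
  have Fb: "norm (?F n \<zeta>) \<le> ?c n * norm (f \<zeta> * of_real (w (norm \<zeta>)))" if "\<zeta> \<in> space area_measure" for n \<zeta>
  proof -
    have "norm (?F n \<zeta>) = norm (?g n \<zeta>) * norm (f \<zeta> * of_real (w (norm \<zeta>)))" by (simp add: norm_mult mult_ac norm_divide norm_power)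
    then show ?thesis using gb[OF that] by (simp only:) (intro mult_right_mono, auto)
  qed
  have Fint: "integrable area_measure (?F n)" for n
  proof (rule Bochner_Integration.integrable_bound)
    show "integrable area_measure (\<lambda>\<zeta>. ?c n * norm (f \<zeta> * of_real (w (norm \<zeta>))))" using intf by (rule integrable_mult_right)
    have [measurable]: "?g n \<in> borel_measurable area_measure"
      by (intro borel_measurable_area_continuous continuous_intros) (use kappa_pos[of n] in auto)
    show "?F n \<in> borel_measurable area_measure" by measurable
    show "AE \<zeta> in area_measure. norm (?F n \<zeta>) \<le> norm (?c n * norm (f \<zeta> * of_real (w (norm \<zeta>))))"
      unfolding real_norm_def[of "_ * _"] by (intro AE_I2 order_trans[OF Fb abs_ge_self])
  qed
  have "(\<lambda>n. integral\<^sup>L area_measure (?F n)) sums (\<integral>\<zeta>. (\<Sum>n. ?F n \<zeta>) \<partial>area_measure)"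
  proof (rule sums_integral[OF Fint])
    show "AE \<zeta> in area_measure. summable (\<lambda>n. norm (?F n \<zeta>))"
    proof (intro AE_I2)
      fix \<zeta> assume \<zeta>: "\<zeta> \<in> space area_measure"
      show "summable (\<lambda>n. norm (?F n \<zeta>))"
        using Fb[OF \<zeta>] by (intro summable_comparison_test'[OF summable_mult2[OF sc], of 0 _ "norm (f \<zeta> * of_real (w (norm \<zeta>)))"]) auto
    qed
    show "summable (\<lambda>n. \<integral>\<zeta>. norm (?F n \<zeta>) \<partial>area_measure)"
    proof (rule summable_comparison_test'[OF summable_mult2[OF sc], of 0])
      fix n
      have "(\<integral>\<zeta>. norm (?F n \<zeta>) \<partial>area_measure) \<le> (\<integral>\<zeta>. ?c n * norm (f \<zeta> * of_real (w (norm \<zeta>))) \<partial>area_measure)"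
        using Fb by (intro integral_mono integrable_norm Fint integrable_mult_right intf) auto
      then show "norm (\<integral>\<zeta>. norm (?F n \<zeta>) \<partial>area_measure) \<le> ?c n * (\<integral>\<zeta>. norm (f \<zeta> * of_real (w (norm \<zeta>))) \<partial>area_measure)"
        by (simp add: integral_nonneg_AE)
    qed
  qed
  moreover have "(\<integral>\<zeta>. (\<Sum>n. ?F n \<zeta>) \<partial>area_measure) = bergman_projection w f z"
    unfolding bergman_projection_def
  proof (rule Bochner_Integration.integral_cong[OF refl])
    fix \<zeta> assume \<zeta>: "\<zeta> \<in> space area_measure"
    have sg: "summable (\<lambda>n. ?g n \<zeta>)"
      using gb[OF \<zeta>] by (intro summable_comparison_test'[OF sc, of 0]) auto
    then have "(\<lambda>n. cnj (?g n \<zeta>)) sums cnj (\<Sum>n. ?g n \<zeta>)"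
      unfolding sums_cnj by (rule summable_sums)
    then have "bergman_kernel w z \<zeta> = cnj (\<Sum>n. ?g n \<zeta>)"
      unfolding bergman_kernel_def by (intro sums_unique[symmetric]) simp
    then have k: "cnj (bergman_kernel w z \<zeta>) = (\<Sum>n. ?g n \<zeta>)" by simp
    have "(\<lambda>n. f \<zeta> * of_real (w (norm \<zeta>)) * ?g n \<zeta>) sums (f \<zeta> * of_real (w (norm \<zeta>)) * (\<Sum>n. ?g n \<zeta>))"
      by (intro sums_mult summable_sums sg)
    then have "(\<lambda>n. ?F n \<zeta>) sums (f \<zeta> * cnj (bergman_kernel w z \<zeta>) * of_real (w (norm \<zeta>)))"
      unfolding k by (simp add: mult_ac)
    then show "(\<Sum>n. ?F n \<zeta>) = f \<zeta> * cnj (bergman_kernel w z \<zeta>) * of_real (w (norm \<zeta>))" by (rule sums_unique[symmetric])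
  qed
  moreover have "integral\<^sup>L area_measure (?F n) = z ^ n / of_real (2 * kappa n) * (\<integral>\<zeta>. cnj \<zeta> ^ n * f \<zeta> * of_real (w (norm \<zeta>)) \<partial>area_measure)" for n
    by (subst integral_mult_right_zero[symmetric]) (simp add: power_mult_distrib mult_ac)
  ultimately show ?thesis by (simp only:)
qed

lemma bergman_projection_eq:
  assumes p: "1 < p" and f: "f \<in> Lp_space p w" and g: "g holomorphic_on disc" and z: "z \<in> disc"
    and c: "\<And>n. (\<integral>\<zeta>. cnj \<zeta> ^ n * f \<zeta> * of_real (w (norm \<zeta>)) \<partial>area_measure) = taylor_coeff g n * of_real (2 * kappa n)"
  shows "bergman_projection w f z = g z"
proof -
  have "z ^ n / of_real (2 * kappa n) * (taylor_coeff g n * of_real (2 * kappa n)) = taylor_coeff g n * z ^ n" for n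
    using kappa_pos[of n] by simp
  then have "(\<lambda>n. taylor_coeff g n * z ^ n) sums bergman_projection w f z"
    using bergman_projection_sums[OF p f z] unfolding c by simp
  then show ?thesis using taylor_sums[OF g, of z] z sums_unique2 by auto
qed

theorem projection_bounded_imp_identity_bounded:
  assumes p: "1 < p"
    and bdd: "bounded_between (Lp_space p w) (Lp_norm p w) (dirichlet_space p w k) (dirichlet_norm p w k) (bergman_projection w)"
  shows "bounded_between (bergman_space p w) (Lp_norm p w) (dirichlet_space p w k) (dirichlet_norm p w k) (\<lambda>f. f)"
proof -
  obtain C where C: "\<And>f. f \<in> Lp_space p w \<Longrightarrow> bergman_projection w f \<in> dirichlet_space p w k \<and> dirichlet_norm p w k (bergman_projection w f) \<le> C * Lp_norm p w f"
    using bdd unfolding bounded_between_def by blast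
  have "f \<in> dirichlet_space p w k \<and> dirichlet_norm p w k f \<le> C * Lp_norm p w f" if fb: "f \<in> bergman_space p w" for f
  proof -
    have f: "f \<in> Lp_space p w" "f holomorphic_on disc" using fb by (auto simp: bergman_space_def)
    have "bergman_projection w f z = f z" if "z \<in> disc" for z
      by (rule bergman_projection_eq[OF p f that coeff_disc(1)[OF f(2) Lp_integrable[OF p f(1)]]])
    then have eq: "f z = bergman_projection w f z" if "z \<in> disc" for z using that by simp
    have P: "bergman_projection w f \<in> dirichlet_space p w k" using C[OF f(1)] by simp
    then have "bergman_projection w f holomorphic_on disc" by (simp add: dirichlet_space_def)
    from dirichlet_cong[OF this eq P] show ?thesis using C[OF f(1)] by simp
  qed
  then show ?thesis unfolding bounded_between_def by blast
qed

text \<open>Dilating a monomial multiplies the integral by \<open>r^n\<close>, so the limit is the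
  undilated integral, which \<open>coeff_disc\<close> evaluates. Consequently the functional
  determines every coefficient of g; this is the source of uniqueness in (ii).\<close>

lemma pairing_power:
  assumes g: "g holomorphic_on disc"
    and one: "has_A2_pairing w (\<lambda>z. z ^ 0) g c0" and pair: "has_A2_pairing w (\<lambda>z. z ^ n) g c"
  shows "c = cnj (taylor_coeff g n) * of_real (2 * kappa n)"
proof -
  \<comment> \<open>Constants are fixed by dilation, so the pairing with 1 contains the
    integrability of g against w.\<close>
  have "integrable area_measure (\<lambda>z. cnj (g z) * of_real (w (norm z)))"
    using one[unfolded has_A2_pairing_def, THEN conjunct1, THEN bspec, of "1/2"] by simp
  then have "integrable area_measure (\<lambda>z. cnj (cnj (g z) * of_real (w (norm z))))" by (rule integrable_cnj)
  then have int: "integrable area_measure (\<lambda>z. g z * of_real (w (norm z)))" by simp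
  have "(\<integral>z. z ^ n * cnj (g z) * of_real (w (norm z)) \<partial>area_measure) = (\<integral>z. cnj (cnj z ^ n * g z * of_real (w (norm z))) \<partial>area_measure)" by simp
  also have "\<dots> = cnj (taylor_coeff g n * of_real (2 * kappa n))"
    unfolding Bochner_Integration.integral_cnj coeff_disc(1)[OF g int] ..
  finally have I: "(\<integral>z. z ^ n * cnj (g z) * of_real (w (norm z)) \<partial>area_measure) = cnj (taylor_coeff g n) * of_real (2 * kappa n)" by simp
  have "(\<integral>z. (of_real r * z) ^ n * cnj (g z) * of_real (w (norm z)) \<partial>area_measure) = of_real r ^ n * (cnj (taylor_coeff g n) * of_real (2 * kappa n))" for r
    unfolding I[symmetric] by (subst integral_mult_right_zero[symmetric]) (simp add: power_mult_distrib mult_ac)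
  then have "((\<lambda>r. of_real r ^ n * (cnj (taylor_coeff g n) * of_real (2 * kappa n))) \<longlongrightarrow> c) (at_left (1::real))"
    using pair unfolding has_A2_pairing_def by simp
  moreover have "((\<lambda>r. of_real r ^ n * (cnj (taylor_coeff g n) * of_real (2 * kappa n))) \<longlongrightarrow> of_real 1 ^ n * (cnj (taylor_coeff g n) * of_real (2 * kappa n))) (at_left (1::real))"
    by (intro tendsto_intros)
  ultimately show ?thesis
    using tendsto_unique[OF trivial_limit_at_left_real] by fastforce
qed

section \<open>From duality to the projection\<close>

lemma Lp_norm_scale: "0 < p \<Longrightarrow> Lp_norm p w (\<lambda>z. c * f z) = norm c * Lp_norm p w f"
  unfolding Lp_norm_def by (simp add: norm_mult powr_mult mult.assoc powr_powr)

lemma bergman_scale: "f \<in> bergman_space p w \<Longrightarrow> (\<lambda>z. c * f z) \<in> bergman_space p w"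
  unfolding bergman_space_def Lp_space_def by (auto simp: norm_mult powr_mult mult.assoc intro!: holomorphic_intros)

lemma bergman_add:
  assumes p: "1 < p" and "f \<in> bergman_space p w" "g \<in> bergman_space p w"
  shows "(\<lambda>z. f z + g z) \<in> bergman_space p w"
proof -
  note [measurable] = Lp_measurable[OF bergman_Lp[OF assms(2)]] Lp_measurable[OF bergman_Lp[OF assms(3)]]
  have "integrable area_measure (\<lambda>z. norm (f z + g z) powr p * w (norm z))"
  proof (rule Bochner_Integration.integrable_bound)
    show "integrable area_measure (\<lambda>z. 2 powr p * (norm (f z) powr p * w (norm z) + norm (g z) powr p * w (norm z)))"
      using assms by (intro integrable_mult_right Bochner_Integration.integrable_add) (auto simp: bergman_space_def Lp_space_def)
    show "AE z in area_measure. norm (norm (f z + g z) powr p * w (norm z))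
       \<le> norm (2 powr p * (norm (f z) powr p * w (norm z) + norm (g z) powr p * w (norm z)))"
    proof (intro AE_I2)
      fix z assume z: "z \<in> space area_measure"
      have "norm (f z + g z) powr p \<le> (norm (f z) + norm (g z)) powr p"
        using p by (intro powr_mono2 norm_triangle_ineq) auto
      also have "\<dots> \<le> 2 powr p * (norm (f z) powr p + norm (g z) powr p)" using p by (intro powr_add_le) auto
      finally have "norm (f z + g z) powr p * w (norm z) \<le> (2 powr p * (norm (f z) powr p + norm (g z) powr p)) * w (norm z)"
        using nonneg_on_disc[OF z] by (intro mult_right_mono) auto
      then show "norm (norm (f z + g z) powr p * w (norm z))
       \<le> norm (2 powr p * (norm (f z) powr p * w (norm z) + norm (g z) powr p * w (norm z)))"
        using nonneg_on_disc[OF z] by (simp add: algebra_simps abs_mult)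
    qed
  qed measurable
  moreover have "(\<lambda>z. f z + g z) \<in> borel_measurable (lebesgue_on disc)"
    using assms by (intro borel_measurable_add) (auto simp: bergman_space_def Lp_space_def)
  ultimately show ?thesis using assms by (auto simp: bergman_space_def Lp_space_def intro!: holomorphic_intros)
qed

theorem duality_imp_projection_bounded:
  assumes pq: "1 < p" "1 / p + 1 / q = 1" and C: "0 < C"
    and rep: "\<And>L. L \<in> bergman_dual q w \<Longrightarrow> \<exists>g\<in>dirichlet_space p w k. (\<forall>f\<in>bergman_space q w. has_A2_pairing w f g (L f)) \<and>
           dirichlet_norm p w k g \<le> C * bergman_dual_norm q w L"
  shows "bounded_between (Lp_space p w) (Lp_norm p w) (dirichlet_space p w k) (dirichlet_norm p w k) (bergman_projection w)"
  unfolding bounded_between_def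
proof (intro exI[of _ C] ballI)
  note q = conjugate_exponent[OF pq]
  have qp: "1 / q + 1 / p = 1" using pq by simp
  fix f assume f: "f \<in> Lp_space p w"
  define L where "L h = (\<integral>z. h z * cnj (f z) * of_real (w (norm z)) \<partial>area_measure)" for h
  have int: "integrable area_measure (\<lambda>z. h z * cnj (f z) * of_real (w (norm z)))"
    and bd: "norm (L h) \<le> Lp_norm p w f * Lp_norm q w h" if "h \<in> bergman_space q w" for h
    using Hoelder_disc[OF q(1) qp bergman_Lp[OF that] Lp_cnj(1)[OF f]] Lp_cnj(2)
    by (simp_all add: L_def mult.commute)
  have L: "L \<in> bergman_dual q w"
    unfolding bergman_dual_def
  proof (intro CollectI conjI ballI allI exI[of _ "Lp_norm p w f"])
    fix g h assume "g \<in> bergman_space q w" "h \<in> bergman_space q w"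
    then show "L (\<lambda>z. g z + h z) = L g + L h"
      unfolding L_def distrib_right by (intro Bochner_Integration.integral_add int)
  next
    fix a g show "L (\<lambda>z. a * g z) = a * L g"
      unfolding L_def by (simp add: mult.assoc)
  qed (rule bd)
  \<comment> \<open>The supremum defining the dual norm is bounded above term by term only over a
    nonempty set.\<close>
  have zero: "(\<lambda>z. 0) \<in> {h \<in> bergman_space q w. Lp_norm q w h \<le> 1}"
  proof -
    have "(\<lambda>z. 0) \<in> bergman_space q w" by (rule bergman_bounded(1)[OF q(1), of _ 0]) auto
    moreover have "Lp_norm q w (\<lambda>z. 0) = 0" using q(1) by (simp add: Lp_norm_def)
    ultimately show ?thesis by simp
  qed
  have dn: "bergman_dual_norm q w L \<le> Lp_norm p w f"
    unfolding bergman_dual_norm_def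
  proof (rule cSUP_least)
    fix h assume "h \<in> {h \<in> bergman_space q w. Lp_norm q w h \<le> 1}"
    then show "norm (L h) \<le> Lp_norm p w f"
      using order_trans[OF bd[of h] mult_left_mono[of "Lp_norm q w h" 1 "Lp_norm p w f"]] Lp_norm_nonneg[of p f] by simp
  qed (use zero in blast)
  obtain g where g: "g \<in> dirichlet_space p w k" "\<And>h. h \<in> bergman_space q w \<Longrightarrow> has_A2_pairing w h g (L h)"
    "dirichlet_norm p w k g \<le> C * bergman_dual_norm q w L"
    using rep[OF L] by blast
  have hol: "g holomorphic_on disc" using g(1) by (simp add: dirichlet_space_def)
  have eq: "bergman_projection w f z = g z" if z: "z \<in> disc" for z
  proof (rule bergman_projection_eq[OF pq(1) f hol z])
    fix n
    have "L (\<lambda>z. z ^ n) = cnj (taylor_coeff g n) * of_real (2 * kappa n)"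
      using pairing_power[OF hol g(2) g(2), OF power_in_bergman(1) power_in_bergman(1), OF q(1) q(1)] .
    then have "cnj (L (\<lambda>z. z ^ n)) = taylor_coeff g n * of_real (2 * kappa n)" by simp
    moreover have "cnj (L (\<lambda>z. z ^ n)) = (\<integral>z. cnj z ^ n * f z * of_real (w (norm z)) \<partial>area_measure)"
      unfolding L_def by (subst Bochner_Integration.integral_cnj[symmetric]) simp
    ultimately show "(\<integral>z. cnj z ^ n * f z * of_real (w (norm z)) \<partial>area_measure) = taylor_coeff g n * of_real (2 * kappa n)" by simp
  qed
  show "bergman_projection w f \<in> dirichlet_space p w k \<and> dirichlet_norm p w k (bergman_projection w f) \<le> C * Lp_norm p w f"
    using dirichlet_cong[OF hol eq g(1)] order_trans[OF g(3) mult_left_mono[OF dn, of C]] C by simp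
qed

end

section \<open>Blocks of comparable moments\<close>

text \<open>Young's inequality replaces the mean value theorem and covers the endpoint 0 as
  well.\<close>

lemma powr_diff_le:
  fixes x y :: real
  assumes q: "1 < q" and "0 \<le> y" "y \<le> x"
  shows "x powr q - y powr q \<le> q * (x - y) * x powr (q - 1)"
proof -
  define q' where "q' = q / (q - 1)"
  have qq: "1 / q + 1 / q' = 1" using q by (simp add: q'_def field_simps)
  note q' = conjugate_exponent[OF q qq]
  have "y * x powr (q - 1) \<le> y powr q / q + (x powr (q - 1)) powr q' / q'"
    using assms q'(1) qq by (intro Youngs_inequality) auto
  also have "(x powr (q - 1)) powr q' = x powr q" using q'(2) by (simp add: powr_powr)
  finally have "q * (y * x powr (q - 1)) \<le> q * (y powr q / q + x powr q / q')"
    using q by (intro mult_left_mono) auto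
  also have "\<dots> = y powr q + q * (1 / q') * x powr q" using q by (simp add: field_simps)
  also have "q * (1 / q') = q - 1" unfolding q'(5) using q by (simp add: field_simps)
  finally have "q * (y * x powr (q - 1)) \<le> y powr q + (q - 1) * x powr q" .
  moreover have "x * x powr (q - 1) = x powr q" using assms by (cases "x = 0") (auto simp: powr_mult_base)
  moreover have "q * (x - y) * x powr (q - 1) = q * (x * x powr (q - 1)) - q * (y * x powr (q - 1))"
    by (simp add: right_diff_distrib left_diff_distrib mult.assoc)
  moreover have "(q - 1) * x powr q = q * x powr q - x powr q" by (simp add: left_diff_distrib)
  ultimately show ?thesis by simp
qed

text \<open>Discrete form of \<open>d(A^q) = q A^(q-1) dA\<close> for the partial sums A of a,
  summed by telescoping.\<close>

lemma powr_sum_le: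
  fixes a :: "nat \<Rightarrow> real"
  assumes q: "1 < q" and a: "\<And>n. 0 \<le> a n"
  shows "(\<Sum>n<N. a n) powr q \<le> q * (\<Sum>n<N. a n * (\<Sum>m\<le>n. a m) powr (q - 1))"
proof (induction N)
  case (Suc N)
  have "(\<Sum>n<Suc N. a n) powr q - (\<Sum>n<N. a n) powr q \<le> q * ((\<Sum>n<Suc N. a n) - (\<Sum>n<N. a n)) * (\<Sum>n<Suc N. a n) powr (q - 1)"
    using a by (intro powr_diff_le q sum_nonneg) auto
  with Suc show ?case by (simp add: lessThan_Suc_atMost[symmetric] distrib_left)
qed (use q in simp)

text \<open>Passing to partial sums costs only a constant, since the weights halve at each step
  while one new summand can be made to cost a factor below 2.\<close>

lemma discrete_Hardy:
  fixes q :: real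
  assumes q: "1 < q"
  shows "\<exists>D>0. \<forall>y N. (\<forall>n. 0 \<le> y n) \<longrightarrow>
    (\<Sum>n<N. (\<Sum>m\<le>n. y m) powr q / 2 ^ n) \<le> D * (\<Sum>n<N. y n powr q / 2 ^ n)"
proof -
  \<comment> \<open>Any growth factor below 2 would do for the old sum;
    \<open>(1 + \<epsilon>)^q = 3/2\<close> is the choice, and D is the price for the new
    term.\<close>
  define \<epsilon> :: real where "\<epsilon> = (3/2) powr (1/q) - 1"
  have e: "0 < \<epsilon>" "(1 + \<epsilon>) powr q = 3/2"
    using q by (auto simp: \<epsilon>_def powr_powr intro: gr_one_powr)
  define D where "D = (1 + 1 / \<epsilon>) powr q"
  have "0 < 1 + 1 / \<epsilon>" using e by (intro add_pos_pos) auto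
  then have D: "0 < D" by (simp add: D_def)
  have add: "(a + b) powr q \<le> 3/2 * a powr q + D * b powr q" if "0 \<le> a" "0 \<le> b" for a b :: real
  proof (cases "b \<le> \<epsilon> * a")
    case True
    then have "(a + b) powr q \<le> ((1 + \<epsilon>) * a) powr q" using that q by (intro powr_mono2) (auto simp: algebra_simps)
    also have "\<dots> = 3/2 * a powr q" using e by (simp add: powr_mult)
    finally show ?thesis using D by (simp add: add_increasing2)
  next
    case False
    then have "a + b \<le> (1 + 1 / \<epsilon>) * b" using e by (simp add: field_simps)
    then have "(a + b) powr q \<le> ((1 + 1 / \<epsilon>) * b) powr q" using that q by (intro powr_mono2) auto
    also have "\<dots> = D * b powr q" by (simp add: powr_mult D_def)
    finally show ?thesis by (simp add: add_increasing)
  qed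
  have "(\<Sum>n<N. (\<Sum>m\<le>n. y m) powr q / 2 ^ n) \<le> 4 * D * (\<Sum>n<N. y n powr q / 2 ^ n)"
    if y: "\<And>n. 0 \<le> y n" for y N
  proof -
    \<comment> \<open>The boundary term closes the induction: the new sum appears with weight 1 +
      6/2 = 4 over \<open>2^N\<close>, and 4 times 3/2 is 6 again.\<close>
    have "(\<Sum>n<N. (\<Sum>m\<le>n. y m) powr q / 2 ^ n) + 6 * (\<Sum>m<N. y m) powr q / 2 ^ N \<le> 4 * D * (\<Sum>n<N. y n powr q / 2 ^ n)"
    proof (induction N)
      case (Suc N)
      let ?Z = "\<lambda>N. (\<Sum>m<N. y m) powr q"
      have "?Z (Suc N) \<le> 3/2 * ?Z N + D * y N powr q"
        using add[of "\<Sum>m<N. y m" "y N"] y by (simp add: sum_nonneg)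
      then have "4 * ?Z (Suc N) / 2 ^ N \<le> (6 * ?Z N + 4 * D * y N powr q) / 2 ^ N"
        by (intro divide_right_mono) auto
      then have "?Z (Suc N) / 2 ^ N + 6 * ?Z (Suc N) / 2 ^ Suc N \<le> 6 * ?Z N / 2 ^ N + 4 * D * (y N powr q / 2 ^ N)"
        by (simp add: add_divide_distrib)
      with Suc show ?case by (simp add: lessThan_Suc_atMost[symmetric] distrib_left)
    qed simp
    moreover have "0 \<le> 6 * (\<Sum>m<N. y m) powr q / 2 ^ N" by simp
    ultimately show ?thesis by linarith
  qed
  with D show ?thesis by (intro exI[of _ "4 * D"]) auto
qed

text \<open>Uniqueness of coefficients, read off by orthogonality on the circle of radius
  1/2.\<close>

lemma taylor_coeff_power_series:
  assumes f: "f holomorphic_on disc" and s: "\<And>z. z \<in> disc \<Longrightarrow> (\<lambda>n. c n * z ^ n) sums f z"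
    and sm: "summable (\<lambda>n. norm (c n) * (1/2) ^ n)"
  shows "taylor_coeff f n = c n"
proof -
  have "(\<lambda>m. (c m * of_real (1/2) ^ m) * (\<integral>u. cnj u ^ n * u ^ m \<partial>arc_measure)) sums (\<integral>u. cnj u ^ n * f (of_real (1/2) * u) \<partial>arc_measure)"
  proof (rule sums_integral_circle)
    show "summable (\<lambda>m. norm (c m * of_real (1/2) ^ m))"
      using sm by (simp add: norm_mult norm_power)
    show "continuous_on circle (\<lambda>u. cnj u ^ n)" "continuous_on circle (\<lambda>u. u ^ m)" for m by (intro continuous_intros)+
    show "norm (u ^ m) \<le> 1" if "u \<in> circle" for m u using that by (simp add: circle_norm norm_power)
    show "(\<lambda>m. c m * of_real (1/2) ^ m * u ^ m) sums f (of_real (1/2) * u)" if "u \<in> circle" for u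
      using s[of "of_real (1/2) * u"] that by (simp add: circle_norm norm_mult power_mult_distrib power_divide)
  qed
  moreover have "(\<integral>u. cnj u ^ n * u ^ m \<partial>arc_measure) = (if m = n then 1 else 0)" for m
    using arc_orthogonal[of m n] by (simp add: mult.commute)
  then have "(\<lambda>m. (c m * of_real (1/2) ^ m) * (\<integral>u. cnj u ^ n * u ^ m \<partial>arc_measure)) = (\<lambda>m. if m = n then c m * of_real (1/2) ^ m else 0)"
    by auto
  ultimately have "(\<lambda>m. if m = n then c m * of_real (1/2) ^ m else 0) sums (taylor_coeff f n * of_real (1/2) ^ n)"
    using coeff_integral[OF f, of "1/2" n] by simp
  from sums_unique2[OF this sums_single] show ?thesis by simp
qed

section \<open>Dyadic blocks of frequencies\<close>

context positive_weight begin

lemma kappa_antimono: "m \<le> n \<Longrightarrow> kappa n \<le> kappa m"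
  by (intro moment_antimono) auto

text \<open>The first frequency whose moment has dropped to \<open>2^-n\<close> of the initial one.
  For k from \<open>block n\<close> to just before \<open>block (Suc n)\<close>,
  \<open>kappa k\<close> lies between \<open>kappa 0 / 2^(n+1)\<close> and
  \<open>kappa 0 / 2^n\<close>. Blocks may be empty.\<close>

definition block :: "nat \<Rightarrow> nat" where
  "block n = (LEAST k. kappa k \<le> kappa 0 / 2 ^ n)"

lemma block_ex: "\<exists>k. kappa k \<le> kappa 0 / 2 ^ n"
proof -
  have "eventually (\<lambda>k. kappa k < kappa 0 / 2 ^ n) sequentially"
    using moment_tendsto_0 kappa_pos[of 0] by (intro order_tendstoD(2)) auto
  then show ?thesis by (auto simp: eventually_sequentially intro: less_imp_le)
qed

lemma block_le: "kappa (block n) \<le> kappa 0 / 2 ^ n"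
  unfolding block_def by (rule LeastI_ex[OF block_ex])

lemma block_gt: "k < block n \<Longrightarrow> kappa 0 / 2 ^ n < kappa k"
  unfolding block_def using not_less_Least by (metis not_le)

lemma block_0: "block 0 = 0"
  unfolding block_def by (intro Least_equality) auto

lemma block_mono: "mono block"
proof (rule monoI, rule ccontr)
  fix m n :: nat assume "m \<le> n" "\<not> block m \<le> block n"
  then have "kappa 0 / 2 ^ m < kappa (block n)" by (intro block_gt) auto
  also have "\<dots> \<le> kappa 0 / 2 ^ n" by (rule block_le)
  also have "\<dots> \<le> kappa 0 / 2 ^ m"
    using \<open>m \<le> n\<close> kappa_pos[of 0] by (intro divide_left_mono power_increasing) auto
  finally show False by simp
qed

text \<open>The moments are positive, so each frequency is eventually passed; sums over blocks thus
  exhaust the power series.\<close>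

lemma block_unbounded: "filterlim block at_top sequentially"
  unfolding filterlim_at_top eventually_sequentially
proof
  fix M
  have "(\<lambda>n. kappa 0 * (1/2) ^ n) \<longlonglongrightarrow> kappa 0 * 0"
    by (intro tendsto_mult tendsto_const LIMSEQ_realpow_zero) auto
  then have "(\<lambda>n. kappa 0 / 2 ^ n) \<longlonglongrightarrow> 0" by (simp add: power_divide)
  then have "eventually (\<lambda>n. kappa 0 / 2 ^ n < kappa M) sequentially"
    using kappa_pos[of M] by (intro order_tendstoD(2)) auto
  then obtain n where n: "kappa 0 / 2 ^ n < kappa M" by (auto simp: eventually_sequentially)
  have "M \<le> block n"
  proof (rule ccontr)
    assume "\<not> M \<le> block n"
    then have "kappa M \<le> kappa (block n)" by (intro kappa_antimono) auto
    then show False using block_le[of n] n by linarith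
  qed
  then show "\<exists>N. \<forall>n\<ge>N. M \<le> block n" using monoD[OF block_mono] by (meson order_trans)
qed

lemma sum_blocks: "(\<Sum>n<N. \<Sum>k=block n..<block (Suc n). h k) = (\<Sum>k<block N. h k)"
proof (induction N)
  case (Suc N)
  have "(\<Sum>k<block N. h k) + (\<Sum>k=block N..<block (Suc N). h k) = (\<Sum>k<block (Suc N). h k)"
    using monoD[OF block_mono, of N "Suc N"] unfolding lessThan_atLeast0 by (intro sum.atLeastLessThan_concat) auto
  with Suc show ?case by simp
qed (simp add: block_0)

definition block_sum :: "(nat \<Rightarrow> complex) \<Rightarrow> nat \<Rightarrow> complex \<Rightarrow> complex" where
  "block_sum c n z = (\<Sum>k=block n..<block (Suc n). c k * z ^ k)"

lemma continuous_on_block_sum [continuous_intros]: "continuous_on S g \<Longrightarrow> continuous_on S (\<lambda>x. block_sum c n (g x))"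
  unfolding block_sum_def by (intro continuous_intros)

text \<open>A block is \<open>z ^ block n\<close> times a polynomial v. The power contributes its
  exact decay in r, and the mean of v increases up to the circle; Minkowski adds the blocks.\<close>

lemma mean_pow_block_sums:
  assumes q: "1 < q" and r: "0 \<le> r" "r < 1"
  shows "mean_pow q (\<lambda>z. \<Sum>n<N. block_sum (c n) n z) r \<le> (\<Sum>n<N. r ^ block n * circle_norm_p q (block_sum (c n) n)) powr q"
proof -
  let ?g = "\<lambda>n u. block_sum (c n) n (of_real r * u)"
  have one: "circle_norm_p q (?g n) \<le> r ^ block n * circle_norm_p q (block_sum (c n) n)" for n
  proof -
    define v where "v z = (\<Sum>k=block n..<block (Suc n). c n k * z ^ (k - block n))" for z
    have v: "block_sum (c n) n z = z ^ block n * v z" for z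
    proof -
      have "c n k * z ^ k = z ^ block n * (c n k * z ^ (k - block n))" if "k \<in> {block n..<block (Suc n)}" for k
      proof -
        have "block n + (k - block n) = k" using that by simp
        then have "z ^ k = z ^ block n * z ^ (k - block n)" by (metis power_add)
        then show ?thesis by (simp only: mult.left_commute)
      qed
      then show ?thesis unfolding block_sum_def v_def sum_distrib_left by (rule sum.cong[OF refl])
    qed
    \<comment> \<open>The radius 2 lets monotonicity of the mean reach r = 1.\<close>
    have hol: "v holomorphic_on ball 0 2" unfolding v_def by (intro holomorphic_intros)
    have e1: "norm (?g n u) powr q = (r ^ block n) powr q * norm (v (of_real r * u)) powr q" if "u \<in> space arc_measure" for u
      using that r unfolding v by (simp add: norm_mult norm_power circle_norm powr_mult power_mult_distrib)
    have e2: "norm (v (of_real 1 * u)) powr q = norm (block_sum (c n) n u) powr q" if "u \<in> space arc_measure" for u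
      using that unfolding v by (simp add: norm_mult norm_power circle_norm)
    have "(\<integral>u. norm (?g n u) powr q \<partial>arc_measure) = (r ^ block n) powr q * mean_pow q v r"
      unfolding mean_pow_def by (subst Bochner_Integration.integral_cong[OF refl e1]) auto
    also have "\<dots> \<le> (r ^ block n) powr q * mean_pow q v 1"
      using r mean_pow_mono[OF q hol, of r 1] by (intro mult_left_mono) auto
    also have "mean_pow q v 1 = (\<integral>u. norm (block_sum (c n) n u) powr q \<partial>arc_measure)"
      unfolding mean_pow_def by (rule Bochner_Integration.integral_cong[OF refl e2])
    finally have "circle_norm_p q (?g n) \<le> ((r ^ block n) powr q * (\<integral>u. norm (block_sum (c n) n u) powr q \<partial>arc_measure)) powr (1/q)"
      unfolding circle_norm_p_def using q by (intro powr_mono2) (auto intro!: integral_nonneg_AE)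
    also have "\<dots> = r ^ block n * circle_norm_p q (block_sum (c n) n)"
      using q r by (simp add: powr_mult powr_powr circle_norm_p_def)
    finally show ?thesis .
  qed
  have "circle_norm_p q (\<lambda>u. \<Sum>n<N. ?g n u) \<le> (\<Sum>n<N. circle_norm_p q (?g n))"
    by (intro circle_norm_p_sum q continuous_intros) auto
  also have "\<dots> \<le> (\<Sum>n<N. r ^ block n * circle_norm_p q (block_sum (c n) n))" by (intro sum_mono one)
  finally have "circle_norm_p q (\<lambda>u. \<Sum>n<N. ?g n u) powr q \<le> (\<Sum>n<N. r ^ block n * circle_norm_p q (block_sum (c n) n)) powr q"
    using q by (intro powr_mono2) auto
  then show ?thesis using q by (simp add: circle_norm_p_powr mean_pow_def)
qed

text \<open>\<open>powr_sum_le\<close> expands the q-th power so that only one factor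
  \<open>r^(block n)\<close> survives; its integral is a moment of size \<open>2^-n\<close> by
  doubling, and Hardy's inequality replaces partial sums of block norms by the block norms. The
  coefficients may differ from block to block, which allows rescaling each block.\<close>

lemma block_norm:
  assumes q: "1 < q" and dbl: "upper_doubling w"
  shows "\<exists>A>0. \<forall>c N. (\<lambda>z. \<Sum>n<N. block_sum (c n) n z) \<in> bergman_space q w \<and>
     Lp_norm q w (\<lambda>z. \<Sum>n<N. block_sum (c n) n z) powr q \<le> A * (\<Sum>n<N. circle_norm_p q (block_sum (c n) n) powr q / 2 ^ n)"
proof -
  obtain C where C: "1 \<le> C" "\<And>r. 0 \<le> r \<Longrightarrow> r < 1 \<Longrightarrow> weight_tail w r \<le> C * weight_tail w ((1 + r) / 2)"
    using dbl unfolding upper_doubling_def by auto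
  obtain D where D: "0 < D" and H: "\<forall>y N. (\<forall>n. 0 \<le> y n) \<longrightarrow>
      (\<Sum>n<N. (\<Sum>m\<le>n. y m) powr q / 2 ^ n) \<le> D * (\<Sum>n<N. y n powr q / 2 ^ n)"
    using discrete_Hardy[OF q] by (elim exE conjE)
  have Hardy: "(\<Sum>n<N. (\<Sum>m\<le>n. y m) powr q / 2 ^ n) \<le> D * (\<Sum>n<N. y n powr q / 2 ^ n)"
    if "\<And>n. 0 \<le> y n" for y N
    by (rule H[THEN spec, THEN spec, THEN mp]) (intro allI that)
  define A where "A = 2 * q * C * kappa 0 * D"
  have A: "0 < A" using q C(1) D kappa_pos[of 0] by (simp add: A_def)
  \<comment> \<open>Integration produces the exponent \<open>block n + 1\<close>, but blocks are
    defined through \<open>2 * block n + 1\<close>; moment doubling halves the latter to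
    \<open>block n + 1/2\<close>.\<close>
  have mom: "weight_moment w (real (block n) + 1) \<le> C * kappa 0 / 2 ^ n" for n
  proof -
    have "weight_moment w (real (block n) + 1) \<le> weight_moment w ((2 * real (block n) + 1) / 2)"
      by (intro moment_antimono) auto
    also have "\<dots> \<le> C * kappa (block n)" by (rule moment_doubling[OF _ C(2)]) (use C(1) in auto)
    also have "\<dots> \<le> C * (kappa 0 / 2 ^ n)" using C(1) block_le by (intro mult_left_mono) auto
    finally show ?thesis by simp
  qed
  have "(\<lambda>z. \<Sum>n<N. block_sum (c n) n z) \<in> bergman_space q w \<and>
     Lp_norm q w (\<lambda>z. \<Sum>n<N. block_sum (c n) n z) \<le> (A * (\<Sum>n<N. circle_norm_p q (block_sum (c n) n) powr q / 2 ^ n)) powr (1/q)" for c N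
  proof -
    let ?F = "\<lambda>z. \<Sum>n<N. block_sum (c n) n z"
    define y where "y n = circle_norm_p q (block_sum (c n) n)" for n
    have y: "0 \<le> y n" for n by (simp add: y_def)
    let ?Y = "\<lambda>n. \<Sum>m\<le>n. y m"
    have Y: "0 \<le> ?Y n" "y n \<le> ?Y n" for n
      using y member_le_sum[of n "{..n}" y] by (simp_all add: sum_nonneg)
    have hol: "?F holomorphic_on disc" unfolding block_sum_def by (intro holomorphic_intros)
    have pt: "2 * r * mean_pow q ?F r \<le> (\<Sum>n<N. 2 * q * ?Y n powr q * r powr (real (block n) + 1))"
      if r: "0 \<le> r" "r < 1" for r
    proof -
      have "mean_pow q ?F r \<le> (\<Sum>n<N. r ^ block n * y n) powr q"
        unfolding y_def by (rule mean_pow_block_sums[OF q r])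
      also have "\<dots> \<le> q * (\<Sum>n<N. r ^ block n * y n * (\<Sum>m\<le>n. r ^ block m * y m) powr (q - 1))"
        using r y by (intro powr_sum_le q) auto
      also have "\<dots> \<le> q * (\<Sum>n<N. r ^ block n * ?Y n powr q)"
      proof (intro mult_left_mono sum_mono)
        fix n
        \<comment> \<open>The powers of r inside the partial sums are discarded, keeping the
          integrand linear in powers of r.\<close>
        have "(\<Sum>m\<le>n. r ^ block m * y m) \<le> ?Y n"
          using r y by (intro sum_mono mult_left_le_one_le power_le_one) auto
        then have "(\<Sum>m\<le>n. r ^ block m * y m) powr (q - 1) \<le> ?Y n powr (q - 1)"
          using q r y by (intro powr_mono2) (auto intro!: sum_nonneg)
        then have "r ^ block n * y n * (\<Sum>m\<le>n. r ^ block m * y m) powr (q - 1) \<le> r ^ block n * ?Y n * ?Y n powr (q - 1)"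
          using r y Y by (intro mult_mono) auto
        also have "\<dots> = r ^ block n * ?Y n powr q"
          using Y(1)[of n] by (cases "?Y n = 0") (auto simp: mult.assoc powr_mult_base)
        finally show "r ^ block n * y n * (\<Sum>m\<le>n. r ^ block m * y m) powr (q - 1) \<le> r ^ block n * ?Y n powr q" .
      qed (use q in auto)
      finally have "2 * r * mean_pow q ?F r \<le> 2 * r * (q * (\<Sum>n<N. r ^ block n * ?Y n powr q))"
        using r by (intro mult_left_mono) auto
      also have "\<dots> = (\<Sum>n<N. 2 * q * ?Y n powr q * (r * r ^ block n))"
        by (simp add: sum_distrib_left mult_ac)
      also have "\<dots> = (\<Sum>n<N. 2 * q * ?Y n powr q * r powr (real (block n) + 1))"
      proof -
        have "r * r ^ m = r powr (real m + 1)" for m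
          using r by (cases "r = 0") (auto simp: powr_add powr_realpow)
        then show ?thesis by (simp only:)
      qed
      finally show ?thesis .
    qed
    have intm: "integrable radial_measure (\<lambda>r. r powr (real (block n) + 1))" for n
      by (intro integrable_powr_radial) auto
    have "(\<integral>\<^sup>+r. ennreal (2 * r * mean_pow q ?F r) \<partial>radial_measure) \<le> (\<integral>\<^sup>+r. ennreal (\<Sum>n<N. 2 * q * ?Y n powr q * r powr (real (block n) + 1)) \<partial>radial_measure)"
      using pt by (intro nn_integral_mono ennreal_leI) auto
    also have "\<dots> = ennreal (\<integral>r. (\<Sum>n<N. 2 * q * ?Y n powr q * r powr (real (block n) + 1)) \<partial>radial_measure)"
      using q by (intro nn_integral_eq_integral Bochner_Integration.integrable_sum integrable_mult_right intm AE_I2 sum_nonneg) auto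
    also have "(\<integral>r. (\<Sum>n<N. 2 * q * ?Y n powr q * r powr (real (block n) + 1)) \<partial>radial_measure) = (\<Sum>n<N. 2 * q * ?Y n powr q * weight_moment w (real (block n) + 1))"
      unfolding moment_radial
      by (subst Bochner_Integration.integral_sum) (intro integrable_mult_right intm, simp only: integral_mult_right_zero)
    also have "\<dots> \<le> (\<Sum>n<N. 2 * q * ?Y n powr q * (C * kappa 0 / 2 ^ n))"
      using q by (intro sum_mono mult_left_mono mom) auto
    also have "\<dots> = 2 * q * C * kappa 0 * (\<Sum>n<N. ?Y n powr q / 2 ^ n)"
      by (simp add: sum_distrib_left mult_ac)
    also have "\<dots> \<le> 2 * q * C * kappa 0 * (D * (\<Sum>n<N. y n powr q / 2 ^ n))"
      using q C(1) kappa_pos[of 0] by (intro mult_left_mono Hardy y) simp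
    also have "\<dots> = ((A * (\<Sum>n<N. y n powr q / 2 ^ n)) powr (1/q)) powr q"
    proof -
      have "0 \<le> A * (\<Sum>n<N. y n powr q / 2 ^ n)" using A by (intro mult_nonneg_nonneg sum_nonneg) auto
      then have "((A * (\<Sum>n<N. y n powr q / 2 ^ n)) powr (1/q)) powr q = A * (\<Sum>n<N. y n powr q / 2 ^ n)"
        using q by (simp only: powr_powr) simp
      then show ?thesis unfolding A_def by (simp only: mult.assoc)
    qed
    finally have le: "(\<integral>\<^sup>+r. ennreal (2 * r * mean_pow q ?F r) \<partial>radial_measure) \<le> ennreal (((A * (\<Sum>n<N. y n powr q / 2 ^ n)) powr (1/q)) powr q)"
      by (simp add: ennreal_leI)
    show ?thesis
      using bergmanI[OF q hol powr_ge_zero le] unfolding y_def by (intro conjI)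
  qed
  note bound = this
  have "Lp_norm q w (\<lambda>z. \<Sum>n<N. block_sum (c n) n z) powr q \<le> A * (\<Sum>n<N. circle_norm_p q (block_sum (c n) n) powr q / 2 ^ n)" for c N
  proof -
    have nn: "0 \<le> A * (\<Sum>n<N. circle_norm_p q (block_sum (c n) n) powr q / 2 ^ n)"
      using A by (intro mult_nonneg_nonneg sum_nonneg) auto
    have "Lp_norm q w (\<lambda>z. \<Sum>n<N. block_sum (c n) n z) powr q \<le> ((A * (\<Sum>n<N. circle_norm_p q (block_sum (c n) n) powr q / 2 ^ n)) powr (1/q)) powr q"
      using conjunct2[OF bound[of c N]] q by (intro powr_mono2 Lp_norm_nonneg) simp
    also have "\<dots> = A * (\<Sum>n<N. circle_norm_p q (block_sum (c n) n) powr q / 2 ^ n)"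
      using q nn by (simp only: powr_powr) simp
    finally show ?thesis .
  qed
  then show ?thesis using A bound by (intro exI[of _ A] conjI allI) auto
qed

end

section \<open>The dual of the weighted Bergman space\<close>

context positive_weight begin

lemma bergman_zero: "1 < q \<Longrightarrow> (\<lambda>z. 0) \<in> bergman_space q w"
  by (rule bergman_bounded(1)[of q _ 0]) auto

lemma dual_add:
  "L \<in> bergman_dual q w \<Longrightarrow> f \<in> bergman_space q w \<Longrightarrow> g \<in> bergman_space q w \<Longrightarrow> L (\<lambda>z. f z + g z) = L f + L g"
  unfolding bergman_dual_def by blast

lemma dual_scale: "L \<in> bergman_dual q w \<Longrightarrow> f \<in> bergman_space q w \<Longrightarrow> L (\<lambda>z. a * f z) = a * L f"
  unfolding bergman_dual_def by blast

text \<open>Homogeneity extends the bound from the unit ball. A function of norm 0 cannot be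
  normalized; there the bound with M already gives L f = 0.\<close>

lemma dual_bound:
  assumes q: "1 < q" and L: "L \<in> bergman_dual q w"
  shows "0 \<le> bergman_dual_norm q w L"
    and "f \<in> bergman_space q w \<Longrightarrow> norm (L f) \<le> bergman_dual_norm q w L * Lp_norm q w f"
proof -
  obtain M where M: "\<And>f. f \<in> bergman_space q w \<Longrightarrow> norm (L f) \<le> M * Lp_norm q w f"
    using L unfolding bergman_dual_def by blast
  have scale: "L (\<lambda>z. a * f z) = a * L f" if "f \<in> bergman_space q w" for a f
    by (rule dual_scale[OF L that])
  let ?X = "{f \<in> bergman_space q w. Lp_norm q w f \<le> 1}"
  have bdd: "bdd_above ((\<lambda>f. norm (L f)) ` ?X)"
  proof (rule bdd_aboveI2)
    fix f assume f: "f \<in> ?X"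
    then have "norm (L f) \<le> M * Lp_norm q w f" using M by simp
    also have "\<dots> \<le> \<bar>M\<bar> * 1" using f Lp_norm_nonneg by (intro mult_mono) auto
    finally show "norm (L f) \<le> \<bar>M\<bar>" by simp
  qed
  have le: "norm (L f) \<le> bergman_dual_norm q w L" if "f \<in> bergman_space q w" "Lp_norm q w f \<le> 1" for f
    unfolding bergman_dual_norm_def by (rule cSUP_upper[OF _ bdd]) (use that in simp)
  have "Lp_norm q w (\<lambda>z. 0) = 0" using q by (simp add: Lp_norm_def)
  then show "0 \<le> bergman_dual_norm q w L"
    using order_trans[OF norm_ge_zero le[OF bergman_zero[OF q]]] by simp
  assume f: "f \<in> bergman_space q w"
  show "norm (L f) \<le> bergman_dual_norm q w L * Lp_norm q w f"
  proof (cases "Lp_norm q w f = 0")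
    case True
    then show ?thesis using M[OF f] by simp
  next
    case False
    define N where "N = Lp_norm q w f"
    have N: "0 < N" using False Lp_norm_nonneg[of q f] by (simp add: N_def)
    let ?a = "complex_of_real (1 / N)"
    have "norm (L (\<lambda>z. ?a * f z)) \<le> bergman_dual_norm q w L"
    proof (rule le[OF bergman_scale[OF f]])
      have "Lp_norm q w (\<lambda>z. ?a * f z) = norm ?a * N" unfolding N_def using q by (intro Lp_norm_scale) auto
      also have "norm ?a = 1 / N" using N by (simp only: norm_of_real) simp
      also have "1 / N * N = 1" using N by simp
      finally show "Lp_norm q w (\<lambda>z. ?a * f z) \<le> 1" by simp
    qed
    moreover have "norm ?a = 1 / N" using N by (simp only: norm_of_real) simp
    ultimately have "1 / N * norm (L f) \<le> bergman_dual_norm q w L"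
      unfolding scale[OF f] norm_mult by (simp only:)
    then show ?thesis using N by (simp add: N_def[symmetric] field_simps)
  qed
qed

lemma dual_sum:
  assumes q: "1 < q" and L: "L \<in> bergman_dual q w" and I: "finite I"
    and f: "\<And>k. k \<in> I \<Longrightarrow> f k \<in> bergman_space q w"
  shows "(\<lambda>z. \<Sum>k\<in>I. c k * f k z) \<in> bergman_space q w \<and> L (\<lambda>z. \<Sum>k\<in>I. c k * f k z) = (\<Sum>k\<in>I. c k * L (f k))"
  using I f
proof (induction I rule: finite_induct)
  case empty
  \<comment> \<open>L vanishes at 0 by homogeneity with factor 0.\<close>
  have "L (\<lambda>z. 0 * 0) = 0 * L (\<lambda>z. 0)"
    by (rule dual_scale[OF L bergman_zero[OF q]])
  then show ?case using bergman_zero[OF q] by simp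
next
  case (insert i I)
  have s: "(\<lambda>z. c i * f i z) \<in> bergman_space q w" using insert by (intro bergman_scale) auto
  have IH: "(\<lambda>z. \<Sum>k\<in>I. c k * f k z) \<in> bergman_space q w" "L (\<lambda>z. \<Sum>k\<in>I. c k * f k z) = (\<Sum>k\<in>I. c k * L (f k))"
    using insert by auto
  have fi: "f i \<in> bergman_space q w" using insert by auto
  have "L (\<lambda>z. c i * f i z + (\<Sum>k\<in>I. c k * f k z)) = L (\<lambda>z. c i * f i z) + L (\<lambda>z. \<Sum>k\<in>I. c k * f k z)"
    by (rule dual_add[OF L s IH(1)])
  moreover have "L (\<lambda>z. c i * f i z) = c i * L (f i)"
    by (rule dual_scale[OF L fi])
  ultimately show ?case using bergman_add[OF q s IH(1)] IH(2) insert.hyps by simp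
qed

section \<open>Dilations and the pairing\<close>

lemma dilation_holomorphic:
  assumes "f holomorphic_on disc" "0 < r" "r < 1"
  shows "(\<lambda>z. f (of_real r * z)) holomorphic_on disc"
proof (rule holomorphic_on_compose_gen[OF _ assms(1), unfolded o_def])
  show "(*) (of_real r) ` disc \<subseteq> disc"
    using assms by (auto simp: norm_mult intro!: le_less_trans[OF mult_left_le_one_le])
qed (intro holomorphic_intros)

lemma dilation_bounded:
  assumes "f holomorphic_on disc" "0 < r" "r < 1"
  shows "\<exists>B\<ge>0. \<forall>z. norm z \<le> r \<longrightarrow> norm (f z) \<le> B"
proof -
  have "bounded (f ` cball 0 r)"
    using assms by (intro compact_imp_bounded compact_continuous_image continuous_on_subset[OF holomorphic_on_imp_continuous_on[OF assms(1)]]) auto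
  then obtain B where B: "0 < B" "\<And>x. x \<in> f ` cball 0 r \<Longrightarrow> norm x \<le> B" unfolding bounded_pos by blast
  then show ?thesis by (intro exI[of _ B]) auto
qed

lemma dilation_bergman:
  assumes q: "1 < q" and f: "f holomorphic_on disc" and r: "0 < r" "r < 1"
  shows "(\<lambda>z. f (of_real r * z)) \<in> bergman_space q w"
proof -
  obtain B where B: "0 \<le> B" "\<And>z. norm z \<le> r \<Longrightarrow> norm (f z) \<le> B" using dilation_bounded[OF f r] by blast
  show ?thesis
    by (rule bergman_bounded(1)[OF q dilation_holomorphic[OF f r] B(1)])
       (intro B(2), use r in \<open>simp add: norm_mult mult_left_le\<close>)
qed

text \<open>Dominated convergence twice: on each circle by uniform continuity effects inside the
  disc, then in the radius with a multiple of the means of f as majorant. The difference is written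
  with the factor -1 to match \<open>dual_add\<close> and \<open>dual_scale\<close>.\<close>

lemma dilation_tendsto:
  assumes q: "1 < q" and fb: "f \<in> bergman_space q w"
  shows "((\<lambda>r. Lp_norm q w (\<lambda>z. f (of_real r * z) + (-1) * f z)) \<longlongrightarrow> 0) (at_left 1)"
proof (rule tendsto_at_left_sequentially[of 0])
  fix S :: "nat \<Rightarrow> real" assume S: "\<And>n. S n < 1" "\<And>n. 0 < S n" "S \<longlonglongrightarrow> 1"
  note f = bergman_integral(2)[OF q fb]
  let ?h = "\<lambda>n z. f (of_real (S n) * z) + (-1) * f z"
  have hol: "?h n holomorphic_on disc" for n
    using dilation_holomorphic[OF f S(2,1)] f by (intro holomorphic_intros)
  have contf: "continuous_on disc f" using f by (rule holomorphic_on_imp_continuous_on)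
  have in_disc: "norm (of_real (S n) * (of_real s * u)) \<le> s" if "0 \<le> s" "u \<in> circle" for n s u
    using that S(1,2)[of n] by (simp add: norm_mult circle_norm mult_left_le_one_le)
  have pt: "(\<lambda>n. mean_pow q (?h n) s) \<longlonglongrightarrow> 0" if s: "0 \<le> s" "s < 1" for s
  proof -
    define t where "t = (s + 1) / 2"
    have t: "0 < t" "t < 1" "s \<le> t" using s by (auto simp: t_def)
    obtain B where B: "0 \<le> B" "\<And>z. norm z \<le> t \<Longrightarrow> norm (f z) \<le> B" using dilation_bounded[OF f t(1,2)] by blast
    have "(\<lambda>n. \<integral>u. norm (?h n (of_real s * u)) powr q \<partial>arc_measure) \<longlonglongrightarrow> (\<integral>u. 0 \<partial>arc_measure)"
    proof (rule integral_dominated_convergence[where w = "\<lambda>_. (2 * B) powr q"])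
      show "(\<lambda>u. norm (?h n (of_real s * u)) powr q) \<in> borel_measurable arc_measure" for n
        using q s by (intro continuous_on_circle_measurable continuous_on_powr_norm holomorphic_circle_continuous[OF hol]) auto
      show "AE u in arc_measure. norm (norm (?h n (of_real s * u)) powr q) \<le> (2 * B) powr q" for n
      proof (intro AE_I2)
        fix u assume "u \<in> space arc_measure"
        then have u: "u \<in> circle" by simp
        have "norm (?h n (of_real s * u)) \<le> norm (f (of_real (S n) * (of_real s * u))) + norm (f (of_real s * u))"
          using norm_triangle_ineq4[of "f (of_real (S n) * (of_real s * u))" "f (of_real s * u)"] by simp
        also have "\<dots> \<le> B + B"
          using in_disc[OF s(1) u, of n] u s t by (intro add_mono B(2)) (auto simp: norm_mult circle_norm)
        finally show "norm (norm (?h n (of_real s * u)) powr q) \<le> (2 * B) powr q"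
          using q by (auto intro!: powr_mono2)
      qed
      show "AE u in arc_measure. (\<lambda>n. norm (?h n (of_real s * u)) powr q) \<longlonglongrightarrow> 0"
      proof (intro AE_I2)
        fix u assume "u \<in> space arc_measure"
        then have u: "u \<in> circle" by simp
        have d: "of_real s * u \<in> disc" using u s by (simp add: norm_mult circle_norm)
        have "isCont f (of_real s * u)" using contf d by (simp add: continuous_on_eq_continuous_at)
        moreover have "(\<lambda>n. complex_of_real (S n) * (of_real s * u)) \<longlonglongrightarrow> of_real 1 * (of_real s * u)"
          by (intro tendsto_intros S(3))
        ultimately have "(\<lambda>n. f (of_real (S n) * (of_real s * u))) \<longlonglongrightarrow> f (of_real s * u)"
          by (auto intro: isCont_tendsto_compose)
        then have "(\<lambda>n. norm (?h n (of_real s * u))) \<longlonglongrightarrow> norm (f (of_real s * u) + (-1) * f (of_real s * u))"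
          by (intro tendsto_intros)
        then have "(\<lambda>n. norm (?h n (of_real s * u)) powr q) \<longlonglongrightarrow> norm (f (of_real s * u) + (-1) * f (of_real s * u)) powr q"
          using q by (intro tendsto_powr' tendsto_const) auto
        then show "(\<lambda>n. norm (?h n (of_real s * u)) powr q) \<longlonglongrightarrow> 0" by simp
      qed
    qed auto
    then show ?thesis by (simp add: mean_pow_def)
  qed
  have bd: "mean_pow q (?h n) s \<le> 2 powr q * (2 * mean_pow q f s)" if s: "0 \<le> s" "s < 1" for n s
  proof -
    have c1: "continuous_on circle (\<lambda>u. f (of_real (S n) * (of_real s * u)))"
      using holomorphic_circle_continuous[OF dilation_holomorphic[OF f S(2,1)], of "of_real s" n] s by simp
    have c2: "continuous_on circle (\<lambda>u. f (of_real s * u))"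
      using s by (intro holomorphic_circle_continuous[OF f]) auto
    have "mean_pow q (?h n) s \<le> (\<integral>u. 2 powr q * (norm (f (of_real (S n) * (of_real s * u))) powr q + norm (f (of_real s * u)) powr q) \<partial>arc_measure)"
      unfolding mean_pow_def
    proof (rule integral_mono)
      show "integrable arc_measure (\<lambda>u. norm (?h n (of_real s * u)) powr q)"
        using q s by (intro continuous_on_circle_integrable continuous_on_powr_norm holomorphic_circle_continuous[OF hol]) auto
      show "integrable arc_measure (\<lambda>u. 2 powr q * (norm (f (of_real (S n) * (of_real s * u))) powr q + norm (f (of_real s * u)) powr q))"
        using c1 c2 q by (intro continuous_on_circle_integrable continuous_on_mult continuous_on_add continuous_on_const continuous_on_powr_norm) auto
      fix u
      have "norm (?h n (of_real s * u)) powr q \<le> (norm (f (of_real (S n) * (of_real s * u))) + norm (f (of_real s * u))) powr q"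
        using q norm_triangle_ineq4[of "f (of_real (S n) * (of_real s * u))" "f (of_real s * u)"] by (intro powr_mono2) auto
      also have "\<dots> \<le> 2 powr q * (norm (f (of_real (S n) * (of_real s * u))) powr q + norm (f (of_real s * u)) powr q)"
        using q by (intro powr_add_le) auto
      finally show "norm (?h n (of_real s * u)) powr q \<le> 2 powr q * (norm (f (of_real (S n) * (of_real s * u))) powr q + norm (f (of_real s * u)) powr q)" .
    qed
    also have "\<dots> = 2 powr q * ((\<integral>u. norm (f (of_real (S n) * (of_real s * u))) powr q \<partial>arc_measure) + mean_pow q f s)"
      unfolding mean_pow_def using q
      by (simp only: integral_mult_right_zero)
         (subst Bochner_Integration.integral_add, auto intro!: continuous_on_circle_integrable continuous_on_powr_norm c1 c2)
    also have "(\<integral>u. norm (f (of_real (S n) * (of_real s * u))) powr q \<partial>arc_measure) = mean_pow q f (S n * s)"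
      by (simp add: mean_pow_def mult.assoc)
    \<comment> \<open>Monotonicity of the mean makes the majorant independent of the
      dilation.\<close>
    also have "mean_pow q f (S n * s) \<le> mean_pow q f s"
      using s S(1,2)[of n] by (intro mean_pow_mono[OF q f]) (auto simp: mult_left_le_one_le)
    finally show ?thesis by simp
  qed
  have intf: "integrable radial_measure (\<lambda>s. 2 * s * mean_pow q f s)"
    using bergman_iff(1)[OF q f] fb by simp
  have mid: "(\<lambda>s. s) \<in> borel_measurable radial_measure" by (rule borel_radial) simp
  have "(\<lambda>n. \<integral>s. 2 * s * mean_pow q (?h n) s \<partial>radial_measure) \<longlonglongrightarrow> (\<integral>s. 0 \<partial>radial_measure)"
  proof (rule integral_dominated_convergence[where w = "\<lambda>s. 2 * 2 powr q * (2 * s * mean_pow q f s)"])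
    show "(\<lambda>s. 2 * s * mean_pow q (?h n) s) \<in> borel_measurable radial_measure" for n
      by (intro borel_measurable_times borel_measurable_const mid mean_pow_measurable(2)[OF q hol])
    show "integrable radial_measure (\<lambda>s. 2 * 2 powr q * (2 * s * mean_pow q f s))" using intf by (rule integrable_mult_right)
    show "AE s in radial_measure. (\<lambda>n. 2 * s * mean_pow q (?h n) s) \<longlonglongrightarrow> 0"
    proof (intro AE_I2)
      fix s assume "s \<in> space radial_measure"
      then have "(\<lambda>n. mean_pow q (?h n) s) \<longlonglongrightarrow> 0" by (intro pt) auto
      then show "(\<lambda>n. 2 * s * mean_pow q (?h n) s) \<longlonglongrightarrow> 0" by (rule tendsto_mult_right_zero)
    qed
    show "AE s in radial_measure. norm (2 * s * mean_pow q (?h n) s) \<le> 2 * 2 powr q * (2 * s * mean_pow q f s)" for n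
    proof (intro AE_I2)
      fix s assume "s \<in> space radial_measure"
      then have s: "0 \<le> s" "s < 1" by auto
      have "2 * s * mean_pow q (?h n) s \<le> 2 * s * (2 powr q * (2 * mean_pow q f s))"
        using s by (intro mult_left_mono bd) auto
      then show "norm (2 * s * mean_pow q (?h n) s) \<le> 2 * 2 powr q * (2 * s * mean_pow q f s)"
        using s mean_pow_nonneg[of q "?h n" s] by (simp add: abs_mult mult_ac)
    qed
  qed simp
  then have "(\<lambda>n. (\<integral>s. 2 * s * mean_pow q (?h n) s \<partial>radial_measure) powr (1/q)) \<longlonglongrightarrow> 0 powr (1/q)"
    using q by (intro tendsto_powr' tendsto_const) (auto intro!: always_eventually integral_nonneg_AE AE_I2 mult_nonneg_nonneg mean_pow_nonneg)
  then show "(\<lambda>n. Lp_norm q w (?h n)) \<longlonglongrightarrow> 0"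
    unfolding bergman_iff(2)[OF q hol] using q by simp
qed simp

text \<open>A bounded functional vanishing on monomials vanishes on every dilation \<open>f_r\<close>, because the
  Taylor series of \<open>f_r\<close> converges uniformly on the disc.\<close>
lemma dual_dilation:
  assumes q: "1 < q" and L: "L \<in> bergman_dual q w" and J: "J \<in> bergman_dual q w"
    and eq: "\<And>n. L (\<lambda>z. z ^ n) = J (\<lambda>z. z ^ n)"
    and f: "f holomorphic_on disc" and r: "0 < r" "r < 1"
  shows "L (\<lambda>z. f (of_real r * z)) = J (\<lambda>z. f (of_real r * z))"
proof -
  let ?c = "\<lambda>n. taylor_coeff f n * of_real r ^ n"
  let ?fr = "\<lambda>z. f (of_real r * z)"
  let ?P = "\<lambda>N z. \<Sum>n<N. ?c n * z ^ n"
  have sm: "summable (\<lambda>n. norm (?c n))" using r by (intro taylor_summable[OF f]) auto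
  have fr: "?fr \<in> bergman_space q w" by (rule dilation_bergman[OF q f r])
  have P: "?P N \<in> bergman_space q w" "L (?P N) = (\<Sum>n<N. ?c n * L (\<lambda>z. z ^ n))" "J (?P N) = (\<Sum>n<N. ?c n * J (\<lambda>z. z ^ n))" for N
    using dual_sum[OF q L, of "{..<N}" "\<lambda>n z. z ^ n" ?c] dual_sum[OF q J, of "{..<N}" "\<lambda>n z. z ^ n" ?c] power_in_bergman(1)[OF q]
    by auto
  have LJ: "L (?P N) = J (?P N)" for N by (simp only: P(2,3) eq)
  let ?R = "\<lambda>N z. ?fr z + (-1) * ?P N z"
  have Pm: "(\<lambda>z. (-1) * ?P N z) \<in> bergman_space q w" for N by (rule bergman_scale[OF P(1)])
  have RB: "?R N \<in> bergman_space q w" for N by (rule bergman_add[OF q fr Pm])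
  have split: "F (?R N) = F ?fr + (-1) * F (?P N)" if "F \<in> bergman_dual q w" for F N
  proof -
    have "F (?R N) = F ?fr + F (\<lambda>z. (-1) * ?P N z)" by (rule dual_add[OF that fr Pm])
    also have "F (\<lambda>z. (-1) * ?P N z) = (-1) * F (?P N)" by (rule dual_scale[OF that P(1)])
    finally show ?thesis .
  qed
  \<comment> \<open>The tail of the absolutely convergent coefficient series of the dilation bounds
    the Taylor remainder uniformly on the disc.\<close>
  define T where "T N = (\<Sum>n. norm (?c (n + N)))" for N
  have T0: "T \<longlonglongrightarrow> 0"
    unfolding T_def using suminf_exist_split2[OF sm] by simp
  have Tnn: "0 \<le> T N" for N unfolding T_def
    by (intro suminf_nonneg summable_ignore_initial_segment[OF sm] norm_ge_zero)
  have Rb: "Lp_norm q w (?R N) \<le> T N * (2 * kappa 0) powr (1 / q)" for N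
  proof (rule bergman_bounded(2)[OF q _ Tnn])
    show "?R N holomorphic_on disc" using RB[of N] by (simp add: bergman_space_def)
    fix z :: complex assume z: "z \<in> disc"
    then have "norm (of_real r * z) < 1" using r mult_left_le_one_le[of "norm z" r] by (simp add: norm_mult)
    from taylor_sums[OF f this] have s: "(\<lambda>n. ?c n * z ^ n) sums ?fr z" by (simp add: power_mult_distrib mult.assoc)
    have le: "norm (?c n * z ^ n) \<le> norm (?c n)" for n
      using z unfolding norm_mult[of "?c n"] norm_power by (intro mult_right_le_one_le power_le_one) auto
    have le_shift: "norm (?c (n + N) * z ^ (n + N)) \<le> norm (?c (n + N))" for n by (rule le)
    have "(\<lambda>n. ?c (n + N) * z ^ (n + N)) sums (?fr z - ?P N z)"
      using s by (rule sums_split_initial_segment)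
    then have "?R N z = (\<Sum>n. ?c (n + N) * z ^ (n + N))" by (simp add: sums_iff)
    also have "norm \<dots> \<le> T N" unfolding T_def
      by (intro norm_suminf_le le_shift summable_ignore_initial_segment[OF sm])
    finally show "norm (?R N z) \<le> T N" .
  qed
  have lim: "(\<lambda>N. F (?R N)) \<longlonglongrightarrow> 0" if F: "F \<in> bergman_dual q w" for F
  proof (rule Lim_null_comparison)
    show "eventually (\<lambda>N. norm (F (?R N)) \<le> bergman_dual_norm q w F * (T N * (2 * kappa 0) powr (1 / q))) sequentially"
      using order_trans[OF dual_bound(2)[OF q F RB] mult_left_mono[OF Rb dual_bound(1)[OF q F]]] by (intro always_eventually allI)
    show "(\<lambda>N. bergman_dual_norm q w F * (T N * (2 * kappa 0) powr (1 / q))) \<longlonglongrightarrow> 0"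
      by (intro tendsto_mult_right_zero tendsto_mult_left_zero T0)
  qed
  have "(\<lambda>N. L (?R N) - J (?R N)) \<longlonglongrightarrow> 0 - 0" by (intro tendsto_diff lim L J)
  moreover have "L (?R N) - J (?R N) = L ?fr - J ?fr" for N unfolding split[OF L] split[OF J] LJ by simp
  ultimately have "(\<lambda>N::nat. L ?fr - J ?fr) \<longlonglongrightarrow> 0" by simp
  then show ?thesis by (simp add: LIMSEQ_const_iff)
qed

text \<open>Integration against g is itself a bounded functional J because g lies in the Bergman
  space. It agrees with L on monomials, hence on dilations, and \<open>L f_r\<close> tends to
  \<open>L f\<close> by continuity.\<close>

lemma has_pairing:
  assumes qp: "1 < q" "1 / q + 1 / p = 1" and L: "L \<in> bergman_dual q w" and g: "g \<in> bergman_space p w"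
    and mon: "\<And>n. L (\<lambda>z. z ^ n) = cnj (taylor_coeff g n) * of_real (2 * kappa n)"
    and f: "f \<in> bergman_space q w"
  shows "has_A2_pairing w f g (L f)"
proof -
  note p = conjugate_exponent[OF qp]
  have gh: "g holomorphic_on disc" "g \<in> Lp_space p w" using g by (auto simp: bergman_space_def)
  have fh: "f holomorphic_on disc" using f by (auto simp: bergman_space_def)
  define J where "J h = (\<integral>z. h z * cnj (g z) * of_real (w (norm z)) \<partial>area_measure)" for h
  have int: "integrable area_measure (\<lambda>z. h z * cnj (g z) * of_real (w (norm z)))"
    and bd: "norm (J h) \<le> Lp_norm p w g * Lp_norm q w h" if "h \<in> bergman_space q w" for h
    using Hoelder_disc[OF qp bergman_Lp[OF that] Lp_cnj(1)[OF gh(2)]] Lp_cnj(2)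
    by (simp_all add: J_def mult.commute)
  have J: "J \<in> bergman_dual q w"
    unfolding bergman_dual_def
  proof (intro CollectI conjI ballI allI exI[of _ "Lp_norm p w g"])
    fix h h' assume "h \<in> bergman_space q w" "h' \<in> bergman_space q w"
    then show "J (\<lambda>z. h z + h' z) = J h + J h'"
      unfolding J_def distrib_right by (intro Bochner_Integration.integral_add int)
  next
    fix a h show "J (\<lambda>z. a * h z) = a * J h" unfolding J_def by (simp add: mult.assoc)
  qed (rule bd)
  have Jm: "L (\<lambda>z. z ^ n) = J (\<lambda>z. z ^ n)" for n
  proof -
    have "J (\<lambda>z. z ^ n) = (\<integral>z. cnj (cnj z ^ n * g z * of_real (w (norm z))) \<partial>area_measure)" by (simp add: J_def)
    also have "\<dots> = cnj (taylor_coeff g n * of_real (2 * kappa n))"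
      unfolding Bochner_Integration.integral_cnj coeff_disc(1)[OF gh(1) Lp_integrable[OF p(1) gh(2)]] ..
    finally show ?thesis using mon[of n] by simp
  qed
  let ?fr = "\<lambda>r z. f (of_real r * z)"
  have LJ: "L (?fr r) = J (?fr r)" if "0 < r" "r < 1" for r
    by (rule dual_dilation[OF qp(1) L J Jm fh that])
  have "((\<lambda>r. L (?fr r)) \<longlongrightarrow> L f) (at_left 1)"
  proof (rule LIM_zero_cancel, rule Lim_null_comparison)
    show "((\<lambda>r. bergman_dual_norm q w L * Lp_norm q w (\<lambda>z. ?fr r z + (-1) * f z)) \<longlongrightarrow> 0) (at_left 1)"
      by (intro tendsto_mult_right_zero dilation_tendsto qp(1) f)
    have "eventually (\<lambda>r::real. r \<in> {0<..<1}) (at_left 1)" by (rule eventually_at_left_real) simp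
    then show "eventually (\<lambda>r. norm (L (?fr r) - L f) \<le> bergman_dual_norm q w L * Lp_norm q w (\<lambda>z. ?fr r z + (-1) * f z)) (at_left 1)"
    proof eventually_elim
      fix r :: real assume "r \<in> {0<..<1}"
      then have fr: "?fr r \<in> bergman_space q w" using dilation_bergman[OF qp(1) fh] by simp
      have fm: "(\<lambda>z. (-1) * f z) \<in> bergman_space q w" by (rule bergman_scale[OF f])
      have "L (\<lambda>z. ?fr r z + (-1) * f z) = L (?fr r) + L (\<lambda>z. (-1) * f z)"
        by (rule dual_add[OF L fr fm])
      also have "L (\<lambda>z. (-1) * f z) = (-1) * L f" by (rule dual_scale[OF L f])
      finally have "L (\<lambda>z. ?fr r z + (-1) * f z) = L (?fr r) - L f" by simp
      then show "norm (L (?fr r) - L f) \<le> bergman_dual_norm q w L * Lp_norm q w (\<lambda>z. ?fr r z + (-1) * f z)"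
        using dual_bound(2)[OF qp(1) L bergman_add[OF qp(1) fr fm]] by simp
    qed
  qed
  moreover have "eventually (\<lambda>r. L (?fr r) = J (?fr r)) (at_left 1)"
    using eventually_at_left_real[of 0 1] by (auto elim!: eventually_mono simp: LJ)
  ultimately have "((\<lambda>r. J (?fr r)) \<longlongrightarrow> L f) (at_left 1)"
    by (rule Lim_transform_eventually)
  then show ?thesis
    unfolding has_A2_pairing_def J_def using int[OF dilation_bergman[OF qp(1) fh]] by auto
qed

text \<open>The coefficients of g are forced by L; the work is the norm bound. It is obtained for
  finitely many blocks by testing L on a dual function, and passes to g by Fatou's lemma.\<close>

theorem dual_representation:
  assumes pq: "1 < p" "1 / p + 1 / q = 1" and dbl: "upper_doubling w"
  shows "\<exists>C>0. \<forall>L\<in>bergman_dual q w. \<exists>g\<in>bergman_space p w.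
     Lp_norm p w g \<le> C * bergman_dual_norm q w L \<and>
     (\<forall>n. L (\<lambda>z. z ^ n) = cnj (taylor_coeff g n) * of_real (2 * kappa n))"
proof -
  note q = conjugate_exponent[OF pq]
  obtain Ap where Ap: "0 < Ap" and NP': "\<forall>c N. (\<lambda>z. \<Sum>n<N. block_sum (c n) n z) \<in> bergman_space p w \<and>
     Lp_norm p w (\<lambda>z. \<Sum>n<N. block_sum (c n) n z) powr p \<le> Ap * (\<Sum>n<N. circle_norm_p p (block_sum (c n) n) powr p / 2 ^ n)"
    using block_norm[OF pq(1) dbl] by (elim exE conjE)
  note NP = NP'[THEN spec, THEN spec]
  obtain Aq where Aq: "0 < Aq" and NQ': "\<forall>c N. (\<lambda>z. \<Sum>n<N. block_sum (c n) n z) \<in> bergman_space q w \<and>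
     Lp_norm q w (\<lambda>z. \<Sum>n<N. block_sum (c n) n z) powr q \<le> Aq * (\<Sum>n<N. circle_norm_p q (block_sum (c n) n) powr q / 2 ^ n)"
    using block_norm[OF q(1) dbl] by (elim exE conjE)
  note NQ = NQ'[THEN spec, THEN spec]
  obtain R where R: "0 < R" and RM': "\<forall>\<phi> (\<mu>::nat \<Rightarrow> real) a b. continuous_on circle \<phi> \<longrightarrow> mono \<mu> \<longrightarrow> 0 \<le> \<mu> a \<longrightarrow>
     circle_norm_p q (\<lambda>v. \<Sum>k=a..<Suc b. of_real (\<mu> k) * fourier \<phi> k * v ^ k) \<le> R * \<bar>\<mu> b\<bar> * circle_norm_p q \<phi>"
    using Riesz_multiplier[OF q(1)] by (elim exE conjE)
  note RM = RM'[THEN spec, THEN spec, THEN spec, THEN spec, THEN mp, THEN mp, THEN mp]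
  \<comment> \<open>Collects the block estimate for exponent q and the multiplier bound on one
    block; C adds the block estimate for exponent p.\<close>
  define K where "K = Aq powr (1/q) * (R / kappa 0)"
  have K: "0 < K" using Aq R kappa_pos[of 0] by (simp add: K_def)
  define C where "C = Ap powr (1/p) * K"
  have C: "0 < C" using Ap K by (simp add: C_def)
  \<comment> \<open>The coefficients of the kernel, increasing because the moments decrease, so the
    monotone multiplier theorem applies.\<close>
  define \<mu> where "\<mu> k = 1 / (2 * kappa k)" for k
  have \<mu>: "0 < \<mu> k" for k using kappa_pos by (simp add: \<mu>_def)
  have mono\<mu>: "mono \<mu>"
    unfolding \<mu>_def using kappa_antimono kappa_pos by (intro monoI divide_left_mono) auto
  have "\<exists>g\<in>bergman_space p w. Lp_norm p w g \<le> C * bergman_dual_norm q w L \<and>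
     (\<forall>n. L (\<lambda>z. z ^ n) = cnj (taylor_coeff g n) * of_real (2 * kappa n))"
    if L: "L \<in> bergman_dual q w" for L
  proof -
    define S where "S = bergman_dual_norm q w L"
    note LS = dual_bound[OF q(1) L, folded S_def]
    define \<gamma> where "\<gamma> k = cnj (L (\<lambda>z. z ^ k)) * of_real (\<mu> k)" for k
    have pw: "(\<lambda>z. z ^ k) \<in> bergman_space q w" for k by (rule power_in_bergman(1)[OF q(1)])
    have \<gamma>L: "L (\<lambda>z. z ^ k) = cnj (\<gamma> k) * of_real (2 * kappa k)" for k
      using kappa_pos[of k] by (simp add: \<gamma>_def \<mu>_def)
    have \<gamma>b: "norm (\<gamma> k) \<le> (S * (2 * weight_moment w 0) powr (1 / q)) / kappa k" for k
    proof -
      have "Lp_norm q w (\<lambda>z. z ^ k) \<le> (2 * weight_moment w 0) powr (1 / q)"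
        unfolding power_in_bergman(2)[OF q(1)] using q(1) moment_nonneg
        by (intro powr_mono2 mult_left_mono moment_antimono) auto
      then have "norm (L (\<lambda>z. z ^ k)) \<le> S * (2 * weight_moment w 0) powr (1 / q)"
        using order_trans[OF LS(2)[OF pw] mult_left_mono[OF _ LS(1)]] by blast
      moreover have "\<mu> k \<le> 1 / kappa k" unfolding \<mu>_def using kappa_pos[of k] by (intro divide_left_mono) auto
      ultimately have "norm (L (\<lambda>z. z ^ k)) * \<mu> k \<le> (S * (2 * weight_moment w 0) powr (1 / q)) * (1 / kappa k)"
        using \<mu>[of k] LS(1) by (intro mult_mono) auto
      then show ?thesis using \<mu>[of k] by (simp add: \<gamma>_def norm_mult)
    qed
    have sm: "summable (\<lambda>k. norm (\<gamma> k) * x ^ k)" if "0 \<le> x" "x < 1" for x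
    proof (rule summable_comparison_test'[where N = 0])
      show "summable (\<lambda>k. (S * (2 * weight_moment w 0) powr (1 / q)) * (x ^ k / kappa k))"
        by (intro summable_mult summable_inverse_kappa that)
      fix k
      show "norm (norm (\<gamma> k) * x ^ k) \<le> (S * (2 * weight_moment w 0) powr (1 / q)) * (x ^ k / kappa k)"
        using mult_right_mono[OF \<gamma>b[of k], of "x ^ k"] that by simp
    qed
    define g where "g z = (\<Sum>k. \<gamma> k * z ^ k)" for z
    have gs: "(\<lambda>k. \<gamma> k * z ^ k) sums g z" if "z \<in> disc" for z
    proof -
      have "summable (\<lambda>k. norm (\<gamma> k * z ^ k))" using sm[of "norm z"] that by (simp add: norm_mult norm_power)
      then show ?thesis unfolding g_def by (rule summable_sums[OF summable_norm_cancel])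
    qed
    have gh: "g holomorphic_on disc"
      by (rule power_series_holomorphic) (use gs in simp)
    have tc: "taylor_coeff g n = \<gamma> n" for n
      by (rule taylor_coeff_power_series[OF gh gs]) (use sm[of "1/2"] in auto)
    let ?G = "\<lambda>n. block_sum \<gamma> n"
    define x where "x n = circle_norm_p p (?G n)" for n
    define X where "X N = (\<Sum>n<N. x n powr p / 2 ^ n)" for N
    have X0: "0 \<le> X N" for N unfolding X_def by (intro sum_nonneg) auto
    have XS: "X N powr (1/p) \<le> K * S" for N
    proof -
      define \<phi> where "\<phi> n u = dual_pow p (?G n u)" for n u
      have cont\<phi>: "continuous_on circle (\<phi> n)" for n
        unfolding \<phi>_def by (intro continuous_on_compose2[OF continuous_dual_pow[OF pq(1)]] continuous_intros) auto
      have xp: "x n powr p = (\<integral>u. norm (?G n u) powr p \<partial>arc_measure)" for n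
        unfolding x_def using pq(1) by (intro circle_norm_p_powr) auto
      have \<phi>q: "circle_norm_p q (\<phi> n) powr q = x n powr p" for n
      proof -
        have "norm (\<phi> n u) powr q = norm (?G n u) powr p" for u
          using q(2) by (simp add: \<phi>_def norm_dual_pow powr_powr)
        then show ?thesis unfolding xp using q(1) by (subst circle_norm_p_powr) auto
      qed
      \<comment> \<open>The factor \<open>\<mu> k\<close> cancels \<open>2 * kappa k\<close> in
        \<open>L (z^k)\<close>, leaving the Parseval pairing of \<open>\<phi> n\<close> with the
        block of g; \<open>2^-n\<close> gives block n its weight in X.\<close>
      define c where "c n k = of_real (1 / 2 ^ n) * (of_real (\<mu> k) * fourier (\<phi> n) k)" for n k
      have yn: "circle_norm_p q (block_sum (c n) n) \<le> (R / kappa 0) * circle_norm_p q (\<phi> n)" for n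
      proof (cases "block n < block (Suc n)")
        case False
        then have "block_sum (c n) n = (\<lambda>z. 0)" by (simp add: block_sum_def fun_eq_iff)
        then have "circle_norm_p q (block_sum (c n) n) = 0" using q(1) by (simp add: circle_norm_p_def)
        then show ?thesis using R kappa_pos[of 0] by simp
      next
        case True
        \<comment> \<open>The multiplier bound is taken at the last frequency of the block, whose
          moment still exceeds \<open>kappa 0 / 2^(n+1)\<close>; hence
          \<open>\<mu> b \<le> 2^n / kappa 0\<close> absorbs the factor \<open>2^-n\<close>.\<close>
        then obtain b where b: "block (Suc n) = Suc b" by (cases "block (Suc n)") auto
        have "block_sum (c n) n = (\<lambda>v. of_real (1 / 2 ^ n) * (\<Sum>k=block n..<Suc b. of_real (\<mu> k) * fourier (\<phi> n) k * v ^ k))"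
          unfolding block_sum_def c_def b sum_distrib_left by (simp add: mult.assoc)
        then have "circle_norm_p q (block_sum (c n) n) = (1 / 2 ^ n) * circle_norm_p q (\<lambda>v. \<Sum>k=block n..<Suc b. of_real (\<mu> k) * fourier (\<phi> n) k * v ^ k)"
          using q(1) by (simp only:) (subst circle_norm_p_scale, auto simp: norm_divide norm_power)
        also have "\<dots> \<le> (1 / 2 ^ n) * (R * \<bar>\<mu> b\<bar> * circle_norm_p q (\<phi> n))"
          using \<mu> by (intro mult_left_mono RM cont\<phi> mono\<mu>) (auto simp: less_imp_le)
        also have "\<bar>\<mu> b\<bar> \<le> 2 ^ n / kappa 0"
        proof -
          have "kappa 0 / 2 ^ Suc n < kappa b" using b by (intro block_gt) simp
          then have "1 / (2 * kappa b) \<le> 1 / (2 * (kappa 0 / 2 ^ Suc n))"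
            using kappa_pos[of b] kappa_pos[of 0] by (intro divide_left_mono) auto
          also have "\<dots> = 2 ^ n / kappa 0" by simp
          finally show ?thesis using \<mu>[of b] by (simp add: \<mu>_def)
        qed
        then have "(1 / 2 ^ n) * (R * \<bar>\<mu> b\<bar> * circle_norm_p q (\<phi> n)) \<le> (1 / 2 ^ n) * (R * (2 ^ n / kappa 0) * circle_norm_p q (\<phi> n))"
          using R by (intro mult_left_mono mult_right_mono) auto
        finally show ?thesis by simp
      qed
      let ?F = "\<lambda>z. \<Sum>n<N. block_sum (c n) n z"
      have FN: "Lp_norm q w ?F \<le> K * X N powr (1/q)"
      proof -
        have "Lp_norm q w ?F powr q \<le> Aq * (\<Sum>n<N. circle_norm_p q (block_sum (c n) n) powr q / 2 ^ n)"
          by (rule conjunct2[OF NQ])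
        also have "\<dots> \<le> Aq * (\<Sum>n<N. ((R / kappa 0) powr q * x n powr p) / 2 ^ n)"
        proof (intro mult_left_mono sum_mono divide_right_mono)
          fix n
          have "circle_norm_p q (block_sum (c n) n) powr q \<le> ((R / kappa 0) * circle_norm_p q (\<phi> n)) powr q"
            using q(1) yn by (intro powr_mono2) auto
          also have "\<dots> = (R / kappa 0) powr q * x n powr p" by (simp only: powr_mult \<phi>q)
          finally show "circle_norm_p q (block_sum (c n) n) powr q \<le> (R / kappa 0) powr q * x n powr p" .
        qed (use Aq in auto)
        also have "\<dots> = Aq * ((R / kappa 0) powr q * X N)" by (simp add: X_def sum_distrib_left)
        finally have "(Lp_norm q w ?F powr q) powr (1/q) \<le> (Aq * ((R / kappa 0) powr q * X N)) powr (1/q)"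
          using q(1) by (intro powr_mono2) auto
        also have "(Lp_norm q w ?F powr q) powr (1/q) = Lp_norm q w ?F"
          using q(1) Lp_norm_nonneg[of q ?F] by (simp only: powr_powr) simp
        also have "(Aq * ((R / kappa 0) powr q * X N)) powr (1/q) = K * X N powr (1/q)"
          using q(1) R kappa_pos[of 0] by (simp add: powr_mult powr_powr K_def)
        finally show ?thesis .
      qed
      \<comment> \<open>No inequality is lost here: the pairing of each block with its dual function
        is exactly its p-th power norm.\<close>
      have LF: "L ?F = of_real (X N)"
      proof -
        have bs: "block_sum (c n) n \<in> bergman_space q w \<and> L (block_sum (c n) n) = of_real (x n powr p / 2 ^ n)" for n
        proof -
          have d: "block_sum (c n) n \<in> bergman_space q w \<and> L (block_sum (c n) n) = (\<Sum>k=block n..<block (Suc n). c n k * L (\<lambda>z. z ^ k))"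
            unfolding block_sum_def[abs_def] by (rule dual_sum[OF q(1) L _ pw]) simp
          have "(\<Sum>k=block n..<block (Suc n). c n k * L (\<lambda>z. z ^ k)) = (\<Sum>k=block n..<block (Suc n). of_real (1 / 2 ^ n) * (fourier (\<phi> n) k * cnj (\<gamma> k)))"
            unfolding c_def \<gamma>L using kappa_pos by (intro sum.cong refl) (simp add: \<mu>_def less_imp_neq[symmetric])
          also have "\<dots> = of_real (1 / 2 ^ n) * (\<Sum>k=block n..<block (Suc n). fourier (\<phi> n) k * cnj (\<gamma> k))"
            by (rule sum_distrib_left[symmetric])
          also have "(\<Sum>k=block n..<block (Suc n). fourier (\<phi> n) k * cnj (\<gamma> k)) = (\<integral>u. (\<Sum>k=block n..<block (Suc n). \<phi> n u * cnj u ^ k * cnj (\<gamma> k)) \<partial>arc_measure)"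
            unfolding fourier_def using cont\<phi>[of n]
            by (subst Bochner_Integration.integral_sum) (auto intro!: continuous_on_circle_integrable continuous_intros)
          also have "\<dots> = (\<integral>u. of_real (norm (?G n u) powr p) \<partial>arc_measure)"
          proof (rule Bochner_Integration.integral_cong[OF refl])
            fix u
            have "(\<Sum>k=block n..<block (Suc n). \<phi> n u * cnj u ^ k * cnj (\<gamma> k)) = \<phi> n u * cnj (?G n u)"
              by (simp add: block_sum_def sum_distrib_left mult_ac)
            then show "(\<Sum>k=block n..<block (Suc n). \<phi> n u * cnj u ^ k * cnj (\<gamma> k)) = of_real (norm (?G n u) powr p)"
              unfolding \<phi>_def dual_pow_mult_cnj .
          qed
          also have "\<dots> = of_real (x n powr p)" unfolding xp by simp
          finally show ?thesis using d by simp
        qed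
        have "L (\<lambda>z. \<Sum>n<N. 1 * block_sum (c n) n z) = (\<Sum>n<N. 1 * L (block_sum (c n) n))"
          using dual_sum[OF q(1) L, of "{..<N}" "\<lambda>n. block_sum (c n) n" "\<lambda>_. 1"] conjunct1[OF bs] by simp
        then show ?thesis using bs by (simp add: X_def)
      qed
      have "X N = norm (L ?F)" unfolding LF using X0 by simp
      also have "\<dots> \<le> S * Lp_norm q w ?F" by (rule LS(2)[OF conjunct1[OF NQ]])
      also have "\<dots> \<le> S * (K * X N powr (1/q))" using FN LS(1) by (intro mult_left_mono)
      \<comment> \<open>X is finite, so \<open>X^(1/q)\<close> may be cancelled; the resulting bound
        does not depend on N.\<close>
      finally have *: "X N \<le> (K * S) * X N powr (1/q)" by (simp add: mult_ac)
      show ?thesis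
      proof (cases "X N = 0")
        case True
        then show ?thesis using K LS(1) by simp
      next
        case False
        then have XN: "0 < X N" using X0[of N] by simp
        have "X N powr (1/p) * X N powr (1/q) = X N" using XN pq by (simp flip: powr_add)
        then have "X N powr (1/p) * X N powr (1/q) \<le> (K * S) * X N powr (1/q)" using * by simp
        then show ?thesis using XN by (simp add: mult_le_cancel_right)
      qed
    qed
    let ?GN = "\<lambda>N z. \<Sum>n<N. ?G n z"
    have GNb: "(\<integral>\<^sup>+z. ennreal (norm (?GN N z) powr p * w (norm z)) \<partial>area_measure) \<le> ennreal ((C * S) powr p)" for N
    proof -
      have b: "?GN N \<in> bergman_space p w" "Lp_norm p w (?GN N) powr p \<le> Ap * X N"
        unfolding X_def x_def by (rule conjunct1[OF NP], rule conjunct2[OF NP])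
      have "(\<integral>\<^sup>+z. ennreal (norm (?GN N z) powr p * w (norm z)) \<partial>area_measure) = ennreal (Lp_norm p w (?GN N) powr p)"
        using polar_mean_pow[OF pq(1) bergman_integral(2)[OF pq(1) b(1)]] bergman_integral(1)[OF pq(1) b(1)] by simp
      also have "\<dots> \<le> ennreal ((C * S) powr p)"
      proof (rule ennreal_leI)
        have "X N = (X N powr (1/p)) powr p" using X0[of N] pq(1) by (simp add: powr_powr)
        also have "\<dots> \<le> (K * S) powr p" using XS pq(1) by (intro powr_mono2) auto
        finally have "Ap * X N \<le> Ap * (K * S) powr p" using Ap by (intro mult_left_mono) auto
        also have "\<dots> = (C * S) powr p" using Ap pq(1) by (simp add: C_def powr_mult powr_powr)
        finally show "Lp_norm p w (?GN N) powr p \<le> (C * S) powr p" using b(2) by linarith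
      qed
      finally show ?thesis .
    qed
    have conv: "(\<lambda>N. ?GN N z) \<longlonglongrightarrow> g z" if "z \<in> disc" for z
    proof -
      have "(\<lambda>M. \<Sum>k<M. \<gamma> k * z ^ k) \<longlonglongrightarrow> g z" using gs[OF that] by (simp add: sums_def)
      then have "(\<lambda>N. \<Sum>k<block N. \<gamma> k * z ^ k) \<longlonglongrightarrow> g z" by (rule filterlim_compose[OF _ block_unbounded])
      then show ?thesis unfolding block_sum_def sum_blocks .
    qed
    have "(\<integral>\<^sup>+z. ennreal (norm (g z) powr p * w (norm z)) \<partial>area_measure) = (\<integral>\<^sup>+z. liminf (\<lambda>N. ennreal (norm (?GN N z) powr p * w (norm z))) \<partial>area_measure)"
    proof (rule nn_integral_cong)
      fix z assume "z \<in> space area_measure"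
      then have "(\<lambda>N. norm (?GN N z) powr p * w (norm z)) \<longlonglongrightarrow> norm (g z) powr p * w (norm z)"
        using conv[of z] pq(1) by (intro tendsto_mult tendsto_powr' tendsto_norm tendsto_const) auto
      then have "(\<lambda>N. ennreal (norm (?GN N z) powr p * w (norm z))) \<longlonglongrightarrow> ennreal (norm (g z) powr p * w (norm z))"
        by (rule tendsto_ennrealI)
      then show "ennreal (norm (g z) powr p * w (norm z)) = liminf (\<lambda>N. ennreal (norm (?GN N z) powr p * w (norm z)))"
        by (intro lim_imp_Liminf[symmetric]) auto
    qed
    \<comment> \<open>Fatou's lemma: the block sums converge pointwise to g and their norms are
      uniformly bounded.\<close>
    also have "\<dots> \<le> liminf (\<lambda>N. \<integral>\<^sup>+z. ennreal (norm (?GN N z) powr p * w (norm z)) \<partial>area_measure)"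
    proof (rule nn_integral_liminf)
      fix N
      have [measurable]: "?GN N \<in> borel_measurable area_measure"
        by (intro borel_measurable_area_continuous continuous_intros)
      show "(\<lambda>z. ennreal (norm (?GN N z) powr p * w (norm z))) \<in> borel_measurable area_measure" by measurable
    qed
    also have "\<dots> \<le> ennreal ((C * S) powr p)"
      by (rule Liminf_le) (use GNb in \<open>auto intro: always_eventually\<close>)
    finally have "(\<integral>\<^sup>+r. ennreal (2 * r * mean_pow p g r) \<partial>radial_measure) \<le> ennreal ((C * S) powr p)"
      using polar_mean_pow[OF pq(1) gh] by simp
    from bergmanI[OF pq(1) gh _ this] have "g \<in> bergman_space p w" "Lp_norm p w g \<le> C * S"
      using C LS(1) by auto
    then show ?thesis using tc \<gamma>L by (intro bexI[of _ g]) (auto simp: S_def)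
  qed
  with C show ?thesis by blast
qed

theorem doubling_imp_duality:
  assumes pq: "1 < p" "1 / p + 1 / q = 1" and dbl: "upper_doubling w"
  shows "\<exists>C>0. \<forall>L\<in>bergman_dual q w.
         \<exists>g\<in>dirichlet_space p w k.
           (\<forall>f\<in>bergman_space q w. has_A2_pairing w f g (L f)) \<and>
           dirichlet_norm p w k g \<le> C * bergman_dual_norm q w L \<and>
           (\<forall>h\<in>dirichlet_space p w k.
              (\<forall>f\<in>bergman_space q w. has_A2_pairing w f h (L f)) \<longrightarrow>
              (\<forall>z\<in>disc. h z = g z))"
proof -
  note q = conjugate_exponent[OF pq]
  have qp: "1 / q + 1 / p = 1" using pq by simp
  obtain C1 where C1: "0 < C1" and rep: "\<forall>L\<in>bergman_dual q w. \<exists>g\<in>bergman_space p w.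
     Lp_norm p w g \<le> C1 * bergman_dual_norm q w L \<and>
     (\<forall>n. L (\<lambda>z. z ^ n) = cnj (taylor_coeff g n) * of_real (2 * kappa n))"
    using dual_representation[OF pq dbl] by (elim exE conjE)
  obtain C2 where C2: "\<And>f. f \<in> bergman_space p w \<Longrightarrow> f \<in> dirichlet_space p w k \<and> dirichlet_norm p w k f \<le> C2 * Lp_norm p w f"
    using identity_bounded[OF pq(1) dbl, of k] unfolding bounded_between_def by blast
  \<comment> \<open>C2 comes without a sign; the maximum keeps the product positive.\<close>
  define C where "C = max 1 C2 * C1"
  have C: "0 < C" using C1 by (simp add: C_def)
  have main: "\<exists>g\<in>dirichlet_space p w k.
           (\<forall>f\<in>bergman_space q w. has_A2_pairing w f g (L f)) \<and>
           dirichlet_norm p w k g \<le> C * bergman_dual_norm q w L \<and>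
           (\<forall>h\<in>dirichlet_space p w k.
              (\<forall>f\<in>bergman_space q w. has_A2_pairing w f h (L f)) \<longrightarrow>
              (\<forall>z\<in>disc. h z = g z))" if L: "L \<in> bergman_dual q w" for L
  proof -
    obtain g where g: "g \<in> bergman_space p w" "Lp_norm p w g \<le> C1 * bergman_dual_norm q w L"
      "\<forall>n. L (\<lambda>z. z ^ n) = cnj (taylor_coeff g n) * of_real (2 * kappa n)"
      using bspec[OF rep L] by (elim bexE conjE)
    note g3 = g(3)[THEN spec]
    have gh: "g holomorphic_on disc" using g(1) by (simp add: bergman_space_def)
    have "dirichlet_norm p w k g \<le> C2 * Lp_norm p w g" using C2[OF g(1)] by simp
    also have "\<dots> \<le> max 1 C2 * Lp_norm p w g" by (intro mult_right_mono Lp_norm_nonneg) simp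
    also have "\<dots> \<le> max 1 C2 * (C1 * bergman_dual_norm q w L)" by (intro mult_left_mono g(2)) simp
    finally have norm: "dirichlet_norm p w k g \<le> C * bergman_dual_norm q w L" by (simp add: C_def mult.assoc)
    have uniq: "h z = g z" if h: "h \<in> dirichlet_space p w k" "\<forall>f\<in>bergman_space q w. has_A2_pairing w f h (L f)" and z: "z \<in> disc" for h z
    proof -
      have hh: "h holomorphic_on disc" using h(1) by (simp add: dirichlet_space_def)
      have "taylor_coeff h n = taylor_coeff g n" for n
      proof -
        have "L (\<lambda>z. z ^ n) = cnj (taylor_coeff h n) * of_real (2 * kappa n)"
          by (rule pairing_power[OF hh h(2)[rule_format, OF power_in_bergman(1)[OF q(1)]] h(2)[rule_format, OF power_in_bergman(1)[OF q(1)]]])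
        with g3[of n] have "cnj (taylor_coeff h n) = cnj (taylor_coeff g n)" using kappa_pos[of n] by simp
        then show ?thesis by simp
      qed
      then have "(\<lambda>n. taylor_coeff g n * z ^ n) sums h z" using taylor_sums[OF hh, of z] z by simp
      then show ?thesis using taylor_sums[OF gh, of z] z sums_unique2 by auto
    qed
    show ?thesis
    proof (intro bexI[of _ g] conjI ballI impI)
      show "has_A2_pairing w f g (L f)" if "f \<in> bergman_space q w" for f
        by (rule has_pairing[OF q(1) qp L g(1) g3 that])
      show "dirichlet_norm p w k g \<le> C * bergman_dual_norm q w L" by (rule norm)
      show "g \<in> dirichlet_space p w k" using C2[OF g(1)] by simp
      show "h z = g z" if "h \<in> dirichlet_space p w k" "\<forall>f\<in>bergman_space q w. has_A2_pairing w f h (L f)" "z \<in> disc" for h z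
        by (rule uniq[OF that])
    qed
  qed
  show ?thesis by (intro exI[of _ C] conjI C ballI main)
qed

end

theorem theorem11:
  fixes w :: "real \<Rightarrow> real" and p p' :: real and k :: nat
  assumes "radial_weight w"
    and "1 < p" and "1 / p + 1 / p' = 1"
    and "1 \<le> k"
  defines "stmt_i \<equiv>
      bounded_between (Lp_space p w) (Lp_norm p w)
        (dirichlet_space p w k) (dirichlet_norm p w k) (bergman_projection w)"
    and "stmt_ii \<equiv>
      (\<exists>C>0. \<forall>L\<in>bergman_dual p' w.
         \<exists>g\<in>dirichlet_space p w k.
           (\<forall>f\<in>bergman_space p' w. has_A2_pairing w f g (L f)) \<and>
           dirichlet_norm p w k g \<le> C * bergman_dual_norm p' w L \<and>
           (\<forall>h\<in>dirichlet_space p w k.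
              (\<forall>f\<in>bergman_space p' w. has_A2_pairing w f h (L f)) \<longrightarrow>
              (\<forall>z\<in>disc. h z = g z)))"
    and "stmt_iii \<equiv>
      bounded_between (bergman_space p w) (Lp_norm p w)
        (dirichlet_space p w k) (dirichlet_norm p w k) (\<lambda>f. f)"
    and "stmt_iv \<equiv> upper_doubling w"
  shows "(stmt_i \<longleftrightarrow> stmt_ii) \<and> (stmt_ii \<longleftrightarrow> stmt_iii) \<and> (stmt_iii \<longleftrightarrow> stmt_iv)"
proof -
  interpret positive_weight w
    using assms(1) unfolding radial_weight_def by unfold_locales auto
  have "stmt_i" if ii: "stmt_ii"
  proof -
    obtain C where C: "C > 0" and rep: "\<forall>L\<in>bergman_dual p' w. \<exists>g\<in>dirichlet_space p w k.
           (\<forall>f\<in>bergman_space p' w. has_A2_pairing w f g (L f)) \<and>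
           dirichlet_norm p w k g \<le> C * bergman_dual_norm p' w L \<and>
           (\<forall>h\<in>dirichlet_space p w k.
              (\<forall>f\<in>bergman_space p' w. has_A2_pairing w f h (L f)) \<longrightarrow>
              (\<forall>z\<in>disc. h z = g z))"
      using ii unfolding stmt_ii_def by (elim exE conjE)
    show ?thesis unfolding stmt_i_def
    proof (rule duality_imp_projection_bounded[OF assms(2,3) C])
      fix L assume "L \<in> bergman_dual p' w"
      from bspec[OF rep this] show "\<exists>g\<in>dirichlet_space p w k. (\<forall>f\<in>bergman_space p' w. has_A2_pairing w f g (L f)) \<and>
           dirichlet_norm p w k g \<le> C * bergman_dual_norm p' w L"
        by (elim bexE conjE) (intro bexI conjI)
    qed
  qed
  moreover have "stmt_iii" if "stmt_i"
    using projection_bounded_imp_identity_bounded[OF assms(2)] that unfolding stmt_i_def stmt_iii_def .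
  moreover have "stmt_iv" if "stmt_iii"
    using identity_bounded_imp_doubling[OF assms(2,4)] that unfolding stmt_iii_def stmt_iv_def .
  moreover have "stmt_ii" if "stmt_iv"
    using doubling_imp_duality[OF assms(2,3)] that unfolding stmt_ii_def stmt_iv_def .
  \<comment> \<open>The four implications close the cycle (ii), (i), (iii), (iv), (ii).\<close>
  ultimately show ?thesis by blast
qed

end
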